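(* Let $\mathcal I=[0,b)$, $X$, $d_n$ with $\sup_nd_n<\infty$, $\alpha=\{\alpha_n\}_{n=1}^\infty\subset\mathbb R$ and the operator $\mathrm H_{X,\alpha}$ in $L^2(\mathcal I)$ be as in the context. Then $\mathrm H_{X,\alpha}$ has equal deficiency indices and $\mathrm n_+(\mathrm H_{X,\alpha})=\mathrm n_-(\mathrm H_{X,\alpha})\le1$. Moreover, $\mathrm n_\pm(\mathrm H_{X,\alpha})=\mathrm n_\pm(B_{X,\alpha})$, where $B_{X,\alpha}$ is the minimal operator associated either with the Jacobi matrix $B^{(1)}_{X,\alpha}$ or with the Jacobi matrix $B^{(2)}_{X,\alpha}$ (the equality holds for each of the two). In particular, $\mathrm H_{X,\alpha}$ is self-adjoint if and only if $B_{X,\alpha}$ is.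
   Context: Let $\mathcal I=[0,b)$, $0<b\le+\infty$, and $X=\{x_n\}_{n=1}^\infty$, $x_0=0$, with $0=x_0<x_1<x_2<\dots<b$ and $\lim_nx_n=b$; $d_n=x_n-x_{n-1}$, and $d^*=\sup_nd_n<\infty$ is assumed. $W^{2,2}(\mathcal I\setminus X)=\{f\in L^2(\mathcal I): f,f'\in AC_{loc}(\mathcal I\setminus X),\ f''\in L^2(\mathcal I)\}$, and $W^{2,2}_{\mathrm{comp}}(\mathcal I\setminus X)$ is the set of its elements whose support is compact in $\mathcal I=[0,b)$. $\mathrm H_{X,\alpha}$ is the closure in $L^2(\mathcal I)$ of the symmetric operator $-\mathrm d^2/\mathrm dx^2$ with domain $$\{f\in W^{2,2}_{\mathrm{comp}}(\mathcal I\setminus X): f'(0)=0,\ f(x_n+)=f(x_n-),\ f'(x_n+)-f'(x_n-)=\alpha_nf(x_n),\ n\in\mathbb N\}.$$ $B^{(1)}_{X,\alpha}$ is the symmetric tridiagonal matrix with diagonal entries $r_n^{-2}\bigl(\alpha_n+\frac1{d_n}+\frac1{d_{n+1}}\bigr)$ and off-diagonal entries (positions $(n,n+1)$ and $(n+1,n)$) $-(r_nr_{n+1}d_{n+1})^{-1}$, where $r_n=\sqrt{d_n+d_{n+1}}$, $n\in\mathbb N$. $B^{(2)}_{X,\alpha}$ is the symmetric tridiagonal matrix with diagonal entries: $(1,1)$: $0$; $(2n,2n)$: $-d_n^{-2}$; $(2n+1,2n+1)$: $\alpha_nd_{n+1}^{-1}$; and off-diagonal entries $(2n-1,2n)$: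 $-d_n^{-2}$; $(2n,2n+1)$: $d_n^{-3/2}d_{n+1}^{-1/2}$, $n\in\mathbb N$. The minimal operator associated with a Jacobi matrix is the closure in $l_2(\mathbb N)$ of the operator defined by the matrix on finitely supported sequences. $\mathrm n_\pm(T)=\dim\ker(T^*\mp\mathrm i)$ are the deficiency indices. *)

theory Defs
  imports "HOL-Analysis.Analysis"
begin

section \<open>The Hilbert spaces \<open>L\<^sup>2(M)\<close> and operators in them\<close>

text \<open>
  An element of the complex Hilbert space \<open>L\<^sup>2(M)\<close> is represented by any square integrable
  function in its class; equality in the space is equality almost everywhere. A (generally
  unbounded) operator is represented by its graph, a set of pairs of representatives.
  The sequence space \<open>l\<^sub>2(\<nat>)\<close>, \<open>\<nat> = {1, 2, \<dots>}\<close>, is \<open>L\<^sup>2\<close> of the counting measure on \<open>{1..}\<close>.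
\<close>

definition L2 :: "'a measure \<Rightarrow> ('a \<Rightarrow> complex) set" where
  "L2 M = {f \<in> borel_measurable M. integrable M (\<lambda>t. (cmod (f t))\<^sup>2)}"

definition L2_inner :: "'a measure \<Rightarrow> ('a \<Rightarrow> complex) \<Rightarrow> ('a \<Rightarrow> complex) \<Rightarrow> complex" where
  "L2_inner M f g = (LINT t|M. f t * cnj (g t))"

definition L2_norm :: "'a measure \<Rightarrow> ('a \<Rightarrow> complex) \<Rightarrow> real" where
  "L2_norm M f = sqrt (LINT t|M. (cmod (f t))\<^sup>2)"

abbreviation l2_measure :: "nat measure" where
  "l2_measure \<equiv> count_space {1..}"

type_synonym 'a graph = "(('a \<Rightarrow> complex) \<times> ('a \<Rightarrow> complex)) set"

text \<open>The closure of a graph, and hence its adjoint and closure below, contains with every pair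
  all pairs that are equal to it almost everywhere.\<close>

definition op_closure :: "'a measure \<Rightarrow> 'a graph \<Rightarrow> 'a graph" where
  "op_closure M T = {(f, g). f \<in> L2 M \<and> g \<in> L2 M \<and>
     (\<forall>e>0. \<exists>(u, v)\<in>T. u \<in> L2 M \<and> v \<in> L2 M \<and>
        L2_norm M (\<lambda>t. f t - u t) < e \<and> L2_norm M (\<lambda>t. g t - v t) < e)}"

definition op_adjoint :: "'a measure \<Rightarrow> 'a graph \<Rightarrow> 'a graph" where
  "op_adjoint M T = {(f, g). f \<in> L2 M \<and> g \<in> L2 M \<and>
     (\<forall>(u, v)\<in>T. L2_inner M v f = L2_inner M u g)}"

definition op_selfadjoint :: "'a measure \<Rightarrow> 'a graph \<Rightarrow> bool" where
  "op_selfadjoint M T \<longleftrightarrow> op_adjoint M T = T"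

text \<open>\<open>ker (T - z)\<close>\<close>

definition op_eigenspace :: "'a graph \<Rightarrow> complex \<Rightarrow> ('a \<Rightarrow> complex) set" where
  "op_eigenspace T z = {f. (f, \<lambda>t. z * f t) \<in> T}"

text \<open>Dimension of a subspace of \<open>L\<^sup>2(M)\<close>: linear independence is understood modulo equality
  almost everywhere, and all infinite dimensions are identified with \<open>\<infinity>\<close>.\<close>

definition L2_independent :: "'a measure \<Rightarrow> nat \<Rightarrow> (nat \<Rightarrow> 'a \<Rightarrow> complex) \<Rightarrow> bool" where
  "L2_independent M n F \<longleftrightarrow>
     (\<forall>c :: nat \<Rightarrow> complex. (AE t in M. (\<Sum>i<n. c i * F i t) = 0) \<longrightarrow> (\<forall>i<n. c i = 0))"

definition L2_dim :: "'a measure \<Rightarrow> ('a \<Rightarrow> complex) set \<Rightarrow> enat" where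
  "L2_dim M S = Sup {enat n | n. \<exists>F. (\<forall>i<n. F i \<in> S) \<and> L2_independent M n F}"

definition n_plus :: "'a measure \<Rightarrow> 'a graph \<Rightarrow> enat" where
  "n_plus M T = L2_dim M (op_eigenspace (op_adjoint M T) \<i>)"

definition n_minus :: "'a measure \<Rightarrow> 'a graph \<Rightarrow> enat" where
  "n_minus M T = L2_dim M (op_eigenspace (op_adjoint M T) (- \<i>))"

section \<open>The Schroedinger operator with point interactions\<close>

definition half_open :: "ereal \<Rightarrow> real set" where
  "half_open b = {t. 0 \<le> t \<and> ereal t < b}"

text \<open>In \<open>division_of\<close> the members of \<open>D\<close> are compact intervals with disjoint interiors.\<close>

definition abs_cont_on :: "real set \<Rightarrow> (real \<Rightarrow> complex) \<Rightarrow> bool" where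
  "abs_cont_on S f \<longleftrightarrow> (\<forall>e>0. \<exists>\<delta>>0. \<forall>D.
     D division_of \<Union>D \<and> \<Union>D \<subseteq> S \<and> (\<Sum>k\<in>D. Sup k - Inf k) < \<delta> \<longrightarrow>
     (\<Sum>k\<in>D. cmod (f (Sup k) - f (Inf k))) < e)"

definition AC_loc :: "real set \<Rightarrow> (real \<Rightarrow> complex) \<Rightarrow> bool" where
  "AC_loc J f \<longleftrightarrow> (\<forall>a c. {a..c} \<subseteq> J \<longrightarrow> abs_cont_on {a..c} f)"

text \<open>Derivative relative to \<open>S\<close>; for \<open>S = [0, b)\<close> it is one-sided at \<open>0\<close>.\<close>

definition deriv_in :: "real set \<Rightarrow> (real \<Rightarrow> complex) \<Rightarrow> real \<Rightarrow> complex" where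
  "deriv_in S f t = vector_derivative f (at t within S)"

text \<open>\<open>X = {x\<^sub>n | n \<ge> 1}\<close> does not contain \<open>x\<^sub>0 = 0\<close>, so \<open>0 \<in> I - X\<close>. The differentiability of
  \<open>f'\<close> almost everywhere is a consequence of its local absolute continuity, and is required only
  because \<open>vector_derivative\<close> is unspecified where no derivative exists.\<close>

definition W22 :: "real set \<Rightarrow> real set \<Rightarrow> (real \<Rightarrow> complex) set" where
  "W22 I X = {f \<in> L2 (lebesgue_on I).
     AC_loc (I - X) f \<and>
     (\<forall>t\<in>I - X. f differentiable (at t within I)) \<and>
     AC_loc (I - X) (deriv_in I f) \<and>
     (AE t in lebesgue_on I. deriv_in I f differentiable (at t within I)) \<and>
     deriv_in I (deriv_in I f) \<in> L2 (lebesgue_on I)}"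

text \<open>The values of \<open>f\<close> on the null set \<open>X\<close> are immaterial and do not count for the support.\<close>

definition W22_comp :: "real set \<Rightarrow> real set \<Rightarrow> (real \<Rightarrow> complex) set" where
  "W22_comp I X = {f \<in> W22 I X. compact (I \<inter> closure {t \<in> I - X. f t \<noteq> 0})}"

text \<open>Here \<open>c = f(x\<^sub>n+) = f(x\<^sub>n-)\<close>, \<open>p = f'(x\<^sub>n+)\<close> and \<open>m = f'(x\<^sub>n-)\<close>.\<close>

definition delta_condition ::
    "real set \<Rightarrow> real \<Rightarrow> real \<Rightarrow> (real \<Rightarrow> complex) \<Rightarrow> bool" where
  "delta_condition I y a f \<longleftrightarrow> (\<exists>c p m.
     (f \<longlongrightarrow> c) (at_right y) \<and> (f \<longlongrightarrow> c) (at_left y) \<and>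
     (deriv_in I f \<longlongrightarrow> p) (at_right y) \<and> (deriv_in I f \<longlongrightarrow> m) (at_left y) \<and>
     p - m = of_real a * c)"

definition H_dom :: "ereal \<Rightarrow> (nat \<Rightarrow> real) \<Rightarrow> (nat \<Rightarrow> real) \<Rightarrow> (real \<Rightarrow> complex) set" where
  "H_dom b x \<alpha> = (let I = half_open b in
     {f \<in> W22_comp I (x ` {1..}).
        deriv_in I f 0 = 0 \<and> (\<forall>n\<ge>1. delta_condition I (x n) (\<alpha> n) f)})"

definition H_op :: "ereal \<Rightarrow> (nat \<Rightarrow> real) \<Rightarrow> (nat \<Rightarrow> real) \<Rightarrow> real graph" where
  "H_op b x \<alpha> = (let I = half_open b in
     op_closure (lebesgue_on I) {(f, \<lambda>t. - deriv_in I (deriv_in I f) t) | f. f \<in> H_dom b x \<alpha>})"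

section \<open>The Jacobi matrices\<close>

text \<open>Rows and columns are numbered from \<open>1\<close>.\<close>

definition gap :: "(nat \<Rightarrow> real) \<Rightarrow> nat \<Rightarrow> real" where
  "gap x n = x n - x (n - 1)"

text \<open>\<open>v n\<close> is the entry in the positions \<open>(n, n + 1)\<close> and \<open>(n + 1, n)\<close>.\<close>

definition jacobi :: "(nat \<Rightarrow> real) \<Rightarrow> (nat \<Rightarrow> real) \<Rightarrow> nat \<Rightarrow> nat \<Rightarrow> real" where
  "jacobi u v i j =
     (if i = j then u i else if j = i + 1 then v i else if i = j + 1 then v j else 0)"

definition min_op :: "(nat \<Rightarrow> nat \<Rightarrow> real) \<Rightarrow> nat graph" where
  "min_op A = op_closure l2_measure
     {(u, \<lambda>i. \<Sum>j | 1 \<le> j \<and> u j \<noteq> 0. of_real (A i j) * u j) | u. finite {j. 1 \<le> j \<and> u j \<noteq> 0}}"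

definition rr :: "(nat \<Rightarrow> real) \<Rightarrow> nat \<Rightarrow> real" where
  "rr x n = sqrt (gap x n + gap x (n + 1))"

definition B1 :: "(nat \<Rightarrow> real) \<Rightarrow> (nat \<Rightarrow> real) \<Rightarrow> nat \<Rightarrow> nat \<Rightarrow> real" where
  "B1 x \<alpha> = jacobi
     (\<lambda>n. (\<alpha> n + 1 / gap x n + 1 / gap x (n + 1)) / (rr x n)\<^sup>2)
     (\<lambda>n. - 1 / (rr x n * rr x (n + 1) * gap x (n + 1)))"

definition B2 :: "(nat \<Rightarrow> real) \<Rightarrow> (nat \<Rightarrow> real) \<Rightarrow> nat \<Rightarrow> nat \<Rightarrow> real" where
  "B2 x \<alpha> = jacobi
     (\<lambda>k. if k = 1 then 0
          else if even k then - 1 / (gap x (k div 2))\<^sup>2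
          else \<alpha> (k div 2) / gap x (k div 2 + 1))
     (\<lambda>k. if odd k then - 1 / (gap x ((k + 1) div 2))\<^sup>2
          else gap x (k div 2) powr (- (3 / 2)) * gap x (k div 2 + 1) powr (- (1 / 2)))"

lemma B2_entries:
  assumes "n \<ge> 1"
  shows "B2 x \<alpha> 1 1 = 0"
    and "B2 x \<alpha> (2 * n) (2 * n) = - 1 / (gap x n)\<^sup>2"
    and "B2 x \<alpha> (2 * n + 1) (2 * n + 1) = \<alpha> n / gap x (n + 1)"
    and "B2 x \<alpha> (2 * n - 1) (2 * n) = - 1 / (gap x n)\<^sup>2"
    and "B2 x \<alpha> (2 * n) (2 * n + 1) = gap x n powr (- (3 / 2)) * gap x (n + 1) powr (- (1 / 2))"
proof -
  obtain m where n: "n = Suc m" using assms by (cases n) auto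
  show "B2 x \<alpha> 1 1 = 0"
    and "B2 x \<alpha> (2 * n) (2 * n) = - 1 / (gap x n)\<^sup>2"
    and "B2 x \<alpha> (2 * n + 1) (2 * n + 1) = \<alpha> n / gap x (n + 1)"
    and "B2 x \<alpha> (2 * n - 1) (2 * n) = - 1 / (gap x n)\<^sup>2"
    and "B2 x \<alpha> (2 * n) (2 * n + 1) = gap x n powr (- (3 / 2)) * gap x (n + 1) powr (- (1 / 2))"
    by (auto simp: B2_def jacobi_def n)
qed

end

(* Weyl's limit point/limit circle alternative. The deficiency spaces of H and of a Jacobi operator are
   spanned by the solution of the eigenvalue equation at energy \<i> (resp. - \<i>) with the boundary
   condition at the left end, so the indices are equal and at most 1, and they are 1 iff this solution
   is square integrable. That solution p and its conjugate q have a Wronskian bounded away from 0, and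
   y W(p, q) = p W(y, q) - q W(y, p) for every solution y at energy 0; a Gronwall argument shows that
   square integrability of p passes to all such y, and likewise back. At energy 0 the three equations
   coincide: the solutions of H are piecewise linear, their values f n at x n and slopes g n are, up to
   weights, the solutions of the Jacobi equations, with equivalent norms. Hence H, B1 and B2 are in the
   limit circle case simultaneously. A closed symmetric operator is self-adjoint iff its indices vanish. *)

theory Submission
  imports Defs
begin


section \<open>Square integrable functions\<close>

text \<open>Elements of \<open>L2\<close> are functions and operators are sets of pairs of
  functions, so there is no quotient space: completeness and the projection onto a closed graph are
  proved for representatives, and a core is asked to be linear only almost everywhere. Elements of
  the adjoint of H are a priori weak solutions. No regularity is proved for them; variation of
  constants yields enough functions in the domain of H to show that such an element is, on each
  \<open>{0..x N}\<close>, orthogonal to everything orthogonal to the classical solution, hence a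
  multiple of it. Only the energies 0, \<i> and -\<i> are compared, at distance 1, so the energy
  difference drops out of the Gronwall estimates. At energy 0 the condition at the left end is left
  out and square integrability is asked of the whole two-dimensional solution space. This is
  essential: in terms of values f and slopes g, the first row of \<open>B1\<close> says f 0 = 0,
  that of \<open>B2\<close> says g 0 = 0, so the three operators share the equation but not the
  boundary condition.\<close>

lemma L2_D: "f \<in> L2 M \<Longrightarrow> f \<in> borel_measurable M" "f \<in> L2 M \<Longrightarrow> integrable M (\<lambda>t. (cmod (f t))\<^sup>2)"
  by (auto simp: L2_def)

lemma borel_measurable_cnj [measurable (raw)]:
  "f \<in> borel_measurable M \<Longrightarrow> (\<lambda>t. cnj (f t)) \<in> borel_measurable M"
  using measurable_compose[of f M borel cnj borel] borel_measurable_continuous_onI[of cnj] continuous_on_cnj[of UNIV "\<lambda>x. x"]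
  by (simp add: continuous_on_id)

lemma L2_scale: "f \<in> L2 M \<Longrightarrow> (\<lambda>t. c * f t) \<in> L2 M"
  by (auto simp: L2_def norm_mult power_mult_distrib)

lemma L2_cnj: "f \<in> L2 M \<Longrightarrow> (\<lambda>t. cnj (f t)) \<in> L2 M"
  by (auto simp: L2_def)

lemma L2_bound:
  assumes "f \<in> borel_measurable M" "integrable M g" "\<And>t. t \<in> space M \<Longrightarrow> (cmod (f t))\<^sup>2 \<le> g t"
  shows "f \<in> L2 M"
  unfolding L2_def using assms
  by (auto intro!: Bochner_Integration.integrable_bound[of M g] AE_I2 order.trans[OF assms(3)])

lemma L2_add:
  assumes "f \<in> L2 M" "g \<in> L2 M" shows "(\<lambda>t. f t + g t) \<in> L2 M"
proof (rule L2_bound)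
  fix t
  have "(cmod (f t + g t))\<^sup>2 \<le> (cmod (f t) + cmod (g t))\<^sup>2"
    by (simp add: norm_triangle_ineq power_mono)
  also have "\<dots> \<le> 2 * (cmod (f t))\<^sup>2 + 2 * (cmod (g t))\<^sup>2"
    using sum_squares_bound[of "cmod (f t)" "cmod (g t)"] by (simp add: power2_sum)
  finally show "(cmod (f t + g t))\<^sup>2 \<le> 2 * (cmod (f t))\<^sup>2 + 2 * (cmod (g t))\<^sup>2" .
qed (use assms in \<open>auto simp: L2_def\<close>)

lemma L2_minus: "f \<in> L2 M \<Longrightarrow> (\<lambda>t. - f t) \<in> L2 M"
  using L2_scale[of f M "-1"] by simp

lemma L2_diff: "f \<in> L2 M \<Longrightarrow> g \<in> L2 M \<Longrightarrow> (\<lambda>t. f t - g t) \<in> L2 M"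
  using L2_add[OF _ L2_minus] by fastforce

lemma L2_zero: "(\<lambda>t. 0) \<in> L2 M"
  by (simp add: L2_def)

lemma L2_cong_AE:
  assumes "f \<in> L2 M" "g \<in> borel_measurable M" "AE t in M. g t = f t" shows "g \<in> L2 M"
proof -
  have "integrable M (\<lambda>t. (cmod (g t))\<^sup>2) \<longleftrightarrow> integrable M (\<lambda>t. (cmod (f t))\<^sup>2)"
    using assms by (intro integrable_cong_AE) (auto simp: L2_def)
  then show ?thesis using assms by (auto simp: L2_def)
qed

lemma L2_abs_mult_integrable:
  assumes "f \<in> L2 M" "g \<in> L2 M" shows "integrable M (\<lambda>t. cmod (f t) * cmod (g t))"
proof (rule Bochner_Integration.integrable_bound)
  show "integrable M (\<lambda>t. (cmod (f t))\<^sup>2 + (cmod (g t))\<^sup>2)"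
    using assms by (auto simp: L2_def)
  have "norm (cmod (f t) * cmod (g t)) \<le> norm ((cmod (f t))\<^sup>2 + (cmod (g t))\<^sup>2)" for t
  proof -
    have "2 * cmod (f t) * cmod (g t) \<le> (cmod (f t))\<^sup>2 + (cmod (g t))\<^sup>2"
      by (rule sum_squares_bound)
    moreover have "0 \<le> cmod (f t) * cmod (g t)" by simp
    ultimately have "cmod (f t) * cmod (g t) \<le> (cmod (f t))\<^sup>2 + (cmod (g t))\<^sup>2" by linarith
    then show ?thesis by (simp add: norm_mult)
  qed
  then show "AE t in M. norm (cmod (f t) * cmod (g t)) \<le> norm ((cmod (f t))\<^sup>2 + (cmod (g t))\<^sup>2)"
    by simp
qed (use assms in \<open>auto simp: L2_def\<close>)

lemma L2_mult_integrable:
  assumes "f \<in> L2 M" "g \<in> L2 M" shows "integrable M (\<lambda>t. f t * g t)"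
  using L2_abs_mult_integrable[OF assms] assms
  by (auto intro!: Bochner_Integration.integrable_bound[OF L2_abs_mult_integrable[OF assms]] simp: L2_def norm_mult)

lemma L2_inner_integrable:
  assumes "f \<in> L2 M" "g \<in> L2 M" shows "integrable M (\<lambda>t. f t * cnj (g t))"
  using L2_mult_integrable[OF assms(1) L2_cnj[OF assms(2)]] .

section \<open>Norm and inner product of \<open>L2\<close>\<close>

lemma L2_norm_nonneg: "0 \<le> L2_norm M f"
  by (simp add: L2_norm_def)

lemma L2_norm_sq: "(L2_norm M f)\<^sup>2 = (LINT t|M. (cmod (f t))\<^sup>2)"
  by (simp add: L2_norm_def)

lemma L2_norm_eq_0:
  assumes "f \<in> L2 M" shows "L2_norm M f = 0 \<longleftrightarrow> (AE t in M. f t = 0)"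
  using integral_nonneg_eq_0_iff_AE[OF L2_D(2)[OF assms]] by (simp add: L2_norm_def)

lemma L2_norm_cong_AE:
  assumes "f \<in> borel_measurable M" "g \<in> borel_measurable M" "AE t in M. f t = g t"
  shows "L2_norm M f = L2_norm M g"
proof -
  have "(LINT t|M. (cmod (f t))\<^sup>2) = (LINT t|M. (cmod (g t))\<^sup>2)"
    using assms by (intro integral_cong_AE) auto
  then show ?thesis by (simp add: L2_norm_def)
qed

lemma L2_inner_cong_AE:
  assumes "f \<in> borel_measurable M" "g \<in> borel_measurable M" "AE t in M. f t = g t"
    and "f' \<in> borel_measurable M" "g' \<in> borel_measurable M" "AE t in M. f' t = g' t"
  shows "L2_inner M f f' = L2_inner M g g'"
proof -
  show ?thesis unfolding L2_inner_def using assms by (intro integral_cong_AE) auto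
qed

lemma L2_norm_minus: "L2_norm M (\<lambda>t. - f t) = L2_norm M f"
  by (simp add: L2_norm_def)

lemma L2_norm_minus_commute: "L2_norm M (\<lambda>t. f t - g t) = L2_norm M (\<lambda>t. g t - f t)"
  by (simp add: L2_norm_def norm_minus_commute)

lemma L2_norm_scale: "L2_norm M (\<lambda>t. c * f t) = cmod c * L2_norm M f"
  by (simp add: L2_norm_def norm_mult power_mult_distrib real_sqrt_mult)

lemma L2_Cauchy_Schwarz_abs:
  assumes "f \<in> L2 M" "g \<in> L2 M"
  shows "(LINT t|M. cmod (f t) * cmod (g t)) \<le> L2_norm M f * L2_norm M g"
proof -
  let ?a = "L2_norm M f" and ?b = "L2_norm M g"
  note int = L2_abs_mult_integrable[OF assms]
  show ?thesis
  proof (cases "?a = 0 \<or> ?b = 0")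
    case True
    then have "(AE t in M. f t = 0) \<or> (AE t in M. g t = 0)"
      using L2_norm_eq_0 assms by blast
    then have "AE t in M. cmod (f t) * cmod (g t) = 0" by auto
    then have "(LINT t|M. cmod (f t) * cmod (g t)) = 0" by (rule integral_eq_zero_AE)
    then show ?thesis using True by auto
  next
    case False
    then have pos: "?a > 0" "?b > 0" using L2_norm_nonneg[of M f] L2_norm_nonneg[of M g] by auto
    have "2 * (LINT t|M. cmod (f t) * cmod (g t)) = (LINT t|M. 2 * (cmod (f t) * cmod (g t)))"
      by simp
    \<comment> \<open>The weights are chosen so that each of the two terms integrates to
      \<open>?a * ?b\<close>.\<close>
    also have "\<dots> \<le> (LINT t|M. ?b / ?a * (cmod (f t))\<^sup>2 + ?a / ?b * (cmod (g t))\<^sup>2)"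
    proof (rule integral_mono)
      fix t
      have "0 \<le> (?b * cmod (f t) - ?a * cmod (g t))\<^sup>2 / (?a * ?b)"
        using pos by simp
      also have "\<dots> = ?b / ?a * (cmod (f t))\<^sup>2 + ?a / ?b * (cmod (g t))\<^sup>2 - 2 * (cmod (f t) * cmod (g t))"
        using pos by (simp add: field_simps power2_eq_square)
      finally show "2 * (cmod (f t) * cmod (g t)) \<le> ?b / ?a * (cmod (f t))\<^sup>2 + ?a / ?b * (cmod (g t))\<^sup>2"
        by simp
    qed (use int assms in \<open>auto simp: L2_def\<close>)
    also have "\<dots> = ?b / ?a * ?a\<^sup>2 + ?a / ?b * ?b\<^sup>2"
      using assms unfolding L2_norm_sq by (simp add: L2_def)
    also have "\<dots> = 2 * (?a * ?b)" using pos by (simp add: field_simps power2_eq_square)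
    finally show ?thesis by simp
  qed
qed

lemma L2_Cauchy_Schwarz:
  assumes "f \<in> L2 M" "g \<in> L2 M"
  shows "cmod (L2_inner M f g) \<le> L2_norm M f * L2_norm M g"
proof -
  have "cmod (L2_inner M f g) \<le> (LINT t|M. cmod (f t * cnj (g t)))"
    unfolding L2_inner_def by (rule integral_norm_bound)
  also have "\<dots> \<le> L2_norm M f * L2_norm M g"
    using L2_Cauchy_Schwarz_abs[OF assms] by (simp add: norm_mult)
  finally show ?thesis .
qed

lemma L2_inner_add_left:
  "f \<in> L2 M \<Longrightarrow> g \<in> L2 M \<Longrightarrow> h \<in> L2 M \<Longrightarrow>
    L2_inner M (\<lambda>t. f t + g t) h = L2_inner M f h + L2_inner M g h"
  unfolding L2_inner_def using L2_inner_integrable[of f M h] L2_inner_integrable[of g M h]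
  by (simp add: ring_distribs)

lemma L2_inner_diff_left:
  "f \<in> L2 M \<Longrightarrow> g \<in> L2 M \<Longrightarrow> h \<in> L2 M \<Longrightarrow>
    L2_inner M (\<lambda>t. f t - g t) h = L2_inner M f h - L2_inner M g h"
  unfolding L2_inner_def using L2_inner_integrable[of f M h] L2_inner_integrable[of g M h]
  by (simp add: ring_distribs)

lemma L2_inner_scale_left: "L2_inner M (\<lambda>t. c * f t) h = c * L2_inner M f h"
  unfolding L2_inner_def by (simp add: mult.assoc)

lemma L2_inner_commute: "L2_inner M f g = cnj (L2_inner M g f)"
proof -
  have "cnj (L2_inner M g f) = (LINT t|M. cnj (g t * cnj (f t)))"
    unfolding L2_inner_def by (rule Bochner_Integration.integral_cnj[symmetric])
  then show ?thesis by (simp add: L2_inner_def mult.commute)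
qed

lemma L2_inner_add_right:
  "f \<in> L2 M \<Longrightarrow> g \<in> L2 M \<Longrightarrow> h \<in> L2 M \<Longrightarrow>
    L2_inner M h (\<lambda>t. f t + g t) = L2_inner M h f + L2_inner M h g"
  using L2_inner_add_left[of f M g h] by (metis L2_inner_commute complex_cnj_add)

lemma L2_inner_diff_right:
  "f \<in> L2 M \<Longrightarrow> g \<in> L2 M \<Longrightarrow> h \<in> L2 M \<Longrightarrow>
    L2_inner M h (\<lambda>t. f t - g t) = L2_inner M h f - L2_inner M h g"
  using L2_inner_diff_left[of f M g h] by (metis L2_inner_commute complex_cnj_diff)

lemma L2_inner_scale_right: "L2_inner M h (\<lambda>t. c * f t) = cnj c * L2_inner M h f"
  using L2_inner_scale_left[of M c f h] by (metis L2_inner_commute complex_cnj_mult)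

lemma L2_inner_self: "L2_inner M f f = of_real ((L2_norm M f)\<^sup>2)"
proof -
  have "L2_inner M f f = (LINT t|M. of_real ((cmod (f t))\<^sup>2))"
    unfolding L2_inner_def by (intro Bochner_Integration.integral_cong refl complex_norm_square[symmetric])
  then show ?thesis unfolding L2_norm_sq by (simp only: integral_complex_of_real)
qed

lemma L2_norm_add_sq:
  assumes "f \<in> L2 M" "g \<in> L2 M"
  shows "(L2_norm M (\<lambda>t. f t + g t))\<^sup>2
    = (L2_norm M f)\<^sup>2 + (L2_norm M g)\<^sup>2 + 2 * Re (L2_inner M f g)"
proof -
  have "L2_inner M (\<lambda>t. f t + g t) (\<lambda>t. f t + g t)
      = L2_inner M f f + L2_inner M f g + (L2_inner M g f + L2_inner M g g)"
    using assms by (simp add: L2_inner_add_left L2_inner_add_right L2_add)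
  also have "L2_inner M g f = cnj (L2_inner M f g)" by (rule L2_inner_commute)
  finally have "Re (L2_inner M (\<lambda>t. f t + g t) (\<lambda>t. f t + g t))
    = Re (L2_inner M f f) + Re (L2_inner M g g) + 2 * Re (L2_inner M f g)"
    by simp
  then show ?thesis by (simp add: L2_inner_self)
qed

lemma L2_norm_triangle:
  assumes "f \<in> L2 M" "g \<in> L2 M"
  shows "L2_norm M (\<lambda>t. f t + g t) \<le> L2_norm M f + L2_norm M g"
proof (rule power2_le_imp_le)
  have "Re (L2_inner M f g) \<le> L2_norm M f * L2_norm M g"
    using complex_Re_le_cmod order_trans L2_Cauchy_Schwarz[OF assms] by blast
  then show "(L2_norm M (\<lambda>t. f t + g t))\<^sup>2 \<le> (L2_norm M f + L2_norm M g)\<^sup>2"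
    by (simp add: L2_norm_add_sq[OF assms] power2_sum)
qed (simp add: L2_norm_nonneg)

lemma L2_norm_diff_triangle:
  assumes "f \<in> L2 M" "g \<in> L2 M" "h \<in> L2 M"
  shows "L2_norm M (\<lambda>t. f t - h t) \<le> L2_norm M (\<lambda>t. f t - g t) + L2_norm M (\<lambda>t. g t - h t)"
  using L2_norm_triangle[of "\<lambda>t. f t - g t" M "\<lambda>t. g t - h t"] assms by (simp add: L2_diff)

lemma L2_norm_sum_triangle:
  fixes n :: nat
  assumes "\<And>k. k < n \<Longrightarrow> F k \<in> L2 M"
  shows "(\<lambda>t. \<Sum>k<n. F k t) \<in> L2 M \<and> L2_norm M (\<lambda>t. \<Sum>k<n. F k t) \<le> (\<Sum>k<n. L2_norm M (F k))"
  using assms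
proof (induction n)
  case 0 then show ?case by (simp add: L2_zero L2_norm_def)
next
  case (Suc n)
  then have IH: "(\<lambda>t. \<Sum>k<n. F k t) \<in> L2 M" "L2_norm M (\<lambda>t. \<Sum>k<n. F k t) \<le> (\<Sum>k<n. L2_norm M (F k))"
    and Fn: "F n \<in> L2 M" by auto
  then show ?case using L2_norm_triangle[OF IH(1) Fn] L2_add[OF IH(1) Fn] by simp
qed

lemma L2_nn_integral:
  assumes "f \<in> L2 M" shows "(\<integral>\<^sup>+t. ennreal ((cmod (f t))\<^sup>2) \<partial>M) = ennreal ((L2_norm M f)\<^sup>2)"
  unfolding L2_norm_sq using L2_D(2)[OF assms] by (simp add: nn_integral_eq_integral)

text \<open>The nonnegative integral exists before integrability is known; this is the form in which
  Fatou's lemma and monotone convergence deliver their bounds.\<close>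

lemma L2_nn_integral_le:
  assumes "f \<in> borel_measurable M" "(\<integral>\<^sup>+t. ennreal ((cmod (f t))\<^sup>2) \<partial>M) \<le> ennreal (c\<^sup>2)" "0 \<le> c"
  shows "f \<in> L2 M \<and> L2_norm M f \<le> c"
proof -
  have "integrable M (\<lambda>t. (cmod (f t))\<^sup>2)"
    using assms by (intro integrableI_bounded) (auto simp: le_less_trans ennreal_less_top)
  then have f: "f \<in> L2 M" using assms by (auto simp: L2_def)
  then have "(L2_norm M f)\<^sup>2 \<le> c\<^sup>2"
    using assms(2) by (simp add: L2_nn_integral)
  then show ?thesis using f assms(3) power2_le_imp_le by blast
qed

section \<open>Completeness of \<open>L2\<close>\<close>

lemma half_geometric_sum_le: "(\<Sum>j<k. (1/2::real)^j) \<le> 2"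
proof -
  have "(\<Sum>j<k. (1/2::real)^j) = 2 - 2 * (1/2)^k" by (induction k) auto
  then show ?thesis by simp
qed

text \<open>Riesz-Fischer for geometrically small increments. The sums of the moduli of the
  increments have norm at most 2, so the increments are absolutely summable almost everywhere;
  Fatou's lemma then shows that the pointwise limit is also the limit in norm, with a rate.\<close>

lemma L2_complete:
  assumes F: "\<And>n. F n \<in> L2 M" and fast: "\<And>n. L2_norm M (\<lambda>t. F (Suc n) t - F n t) \<le> (1/2)^n"
  obtains f where "f \<in> L2 M" "\<And>n. L2_norm M (\<lambda>t. F n t - f t) \<le> 2 * (1/2)^n"
proof -
  note [measurable] = L2_D(1)[OF F]
  have dist: "L2_norm M (\<lambda>t. F (n + k) t - F n t) \<le> 2 * (1/2)^n" for n k
  proof -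
    have "L2_norm M (\<lambda>t. F (n + k) t - F n t) \<le> (\<Sum>j<k. (1/2)^(n + j))"
    proof (induction k)
      case 0 then show ?case by (simp add: L2_norm_def)
    next
      case (Suc k)
      have "L2_norm M (\<lambda>t. F (n + Suc k) t - F n t)
        \<le> L2_norm M (\<lambda>t. F (Suc (n + k)) t - F (n + k) t) + L2_norm M (\<lambda>t. F (n + k) t - F n t)"
        using L2_norm_diff_triangle[OF F[of "Suc (n + k)"] F[of "n + k"] F[of n]] by simp
      also have "\<dots> \<le> (1/2)^(n + k) + (\<Sum>j<k. (1/2)^(n + j))"
        using fast[of "n + k"] Suc by simp
      finally show ?case by simp
    qed
    also have "\<dots> = (1/2)^n * (\<Sum>j<k. (1/2)^j)" by (simp add: power_add sum_distrib_left)
    also have "(\<Sum>j<k. (1/2::real)^j) \<le> 2" by (rule half_geometric_sum_le)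
    finally show ?thesis by (simp add: mult.commute)
  qed
  define G where "G n t = (\<Sum>k<n. cmod (F (Suc k) t - F k t))" for n t
  have G2: "(\<integral>\<^sup>+t. ennreal ((G n t)\<^sup>2) \<partial>M) \<le> 4" for n
  proof -
    \<comment> \<open>The triangle inequality for sums is about complex functions, so the real
      moduli are embedded.\<close>
    define D where "D k t = complex_of_real (cmod (F (Suc k) t - F k t))" for k t
    have [measurable]: "D k \<in> borel_measurable M" for k unfolding D_def by measurable
    have D: "D k \<in> L2 M \<and> L2_norm M (D k) = L2_norm M (\<lambda>t. F (Suc k) t - F k t)" for k
      using L2_diff[OF F F, of "Suc k" k] by (auto simp: L2_def L2_norm_def) (auto simp: D_def)
    have eq: "(\<lambda>t. \<Sum>k<n. D k t) = (\<lambda>t. complex_of_real (G n t))"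
      by (simp add: D_def G_def)
    have in2: "(\<lambda>t. complex_of_real (G n t)) \<in> L2 M"
      and "L2_norm M (\<lambda>t. complex_of_real (G n t)) \<le> (\<Sum>k<n. L2_norm M (D k))"
      using L2_norm_sum_triangle[of n D M] D unfolding eq by auto
    note this(2)
    also have "(\<Sum>k<n. L2_norm M (D k)) \<le> (\<Sum>k<n. (1/2)^k)" using D fast by (auto intro: sum_mono)
    also have "\<dots> \<le> 2" by (rule half_geometric_sum_le)
    finally have "L2_norm M (\<lambda>t. complex_of_real (G n t)) \<le> 2" .
    then have "(L2_norm M (\<lambda>t. complex_of_real (G n t)))\<^sup>2 \<le> 2\<^sup>2"
      by (intro power_mono L2_norm_nonneg)
    then have "ennreal ((L2_norm M (\<lambda>t. complex_of_real (G n t)))\<^sup>2) \<le> ennreal 4"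
      by (intro ennreal_leI) simp
    with L2_nn_integral[OF in2] show ?thesis by simp
  qed
  have [measurable]: "G n \<in> borel_measurable M" for n unfolding G_def by measurable
  have Gmono: "G m t \<le> G n t" if "m \<le> n" for m n t
    unfolding G_def using that by (intro sum_mono2) auto
  have G0: "0 \<le> G n t" for n t unfolding G_def by (intro sum_nonneg) auto
  have "(\<integral>\<^sup>+t. (SUP n. ennreal ((G n t)\<^sup>2)) \<partial>M) = (SUP n. \<integral>\<^sup>+t. ennreal ((G n t)\<^sup>2) \<partial>M)"
    by (intro nn_integral_monotone_convergence_SUP)
      (auto simp: incseq_def le_fun_def intro!: ennreal_leI power_mono Gmono G0)
  also have "\<dots> \<le> 4" using G2 by (auto intro: SUP_least)
  finally have "(\<integral>\<^sup>+t. (SUP n. ennreal ((G n t)\<^sup>2)) \<partial>M) \<noteq> \<infinity>"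
    by (auto simp: top_unique)
  then have "AE t in M. (SUP n. ennreal ((G n t)\<^sup>2)) \<noteq> \<infinity>"
    by (intro nn_integral_PInf_AE) auto
  then have conv: "AE t in M. (\<lambda>n. F n t) \<longlonglongrightarrow> lim (\<lambda>n. F n t)"
  proof (eventually_elim)
    case (elim t)
    then obtain c where c: "(SUP n. ennreal ((G n t)\<^sup>2)) = ennreal c" "c \<ge> 0"
      by (metis ennreal_cases infinity_ennreal_def)
    have "(G n t)\<^sup>2 \<le> c" for n
    proof -
      have "ennreal ((G n t)\<^sup>2) \<le> ennreal c" unfolding c(1)[symmetric] by (rule SUP_upper) simp
      then show ?thesis using c by simp
    qed
    then have "G n t \<le> sqrt c" for n by (simp add: real_le_rsqrt)
    then have "summable (\<lambda>k. cmod (F (Suc k) t - F k t))"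
      unfolding G_def by (intro summableI_nonneg_bounded[where x="sqrt c"]) auto
    then have "summable (\<lambda>k. F (Suc k) t - F k t)" by (rule summable_norm_cancel)
    then have "convergent (\<lambda>n. \<Sum>k<n. F (Suc k) t - F k t)" by (simp add: summable_iff_convergent)
    then have "convergent (\<lambda>n. F n t - F 0 t)" by (simp only: sum_lessThan_telescope[of "\<lambda>n. F n t"])
    then have "convergent (\<lambda>n. F n t - F 0 t + F 0 t)" by (intro convergent_add convergent_const)
    then show ?case by (simp add: convergent_LIMSEQ_iff)
  qed
  define f where "f t = lim (\<lambda>n. F n t)" for t
  have [measurable]: "f \<in> borel_measurable M" unfolding f_def by (rule borel_measurable_lim_metric) measurable
  have diff: "(\<lambda>t. F n t - f t) \<in> L2 M \<and> L2_norm M (\<lambda>t. F n t - f t) \<le> 2 * (1/2)^n" for n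
  proof (rule L2_nn_integral_le)
    \<comment> \<open>The distance to the limit is written as a lower limit of distances to later
      terms, ready for Fatou's lemma.\<close>
    have "(\<integral>\<^sup>+t. ennreal ((cmod (F n t - f t))\<^sup>2) \<partial>M)
      = (\<integral>\<^sup>+t. liminf (\<lambda>k. ennreal ((cmod (F n t - F (n + k) t))\<^sup>2)) \<partial>M)"
    proof (rule nn_integral_cong_AE, use conv in eventually_elim)
      case (elim t)
      have "(\<lambda>k. F (n + k) t) \<longlonglongrightarrow> f t"
        using LIMSEQ_ignore_initial_segment[OF elim, of n] by (simp add: f_def add.commute)
      then have "(\<lambda>k. ennreal ((cmod (F n t - F (n + k) t))\<^sup>2)) \<longlonglongrightarrow> ennreal ((cmod (F n t - f t))\<^sup>2)"
        by (intro tendsto_intros)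
      then show ?case by (metis lim_imp_Liminf sequentially_bot)
    qed
    also have "\<dots> \<le> liminf (\<lambda>k. \<integral>\<^sup>+t. ennreal ((cmod (F n t - F (n + k) t))\<^sup>2) \<partial>M)"
      by (intro nn_integral_liminf) auto
    also have "\<dots> \<le> ennreal ((2 * (1/2)^n)\<^sup>2)"
    proof -
      have "(\<integral>\<^sup>+t. ennreal ((cmod (F n t - F (n + k) t))\<^sup>2) \<partial>M) \<le> ennreal ((2 * (1/2)^n)\<^sup>2)" for k
        using power_mono[OF dist[of n k] L2_norm_nonneg, of 2]
        by (simp only: L2_nn_integral[OF L2_diff[OF F F]] L2_norm_minus_commute[of M "F n"] ennreal_leI)
      then show ?thesis by (intro Liminf_le) (auto intro: always_eventually)
    qed
    finally show "(\<integral>\<^sup>+t. ennreal ((cmod (F n t - f t))\<^sup>2) \<partial>M) \<le> ennreal ((2 * (1/2)^n)\<^sup>2)" .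
  qed auto
  have "f \<in> L2 M" using L2_diff[OF F[of 0] conjunct1[OF diff[of 0]]] by simp
  with diff that show thesis by blast
qed


section \<open>Closed symmetric operators\<close>

lemma op_closure_L2: "(f, g) \<in> op_closure M T \<Longrightarrow> f \<in> L2 M \<and> g \<in> L2 M"
  by (simp add: op_closure_def)

lemma op_closure_approx:
  assumes "(f, g) \<in> op_closure M T" "e > 0"
  obtains u v where "(u, v) \<in> T" "u \<in> L2 M" "v \<in> L2 M"
    "L2_norm M (\<lambda>t. f t - u t) < e" "L2_norm M (\<lambda>t. g t - v t) < e"
  using assms unfolding op_closure_def by fast

lemma op_closure_superset:
  assumes "T \<subseteq> L2 M \<times> L2 M" shows "T \<subseteq> op_closure M T"
proof clarify
  fix f g assume fg: "(f, g) \<in> T"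
  then have "f \<in> L2 M" "g \<in> L2 M" using assms by auto
  moreover have "L2_norm M (\<lambda>t. h t - h t) = 0" for h :: "'a \<Rightarrow> complex" by (simp add: L2_norm_def)
  ultimately show "(f, g) \<in> op_closure M T"
    using fg unfolding op_closure_def by (auto intro!: bexI[of _ "(f, g)"])
qed

lemma op_closure_cong_AE:
  assumes fg: "(f, g) \<in> op_closure M T" and f': "f' \<in> L2 M" "AE t in M. f' t = f t"
    and g': "g' \<in> L2 M" "AE t in M. g' t = g t"
  shows "(f', g') \<in> op_closure M T"
proof -
  have "\<exists>(u, v)\<in>T. u \<in> L2 M \<and> v \<in> L2 M \<and>
      L2_norm M (\<lambda>t. f' t - u t) < e \<and> L2_norm M (\<lambda>t. g' t - v t) < e" if e: "e > 0" for e
  proof -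
    obtain u v where uv: "(u, v) \<in> T" "u \<in> L2 M" "v \<in> L2 M"
      "L2_norm M (\<lambda>t. f t - u t) < e" "L2_norm M (\<lambda>t. g t - v t) < e"
      by (rule op_closure_approx[OF fg e])
    have "L2_norm M (\<lambda>t. f' t - u t) = L2_norm M (\<lambda>t. f t - u t)"
      using f' uv op_closure_L2[OF fg] by (intro L2_norm_cong_AE) (auto intro!: L2_D(1) L2_diff)
    moreover have "L2_norm M (\<lambda>t. g' t - v t) = L2_norm M (\<lambda>t. g t - v t)"
      using g' uv op_closure_L2[OF fg] by (intro L2_norm_cong_AE) (auto intro!: L2_D(1) L2_diff)
    ultimately show ?thesis using uv by (intro bexI[of _ "(u, v)"]) auto
  qed
  then show ?thesis using f' g' unfolding op_closure_def by blast
qed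

lemma op_closure_closed:
  assumes F: "\<And>n. (F n, G n) \<in> op_closure M T" and fg: "f \<in> L2 M" "g \<in> L2 M"
    and lim: "(\<lambda>n. L2_norm M (\<lambda>t. F n t - f t)) \<longlonglongrightarrow> 0" "(\<lambda>n. L2_norm M (\<lambda>t. G n t - g t)) \<longlonglongrightarrow> 0"
  shows "(f, g) \<in> op_closure M T"
proof -
  have "\<exists>(u, v)\<in>T. u \<in> L2 M \<and> v \<in> L2 M \<and>
      L2_norm M (\<lambda>t. f t - u t) < e \<and> L2_norm M (\<lambda>t. g t - v t) < e" if e: "e > 0" for e
  proof -
    have "\<forall>\<^sub>F n in sequentially. L2_norm M (\<lambda>t. F n t - f t) < e/2 \<and> L2_norm M (\<lambda>t. G n t - g t) < e/2"
      using e by (intro eventually_conj order_tendstoD(2)[OF lim(1)] order_tendstoD(2)[OF lim(2)]) auto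
    then obtain n where n: "L2_norm M (\<lambda>t. F n t - f t) < e/2" "L2_norm M (\<lambda>t. G n t - g t) < e/2"
      by (auto simp: eventually_sequentially)
    obtain u v where uv: "(u, v) \<in> T" "u \<in> L2 M" "v \<in> L2 M"
      "L2_norm M (\<lambda>t. F n t - u t) < e/2" "L2_norm M (\<lambda>t. G n t - v t) < e/2"
      by (rule op_closure_approx[OF F[of n] half_gt_zero[OF e]])
    have FG: "F n \<in> L2 M" "G n \<in> L2 M" using op_closure_L2[OF F] by auto
    have "L2_norm M (\<lambda>t. f t - u t) < e"
      using L2_norm_diff_triangle[OF fg(1) FG(1) uv(2)] n(1) uv(4) L2_norm_minus_commute[of M f "F n"] by simp
    moreover have "L2_norm M (\<lambda>t. g t - v t) < e"
      using L2_norm_diff_triangle[OF fg(2) FG(2) uv(3)] n(2) uv(5) L2_norm_minus_commute[of M g "G n"] by simp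
    ultimately show ?thesis using uv by (intro bexI[of _ "(u, v)"]) auto
  qed
  then show ?thesis using fg unfolding op_closure_def by blast
qed

text \<open>Both sides are continuous in \<open>(f, g)\<close> by the Cauchy-Schwarz inequality.
  Used twice: for the adjoint of a closure and for the symmetry of a closure.\<close>

lemma L2_inner_eq_op_closure:
  assumes fg: "(f, g) \<in> op_closure M T" and uv: "u \<in> L2 M" "v \<in> L2 M"
    and eq: "\<And>f' g'. (f', g') \<in> T \<Longrightarrow> f' \<in> L2 M \<Longrightarrow> g' \<in> L2 M \<Longrightarrow> L2_inner M v f' = L2_inner M u g'"
  shows "L2_inner M v f = L2_inner M u g"
proof -
  \<comment> \<open>The summand 1 keeps the divisor positive when \<open>u\<close> and
    \<open>v\<close> are null; approximation within \<open>e / ?K\<close> makes the two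
    Cauchy-Schwarz terms add up to at most \<open>e\<close>.\<close>
  let ?K = "L2_norm M v + L2_norm M u + 1"
  have K: "?K > 0" using L2_norm_nonneg[of M u] L2_norm_nonneg[of M v] by linarith
  have L: "f \<in> L2 M" "g \<in> L2 M" using op_closure_L2[OF fg] by auto
  have small: "cmod (L2_inner M v f - L2_inner M u g) \<le> e" if e: "e > 0" for e
  proof -
    obtain f' g' where f': "(f', g') \<in> T" "f' \<in> L2 M" "g' \<in> L2 M"
      "L2_norm M (\<lambda>t. f t - f' t) < e / ?K" "L2_norm M (\<lambda>t. g t - g' t) < e / ?K"
      by (rule op_closure_approx[OF fg divide_pos_pos[OF e K]])
    have "L2_inner M v f - L2_inner M u g
        = L2_inner M v (\<lambda>t. f t - f' t) - L2_inner M u (\<lambda>t. g t - g' t)"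
      using L f' uv eq[OF f'(1-3)] by (simp add: L2_inner_diff_right)
    also have "cmod \<dots> \<le> L2_norm M v * L2_norm M (\<lambda>t. f t - f' t) + L2_norm M u * L2_norm M (\<lambda>t. g t - g' t)"
      using L2_Cauchy_Schwarz[OF uv(2) L2_diff[OF L(1) f'(2)]] L2_Cauchy_Schwarz[OF uv(1) L2_diff[OF L(2) f'(3)]]
      by (meson add_mono norm_triangle_ineq4 order_trans)
    also have "\<dots> \<le> L2_norm M v * (e / ?K) + L2_norm M u * (e / ?K)"
      using f' by (intro add_mono mult_left_mono L2_norm_nonneg) auto
    also have "\<dots> = (L2_norm M v + L2_norm M u) * (e / ?K)" by (simp only: distrib_right)
    also have "\<dots> \<le> ?K * (e / ?K)" using K e by (intro mult_right_mono) auto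
    also have "\<dots> = e" using K by simp
    finally show ?thesis .
  qed
  have "cmod (L2_inner M v f - L2_inner M u g) \<le> 0"
    by (rule field_le_epsilon, unfold add_0, rule small)
  then show ?thesis by simp
qed

text \<open>Lets the deficiency spaces of the closed operators be computed on their cores, where the
  elements are explicit.\<close>

lemma op_adjoint_closure:
  assumes "T \<subseteq> L2 M \<times> L2 M"
  shows "op_adjoint M (op_closure M T) = op_adjoint M T"
proof
  show "op_adjoint M (op_closure M T) \<subseteq> op_adjoint M T"
    using op_closure_superset[OF assms] unfolding op_adjoint_def by blast
  show "op_adjoint M T \<subseteq> op_adjoint M (op_closure M T)"
  proof clarify
    fix f g assume fg: "(f, g) \<in> op_adjoint M T"
    then have L: "f \<in> L2 M" "g \<in> L2 M" by (auto simp: op_adjoint_def)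
    \<comment> \<open>The closure lemma varies the right-hand arguments of the inner products, the
      adjoint the left-hand ones; conjugation exchanges them.\<close>
    have eq: "L2_inner M g u' = L2_inner M f v'" if "(u', v') \<in> T" for u' v'
    proof -
      have "L2_inner M v' f = L2_inner M u' g" using that fg unfolding op_adjoint_def by blast
      then show ?thesis by (metis L2_inner_commute)
    qed
    have "L2_inner M v f = L2_inner M u g" if "(u, v) \<in> op_closure M T" for u v
      using L2_inner_eq_op_closure[OF that L] eq by (metis L2_inner_commute)
    then show "(f, g) \<in> op_adjoint M (op_closure M T)"
      using L unfolding op_adjoint_def by blast
  qed
qed

text \<open>Representatives of classes need not be closed under pointwise linear combinations.\<close>

definition graph_subspace :: "'a measure \<Rightarrow> 'a graph \<Rightarrow> bool" where
  "graph_subspace M T \<longleftrightarrow> T \<noteq> {} \<and> T \<subseteq> L2 M \<times> L2 M \<and>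
     (\<forall>(u, v)\<in>T. \<forall>(u', v')\<in>T. \<forall>c. \<exists>(p, q)\<in>T.
        (AE t in M. p t = c * u t + u' t) \<and> (AE t in M. q t = c * v t + v' t))"

definition graph_symmetric :: "'a measure \<Rightarrow> 'a graph \<Rightarrow> bool" where
  "graph_symmetric M T \<longleftrightarrow> (\<forall>(u, v)\<in>T. \<forall>(u', v')\<in>T. L2_inner M v u' = L2_inner M u v')"

lemma graph_subspaceI:
  assumes "T \<noteq> {}" "T \<subseteq> L2 M \<times> L2 M"
    and "\<And>u v u' v' c. (u, v) \<in> T \<Longrightarrow> (u', v') \<in> T \<Longrightarrow>
      \<exists>(p, q)\<in>T. (AE t in M. p t = c * u t + u' t) \<and> (AE t in M. q t = c * v t + v' t)"
  shows "graph_subspace M T"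
  unfolding graph_subspace_def using assms(1,2) assms(3) by (intro conjI ballI; clarify) blast+

lemma graph_symmetricI:
  assumes "\<And>u v u' v'. (u, v) \<in> T \<Longrightarrow> (u', v') \<in> T \<Longrightarrow> L2_inner M v u' = L2_inner M u v'"
  shows "graph_symmetric M T"
  unfolding graph_symmetric_def using assms by clarify

text \<open>The closure contains every representative of its pairs, so here linear combinations are
  available pointwise, not just almost everywhere. The projection argument relies on this.\<close>

lemma op_closure_linear:
  assumes T: "graph_subspace M T" and fg: "(f, g) \<in> op_closure M T" "(f', g') \<in> op_closure M T"
  shows "(\<lambda>t. c * f t + f' t, \<lambda>t. c * g t + g' t) \<in> op_closure M T"
proof -
  have L: "f \<in> L2 M" "g \<in> L2 M" "f' \<in> L2 M" "g' \<in> L2 M" using op_closure_L2 fg by auto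
  have aux: "L2_norm M (\<lambda>t. c * h t + h' t - p t) < e"
    if "h \<in> L2 M" "h' \<in> L2 M" "k \<in> L2 M" "k' \<in> L2 M" "p \<in> L2 M" "AE t in M. p t = c * k t + k' t"
      "L2_norm M (\<lambda>t. h t - k t) < e / (cmod c + 1)" "L2_norm M (\<lambda>t. h' t - k' t) < e / (cmod c + 1)" "e > 0"
    for h h' k k' p :: "'a \<Rightarrow> complex" and e :: real
  proof -
    have "L2_norm M (\<lambda>t. c * h t + h' t - p t) = L2_norm M (\<lambda>t. c * (h t - k t) + (h' t - k' t))"
      using that by (intro L2_norm_cong_AE) (auto intro!: L2_D(1) L2_diff L2_add L2_scale simp: algebra_simps)
    also have "\<dots> \<le> cmod c * L2_norm M (\<lambda>t. h t - k t) + L2_norm M (\<lambda>t. h' t - k' t)"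
      using L2_norm_triangle[OF L2_scale[OF L2_diff[of h M k], of c] L2_diff[of h' M k']] that
      by (simp add: L2_norm_scale)
    also have "\<dots> < cmod c * (e / (cmod c + 1)) + e / (cmod c + 1)"
      using that by (intro add_le_less_mono mult_left_mono) auto
    also have "\<dots> = (cmod c + 1) * (e / (cmod c + 1))" by (simp only: distrib_right mult_1)
    also have "\<dots> = e" using norm_ge_zero[of c] by (simp add: add_nonneg_eq_0_iff)
    finally show ?thesis .
  qed
  have "\<exists>(p, q)\<in>T. p \<in> L2 M \<and> q \<in> L2 M \<and>
      L2_norm M (\<lambda>t. c * f t + f' t - p t) < e \<and> L2_norm M (\<lambda>t. c * g t + g' t - q t) < e"
    if e: "e > 0" for e
  proof -
    let ?d = "e / (cmod c + 1)"
    have d: "?d > 0" using e by (simp add: add_nonneg_pos)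
    obtain u v where uv: "(u, v) \<in> T" "u \<in> L2 M" "v \<in> L2 M"
      "L2_norm M (\<lambda>t. f t - u t) < ?d" "L2_norm M (\<lambda>t. g t - v t) < ?d"
      by (rule op_closure_approx[OF fg(1) d])
    obtain u' v' where uv': "(u', v') \<in> T" "u' \<in> L2 M" "v' \<in> L2 M"
      "L2_norm M (\<lambda>t. f' t - u' t) < ?d" "L2_norm M (\<lambda>t. g' t - v' t) < ?d"
      by (rule op_closure_approx[OF fg(2) d])
    obtain p q where pq: "(p, q) \<in> T" "AE t in M. p t = c * u t + u' t" "AE t in M. q t = c * v t + v' t"
      using T uv(1) uv'(1) unfolding graph_subspace_def by fast
    then have "p \<in> L2 M" "q \<in> L2 M" using T unfolding graph_subspace_def by auto
    then show ?thesis
      using pq aux[OF L(1,3) uv(2) uv'(2) _ pq(2) uv(4) uv'(4) e]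
        aux[OF L(2,4) uv(3) uv'(3) _ pq(3) uv(5) uv'(5) e]
      by (intro bexI[of _ "(p, q)"]) auto
  qed
  then show ?thesis using L unfolding op_closure_def by (auto intro!: L2_add L2_scale)
qed

text \<open>The inclusion in self-adjointness that holds for every symmetric operator.\<close>

lemma op_closure_symmetric:
  assumes T: "T \<subseteq> L2 M \<times> L2 M" and sym: "graph_symmetric M T"
  shows "op_closure M T \<subseteq> op_adjoint M T"
proof clarify
  fix f g assume fg: "(f, g) \<in> op_closure M T"
  have "L2_inner M v f = L2_inner M u g" if "(u, v) \<in> T" for u v
    using T that sym by (intro L2_inner_eq_op_closure[OF fg]) (auto simp: graph_symmetric_def)
  then show "(f, g) \<in> op_adjoint M T" using op_closure_L2[OF fg] unfolding op_adjoint_def by blast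
qed

text \<open>Orthogonal projection onto the closed graph for the graph inner product of
  \<open>L2 M \<times> L2 M\<close>: a minimising sequence is Cauchy by the parallelogram law, and
  the minimiser satisfies the first-order condition.\<close>

lemma op_closure_projection:
  assumes T: "graph_subspace M T" and fg: "f \<in> L2 M" "g \<in> L2 M"
  obtains u v where "(u, v) \<in> op_closure M T"
    "\<And>u' v'. (u', v') \<in> op_closure M T \<Longrightarrow>
      L2_inner M u' (\<lambda>t. f t - u t) + L2_inner M v' (\<lambda>t. g t - v t) = 0"
proof -
  let ?T = "op_closure M T"
  define Q where "Q a b = (L2_norm M a)\<^sup>2 + (L2_norm M b)\<^sup>2" for a b :: "'a \<Rightarrow> complex"
  define dist where "dist p = Q (\<lambda>t. f t - fst p t) (\<lambda>t. g t - snd p t)" for p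
  define D where "D = Inf (dist ` ?T)"
  have Q0: "Q a b \<ge> 0" for a b by (simp add: Q_def)
  have bdd: "bdd_below (dist ` ?T)" by (rule bdd_belowI[of _ 0]) (auto simp: dist_def Q0)
  have D: "D \<le> dist p" if "p \<in> ?T" for p unfolding D_def using that by (intro cInf_lower bdd) auto
  have ne: "?T \<noteq> {}" using T op_closure_superset[of T M] unfolding graph_subspace_def by auto
  \<comment> \<open>With this excess the parallelogram law bounds the squared distance of
    consecutive terms by (2/16 + 2/4) times (1/4)^n, which is what \<open>L2_complete\<close>
    requires.\<close>
  have "\<exists>p\<in>?T. dist p < D + (1/4)^(Suc n)" for n :: nat
    using cInf_lessD[of "dist ` ?T" "D + (1/4)^(Suc n)"] ne unfolding D_def by auto
  then obtain P where P: "\<And>n. P n \<in> ?T" "\<And>n. dist (P n) < D + (1/4)^(Suc n)" by metis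
  define U V where "U n = fst (P n)" and "V n = snd (P n)" for n
  have UV: "(U n, V n) \<in> ?T" for n using P(1) by (simp add: U_def V_def)
  have L: "U n \<in> L2 M" "V n \<in> L2 M" for n using op_closure_L2[OF UV] by auto
  \<comment> \<open>Parallelogram law for \<open>a - h\<close> and \<open>a - k\<close>; half their
    sum is the distance vector from \<open>a\<close> to the midpoint of \<open>h\<close> and
    \<open>k\<close>.\<close>
  have par1: "(L2_norm M (\<lambda>t. h t - k t))\<^sup>2 = 2 * (L2_norm M (\<lambda>t. a t - h t))\<^sup>2 + 2 * (L2_norm M (\<lambda>t. a t - k t))\<^sup>2
      - 4 * (L2_norm M (\<lambda>t. a t - (1/2 * h t + 1/2 * k t)))\<^sup>2"
    if "h \<in> L2 M" "k \<in> L2 M" "a \<in> L2 M" for h k a :: "'a \<Rightarrow> complex"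
  proof -
    let ?x = "\<lambda>t. a t - h t" and ?y = "\<lambda>t. a t - k t"
    have x: "?x \<in> L2 M" "?y \<in> L2 M" using that L2_diff by auto
    have "(\<lambda>t. h t - k t) = (\<lambda>t. ?y t + - ?x t)" by auto
    moreover have "(\<lambda>t. 2 * (a t - (1/2 * h t + 1/2 * k t))) = (\<lambda>t. ?x t + ?y t)" by (auto simp: field_simps)
    moreover have "(L2_norm M (\<lambda>t. 2 * (a t - (1/2 * h t + 1/2 * k t))))\<^sup>2
        = 4 * (L2_norm M (\<lambda>t. a t - (1/2 * h t + 1/2 * k t)))\<^sup>2"
      unfolding L2_norm_scale by (simp add: power_mult_distrib)
    moreover have "L2_inner M ?y (\<lambda>t. - ?x t) = - L2_inner M ?y ?x"
      using L2_inner_scale_right[of M ?y "-1" ?x] by simp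
    moreover have "Re (L2_inner M ?y ?x) = Re (L2_inner M ?x ?y)"
      using L2_inner_commute[of M ?x ?y] by simp
    ultimately show ?thesis
      using L2_norm_add_sq[OF x(2) L2_minus[OF x(1)]] L2_norm_add_sq[OF x] L2_norm_minus[of M ?x] by simp
  qed
  have close: "Q (\<lambda>t. U (Suc n) t - U n t) (\<lambda>t. V (Suc n) t - V n t) \<le> ((1/2)^n)\<^sup>2" for n
  proof -
    let ?m = "(\<lambda>t. 1/2 * U (Suc n) t + 1/2 * U n t, \<lambda>t. 1/2 * V (Suc n) t + 1/2 * V n t)"
    \<comment> \<open>Linearity is available only in the form \<open>c * f + f'\<close>, so halving
      a pair goes through the zero element.\<close>
    have zero: "(\<lambda>t. -1 * a t + a t, \<lambda>t. -1 * b t + b t) \<in> ?T" if "(a, b) \<in> ?T" for a b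
      using op_closure_linear[OF T that that] .
    have half: "(\<lambda>t. 1/2 * a t, \<lambda>t. 1/2 * b t) \<in> ?T" if "(a, b) \<in> ?T" for a b
      using op_closure_linear[OF T that zero[OF that], of "1/2"] by simp
    have "?m \<in> ?T" using op_closure_linear[OF T UV half[OF UV], of "Suc n" n]
      using op_closure_linear[OF T UV[of "Suc n"] half[OF UV[of n]], of "1/2"] by simp
    then have "D \<le> dist ?m" by (rule D)
    moreover have "Q (\<lambda>t. U (Suc n) t - U n t) (\<lambda>t. V (Suc n) t - V n t)
      = 2 * dist (P (Suc n)) + 2 * dist (P n) - 4 * dist ?m"
      using par1[OF L(1) L(1) fg(1), of "Suc n" n] par1[OF L(2) L(2) fg(2), of "Suc n" n]
      unfolding Q_def dist_def U_def V_def by simp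
    moreover have "((1/2::real)^n)\<^sup>2 = (1/4)^n" by (simp add: power2_eq_square power_mult_distrib[symmetric])
    moreover have "(1/4::real)^Suc n = (1/4)^n / 4" "(1/4::real)^Suc (Suc n) = (1/4)^n / 16" "(0::real) \<le> (1/4)^n"
      by auto
    ultimately show ?thesis using P(2)[of n] P(2)[of "Suc n"] by linarith
  qed
  have fast: "L2_norm M (\<lambda>t. U (Suc n) t - U n t) \<le> (1/2)^n" "L2_norm M (\<lambda>t. V (Suc n) t - V n t) \<le> (1/2)^n" for n
  proof -
    have sq: "(L2_norm M (\<lambda>t. U (Suc n) t - U n t))\<^sup>2 \<le> ((1/2)^n)\<^sup>2"
      "(L2_norm M (\<lambda>t. V (Suc n) t - V n t))\<^sup>2 \<le> ((1/2)^n)\<^sup>2"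
      using close[of n] zero_le_power2[of "L2_norm M (\<lambda>t. U (Suc n) t - U n t)"]
        zero_le_power2[of "L2_norm M (\<lambda>t. V (Suc n) t - V n t)"] unfolding Q_def by linarith+
    show "L2_norm M (\<lambda>t. U (Suc n) t - U n t) \<le> (1/2)^n" "L2_norm M (\<lambda>t. V (Suc n) t - V n t) \<le> (1/2)^n"
      by (rule power2_le_imp_le[OF sq(1)], simp) (rule power2_le_imp_le[OF sq(2)], simp)
  qed
  obtain u where u: "u \<in> L2 M" "\<And>n. L2_norm M (\<lambda>t. U n t - u t) \<le> 2 * (1/2)^n"
    using L2_complete[of U M] L fast by blast
  obtain v where v: "v \<in> L2 M" "\<And>n. L2_norm M (\<lambda>t. V n t - v t) \<le> 2 * (1/2)^n"
    using L2_complete[of V M] L fast by blast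
  have geo: "(\<lambda>n. 2 * (1/2::real)^n) \<longlonglongrightarrow> 0" by (auto intro!: tendsto_eq_intros LIMSEQ_power_zero)
  have limU: "(\<lambda>n. L2_norm M (\<lambda>t. U n t - u t)) \<longlonglongrightarrow> 0"
    by (rule tendsto_sandwich[OF _ _ tendsto_const geo]) (auto simp: u L2_norm_nonneg)
  have limV: "(\<lambda>n. L2_norm M (\<lambda>t. V n t - v t)) \<longlonglongrightarrow> 0"
    by (rule tendsto_sandwich[OF _ _ tendsto_const geo]) (auto simp: v L2_norm_nonneg)
  have uv: "(u, v) \<in> ?T" by (rule op_closure_closed[OF UV u(1) v(1) limU limV])
  have "dist (u, v) \<le> D"
  proof (rule LIMSEQ_le)
    have "(\<lambda>n. D + (1/4)^(Suc n)) \<longlonglongrightarrow> D + 0"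
      by (intro tendsto_intros LIMSEQ_Suc LIMSEQ_power_zero) auto
    then show "(\<lambda>n. D + (1/4)^(Suc n)) \<longlonglongrightarrow> D" by simp
    show "\<exists>N. \<forall>n\<ge>N. dist (P n) \<le> D + (1/4)^(Suc n)" using P(2) less_imp_le by blast
    have lim: "(\<lambda>n. L2_norm M (\<lambda>t. h t - F n t)) \<longlonglongrightarrow> L2_norm M (\<lambda>t. h t - a t)"
      if "(\<lambda>n. L2_norm M (\<lambda>t. F n t - a t)) \<longlonglongrightarrow> 0" "\<And>n. F n \<in> L2 M" "h \<in> L2 M" "a \<in> L2 M"
      for F and h a :: "'a \<Rightarrow> complex"
    proof (rule LIM_zero_cancel, rule Lim_null_comparison[OF _ that(1)], rule always_eventually, rule allI)
      fix n
      show "norm (L2_norm M (\<lambda>t. h t - F n t) - L2_norm M (\<lambda>t. h t - a t)) \<le> L2_norm M (\<lambda>t. F n t - a t)"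
        using L2_norm_diff_triangle[OF that(3) that(2)[of n] that(4)]
          L2_norm_diff_triangle[OF that(3) that(4) that(2)[of n]] L2_norm_minus_commute[of M a "F n"]
        by (simp add: abs_le_iff)
    qed
    show "(\<lambda>n. dist (P n)) \<longlonglongrightarrow> dist (u, v)"
      unfolding dist_def Q_def fst_conv snd_conv U_def[symmetric] V_def[symmetric]
      by (intro tendsto_intros lim limU limV L fg u(1) v(1))
  qed
  define r s where "r t = f t - u t" and "s t = g t - v t" for t
  have rs: "r \<in> L2 M" "s \<in> L2 M" using fg u v by (auto simp: r_def[abs_def] s_def[abs_def] intro!: L2_diff)
  have "L2_inner M u' r + L2_inner M v' s = 0" if uv': "(u', v') \<in> ?T" for u' v'
  proof (rule ccontr)
    define z where "z = L2_inner M u' r + L2_inner M v' s"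
    assume "L2_inner M u' r + L2_inner M v' s \<noteq> 0"
    then have z: "z \<noteq> 0" by (simp add: z_def)
    have L': "u' \<in> L2 M" "v' \<in> L2 M" using op_closure_L2[OF uv'] by auto
    have ineq: "0 \<le> e * (cmod z)\<^sup>2 * (e * Q u' v' - 2)" for e :: real
    proof -
      \<comment> \<open>Direction of steepest descent: it makes \<open>d * z\<close> the negative
        number - e |z|^2.\<close>
      define d where "d = - (of_real e * cnj z)"
      have "(\<lambda>t. - d * u' t + u t, \<lambda>t. - d * v' t + v t) \<in> ?T"
        using op_closure_linear[OF T uv' uv] .
      then have "dist (u, v) \<le> dist (\<lambda>t. - d * u' t + u t, \<lambda>t. - d * v' t + v t)"
        using D \<open>dist (u, v) \<le> D\<close> order_trans by blast
      also have "\<dots> = Q (\<lambda>t. d * u' t + r t) (\<lambda>t. d * v' t + s t)"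
        by (simp add: dist_def r_def s_def algebra_simps)
      also have "\<dots> = (cmod d)\<^sup>2 * Q u' v' + Q r s + 2 * Re (d * z)"
        unfolding Q_def L2_norm_add_sq[OF L2_scale[OF L'(1)] rs(1)] L2_norm_add_sq[OF L2_scale[OF L'(2)] rs(2)]
          L2_norm_scale L2_inner_scale_left power_mult_distrib z_def
        by (simp add: algebra_simps)
      also have "dist (u, v) = Q r s" by (simp add: dist_def r_def[abs_def] s_def[abs_def])
      finally have "0 \<le> (cmod d)\<^sup>2 * Q u' v' + 2 * Re (d * z)" by simp
      also have "d * z = of_real (- (e * (cmod z)\<^sup>2))"
        unfolding d_def of_real_minus of_real_mult complex_norm_square by simp
      also have "Re (of_real (- (e * (cmod z)\<^sup>2))) = - (e * (cmod z)\<^sup>2)"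
        by (rule Re_complex_of_real)
      also have "(cmod d)\<^sup>2 = e\<^sup>2 * (cmod z)\<^sup>2" by (simp add: d_def norm_mult power_mult_distrib)
      finally show ?thesis by (simp add: algebra_simps power2_eq_square)
    qed
    \<comment> \<open>Small enough that the quadratic term stays below the linear one; the 1 covers
      \<open>Q u' v' = 0\<close>.\<close>
    define e where "e = 1 / (Q u' v' + 1)"
    have e: "e > 0" "e * Q u' v' < 2" using Q0[of u' v'] by (auto simp: e_def field_simps)
    then have "e * (cmod z)\<^sup>2 * (e * Q u' v' - 2) < 0" using z by (intro mult_pos_neg) auto
    then show False using ineq[of e] by linarith
  qed
  then show thesis using that[OF uv] by (simp add: r_def[abs_def] s_def[abs_def])
qed

text \<open>Any two elements are proportional, so the dimension is at most 1. If
  \<open>\<phi>\<close> is not square integrable, no nonzero multiple of it is either, and only null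
  functions remain.\<close>

lemma L2_dim_line:
  assumes \<phi>: "\<phi> \<in> borel_measurable M" "\<not> (AE t in M. \<phi> t = 0)"
  shows "L2_dim M {f \<in> L2 M. \<exists>c. AE t in M. f t = c * \<phi> t} = (if \<phi> \<in> L2 M then 1 else 0)" (is "L2_dim M ?S = _")
proof -
  let ?A = "{enat n |n. \<exists>F. (\<forall>i<n. F i \<in> ?S) \<and> L2_independent M n F}"
  have one: "n \<le> 1" if F: "\<forall>i<n. F i \<in> ?S" and ind: "L2_independent M n F" for n F
  proof (rule ccontr)
    assume "\<not> n \<le> 1"
    then have n: "0 < n" "1 < n" by auto
    obtain a where a: "AE t in M. F 0 t = a * \<phi> t" using F n by auto
    obtain b where b: "AE t in M. F 1 t = b * \<phi> t" using F n by auto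
    have sum2: "(\<Sum>i<n. (if i = 0 then p else if i = 1 then q else 0) * F i t) = p * F 0 t + q * F 1 t" for p q t
    proof -
      have "(\<Sum>i<n. (if i = 0 then p else if i = 1 then q else 0) * F i t)
        = (\<Sum>i\<in>{0, 1}. (if i = 0 then p else if i = 1 then q else 0) * F i t)"
        using n by (intro sum.mono_neutral_right) auto
      then show ?thesis by simp
    qed
    have *: "p = 0 \<and> q = 0" if "AE t in M. p * F 0 t + q * F 1 t = 0" for p q
    proof -
      have "AE t in M. (\<Sum>i<n. (if i = 0 then p else if i = 1 then q else 0) * F i t) = 0"
        using that by (simp only: sum2)
      then have "\<forall>i<n. (if i = 0 then p else if i = 1 then q else 0) = 0"
        using ind[unfolded L2_independent_def, THEN spec, THEN mp] by fast
      from this[rule_format, OF n(1)] this[rule_format, OF n(2)] show ?thesis by simp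
    qed
    \<comment> \<open>\<open>b * F 0 - a * F 1\<close> vanishes, so independence forces
      \<open>a = b = 0\<close>; but then \<open>F 0\<close> itself is null, against
      independence.\<close>
    have "b = 0 \<and> - a = 0" by (rule *, use a b in eventually_elim) simp
    then have "1 = (0::complex) \<and> 0 = (0::complex)" using a by (intro *) auto
    then show False by simp
  qed
  show ?thesis
  proof (cases "\<phi> \<in> L2 M")
    case True
    then have "\<phi> \<in> ?S" by (auto intro!: exI[of _ 1])
    moreover have "L2_independent M 1 (\<lambda>i. \<phi>)"
      unfolding L2_independent_def using \<phi>(2) by auto
    ultimately have "enat 1 \<in> ?A" by fastforce
    then have "enat 1 \<le> L2_dim M ?S" unfolding L2_dim_def by (rule Sup_upper)
    moreover have "L2_dim M ?S \<le> enat 1" unfolding L2_dim_def using one by (intro Sup_least) auto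
    ultimately show ?thesis using True by (simp add: one_enat_def)
  next
    case False
    have zero: "AE t in M. f t = 0" if f: "f \<in> ?S" for f
    proof -
      obtain c where c: "AE t in M. f t = c * \<phi> t" using f by blast
      have "c = 0"
      proof (rule ccontr)
        assume "c \<noteq> 0"
        then have "AE t in M. \<phi> t = 1 / c * f t" using c by auto
        then show False using False L2_cong_AE[OF L2_scale, of f M \<phi> "1/c"] f \<phi>(1) by auto
      qed
      then show ?thesis using c by simp
    qed
    have "n = 0" if F: "\<forall>i<n. F i \<in> ?S" and ind: "L2_independent M n F" for n F
    proof (rule ccontr)
      assume "n \<noteq> 0"
      then have n: "0 < n" by simp
      have sum1: "(\<Sum>i<n. (if i = 0 then 1 else 0) * F i t) = F 0 t" for t
      proof -
        have "(\<Sum>i<n. (if i = 0 then 1 else 0) * F i t) = (\<Sum>i\<in>{0}. (if i = 0 then 1 else 0) * F i t)"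
          using n by (intro sum.mono_neutral_right) auto
        then show ?thesis by simp
      qed
      have "AE t in M. F 0 t = 0" using F n zero by blast
      then have "AE t in M. (\<Sum>i<n. (if i = 0 then 1 else 0) * F i t) = 0" by (simp only: sum1)
      then have "\<forall>i<n. (if i = 0 then 1 else 0) = (0::complex)"
        using ind[unfolded L2_independent_def, THEN spec, THEN mp] by fast
      from this[rule_format, OF n] show False by simp
    qed
    then have "L2_dim M ?S \<le> 0" unfolding L2_dim_def by (intro Sup_least) (auto simp: zero_enat_def)
    then show ?thesis using False by simp
  qed
qed

text \<open>A symmetric operator has no nonreal eigenvalue.\<close>

lemma L2_norm_0_of_eigen_symmetric:
  assumes f: "f \<in> L2 M" and z: "z = \<i> \<or> z = - \<i>" and eq: "L2_inner M (\<lambda>t. z * f t) f = L2_inner M f (\<lambda>t. z * f t)"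
  shows "AE t in M. f t = 0"
proof -
  have "z * L2_inner M f f = cnj z * L2_inner M f f"
    using eq by (simp add: L2_inner_scale_left L2_inner_scale_right)
  then have "L2_inner M f f = 0" using z by (auto simp: complex_eq_iff)
  then have "L2_norm M f = 0" by (simp add: L2_inner_self)
  then show ?thesis using L2_norm_eq_0[OF f] by simp
qed

text \<open>If the defect spaces vanish, the component of an element of \<open>T\<^sup>*\<close> orthogonal to \<open>T\<close> in the
  graph inner product vanishes: for such \<open>(r, s)\<close> also \<open>(s, - r) \<in> T\<^sup>*\<close>, so that
  \<open>s \<plusminus> \<i> r\<close> lie in the defect spaces.\<close>

theorem deficiency_dichotomy:
  assumes T: "graph_subspace M T" and sym: "graph_symmetric M T"
    and \<phi>: "\<phi> \<in> borel_measurable M" "\<not> (AE t in M. \<phi> t = 0)"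
    and eig: "op_eigenspace (op_adjoint M T) \<i> = {f \<in> L2 M. \<exists>c. AE t in M. f t = c * \<phi> t}"
    and eig': "op_eigenspace (op_adjoint M T) (- \<i>) = {f \<in> L2 M. \<exists>c. AE t in M. f t = c * cnj (\<phi> t)}"
  shows "n_plus M (op_closure M T) = (if \<phi> \<in> L2 M then 1 else 0)"
    and "n_minus M (op_closure M T) = (if \<phi> \<in> L2 M then 1 else 0)"
    and "op_selfadjoint M (op_closure M T) \<longleftrightarrow> \<phi> \<notin> L2 M"
proof -
  have TL: "T \<subseteq> L2 M \<times> L2 M" using T by (simp add: graph_subspace_def)
  note adj = op_adjoint_closure[OF TL]
  have cnjL2: "(\<lambda>t. cnj (\<phi> t)) \<in> L2 M \<longleftrightarrow> \<phi> \<in> L2 M"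
    using L2_cnj[of \<phi> M] L2_cnj[of "\<lambda>t. cnj (\<phi> t)" M] by auto
  show "n_plus M (op_closure M T) = (if \<phi> \<in> L2 M then 1 else 0)"
    unfolding n_plus_def adj eig by (rule L2_dim_line[OF \<phi>])
  show "n_minus M (op_closure M T) = (if \<phi> \<in> L2 M then 1 else 0)"
    unfolding n_minus_def adj eig' using L2_dim_line[of "\<lambda>t. cnj (\<phi> t)" M] \<phi> cnjL2 by auto
  show "op_selfadjoint M (op_closure M T) \<longleftrightarrow> \<phi> \<notin> L2 M"
  proof
    assume sa: "op_selfadjoint M (op_closure M T)"
    show "\<phi> \<notin> L2 M"
    proof
      assume L: "\<phi> \<in> L2 M"
      then have "\<phi> \<in> op_eigenspace (op_adjoint M T) \<i>" unfolding eig by (auto intro!: exI[of _ 1])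
      \<comment> \<open>If the closure equals its adjoint, \<open>\<phi>\<close> is an eigenvector
        of it for \<i>, and pairing \<open>\<phi>\<close> with itself contradicts symmetry.\<close>
      then have in_adj: "(\<phi>, \<lambda>t. \<i> * \<phi> t) \<in> op_adjoint M (op_closure M T)"
        by (simp add: op_eigenspace_def adj)
      then have "(\<phi>, \<lambda>t. \<i> * \<phi> t) \<in> op_closure M T" using sa by (simp add: op_selfadjoint_def)
      with in_adj have "L2_inner M (\<lambda>t. \<i> * \<phi> t) \<phi> = L2_inner M \<phi> (\<lambda>t. \<i> * \<phi> t)"
        unfolding op_adjoint_def by blast
      then show False using L2_norm_0_of_eigen_symmetric[OF L] \<phi>(2) by blast
    qed
  next
    assume notL: "\<phi> \<notin> L2 M"
    have zero: "AE t in M. f t = 0" if "f \<in> L2 M" "AE t in M. f t = c * p t" "p \<in> borel_measurable M" "p \<notin> L2 M" for f p c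
    proof -
      have "c = 0"
      proof (rule ccontr)
        assume "c \<noteq> 0"
        then have "AE t in M. p t = 1 / c * f t" using that(2) by auto
        then show False using that L2_cong_AE[OF L2_scale, of f M p "1/c"] by auto
      qed
      then show ?thesis using that by simp
    qed
    have ker: "AE t in M. f t = 0" if "(f, \<lambda>t. z * f t) \<in> op_adjoint M T" "z = \<i> \<or> z = - \<i>" for f z
    proof -
      have f: "f \<in> op_eigenspace (op_adjoint M T) z" using that by (simp add: op_eigenspace_def)
      from that(2) show ?thesis
      proof
        assume "z = \<i>"
        then obtain c where "f \<in> L2 M" "AE t in M. f t = c * \<phi> t" using f eig by auto
        then show ?thesis by (rule zero[OF _ _ \<phi>(1) notL])
      next
        assume "z = - \<i>"
        then obtain c where "f \<in> L2 M" "AE t in M. f t = c * cnj (\<phi> t)" using f eig' by auto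
        then show ?thesis by (rule zero) (use \<phi>(1) cnjL2 notL in auto)
      qed
    qed
    note sub = op_closure_symmetric[OF TL sym]
    have "op_adjoint M T \<subseteq> op_closure M T"
    proof clarify
      fix f g assume fg: "(f, g) \<in> op_adjoint M T"
      then have L: "f \<in> L2 M" "g \<in> L2 M" by (auto simp: op_adjoint_def)
      obtain u v where uv: "(u, v) \<in> op_closure M T"
        and orth: "\<And>u' v'. (u', v') \<in> op_closure M T \<Longrightarrow>
          L2_inner M u' (\<lambda>t. f t - u t) + L2_inner M v' (\<lambda>t. g t - v t) = 0"
        using op_closure_projection[OF T L] by blast
      define r s where "r t = f t - u t" and "s t = g t - v t" for t
      have Luv: "u \<in> L2 M" "v \<in> L2 M" using op_closure_L2[OF uv] by auto
      have rs: "r \<in> L2 M" "s \<in> L2 M" using L Luv by (auto simp: r_def[abs_def] s_def[abs_def] intro!: L2_diff)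
      have uv_adj: "(u, v) \<in> op_adjoint M T" using uv sub by blast
      have eq1: "L2_inner M v' r = L2_inner M u' s" if uv': "(u', v') \<in> T" for u' v'
      proof -
        have L': "u' \<in> L2 M" "v' \<in> L2 M" using uv' TL by auto
        have "L2_inner M v' f = L2_inner M u' g" "L2_inner M v' u = L2_inner M u' v"
          using fg uv_adj uv' unfolding op_adjoint_def by blast+
        then show ?thesis using L Luv L' unfolding r_def[abs_def] s_def[abs_def]
          by (simp add: L2_inner_diff_right)
      qed
      have eq2: "L2_inner M v' s = - L2_inner M u' r" if "(u', v') \<in> T" for u' v'
      proof -
        have "(u', v') \<in> op_closure M T" using op_closure_superset[OF TL] that by blast
        from orth[OF this] show ?thesis
          unfolding r_def[abs_def, symmetric] s_def[abs_def, symmetric] by (metis add.commute eq_neg_iff_add_eq_0)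
      qed
      have "AE t in M. s t + z * r t = 0" if z: "z = \<i> \<or> z = - \<i>" for z
      proof (rule ker[OF _ z])
        have "L2_inner M v' (\<lambda>t. s t + z * r t) = L2_inner M u' (\<lambda>t. z * (s t + z * r t))" if "(u', v') \<in> T" for u' v'
        proof -
          have L': "u' \<in> L2 M" "v' \<in> L2 M" using that TL by auto
          have "L2_inner M v' (\<lambda>t. s t + z * r t) = L2_inner M v' s + cnj z * L2_inner M v' r"
            using rs L' by (simp add: L2_inner_add_right L2_scale L2_inner_scale_right)
          also have "\<dots> = - L2_inner M u' r + cnj z * L2_inner M u' s" by (simp add: eq1[OF that] eq2[OF that])
          \<comment> \<open>Here the square of \<open>cnj z\<close> is -1.\<close>
          also have "\<dots> = cnj z * (L2_inner M u' s + cnj z * L2_inner M u' r)"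
            using z by (auto simp: algebra_simps)
          also have "\<dots> = L2_inner M u' (\<lambda>t. z * (s t + z * r t))"
            using rs L' by (simp add: L2_inner_add_right L2_scale L2_inner_scale_right)
          finally show ?thesis .
        qed
        then show "(\<lambda>t. s t + z * r t, \<lambda>t. z * (s t + z * r t)) \<in> op_adjoint M T"
          using rs unfolding op_adjoint_def by (auto intro!: L2_add L2_scale)
      qed
      from this[of \<i>] this[of "- \<i>"] have "AE t in M. s t + \<i> * r t = 0" "AE t in M. s t - \<i> * r t = 0" by auto
      then have "AE t in M. f t = u t \<and> g t = v t"
      proof eventually_elim
        case (elim t)
        have "2 * s t = (s t + \<i> * r t) + (s t - \<i> * r t)" by simp
        then have "s t = 0" using elim by simp
        moreover have "r t = 0" using elim \<open>s t = 0\<close> by simp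
        ultimately show ?case by (simp add: r_def s_def)
      qed
      then show "(f, g) \<in> op_closure M T"
        by (intro op_closure_cong_AE[OF uv L(1) _ L(2)]) auto
    qed
    then show "op_selfadjoint M (op_closure M T)"
      unfolding op_selfadjoint_def adj using sub by blast
  qed
qed


section \<open>Jacobi matrices\<close>

lemma L2_set_sq: "(L2_set f A)\<^sup>2 = (\<Sum>i\<in>A. (f i)\<^sup>2)"
  by (simp add: L2_set_def sum_nonneg)

text \<open>A discrete Gronwall lemma: on a tail where \<open>\<Sum> (G k)\<^sup>2 \<le> 1/4\<close>, the sum on the right is absorbed
  into the left-hand side by the Cauchy-Schwarz inequality.\<close>

lemma summable_square_Gronwall:
  fixes Y G :: "nat \<Rightarrow> real"
  assumes Y: "\<And>n. 0 \<le> Y n" and G: "\<And>n. 0 \<le> G n" "summable (\<lambda>n. (G n)\<^sup>2)"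
    and C: "0 \<le> C" and le: "\<And>n. Y n \<le> G n * (C + (\<Sum>k\<le>n. G k * Y k))"
  shows "summable (\<lambda>n. (Y n)\<^sup>2)"
proof -
  have "\<exists>N. \<forall>m\<ge>N. \<forall>n. norm (\<Sum>k\<in>{m..<n}. (G k)\<^sup>2) < 1/4"
    using G(2)[unfolded summable_Cauchy, rule_format, of "1/4"] by simp
  then obtain m where m: "\<And>n. norm (\<Sum>k\<in>{m..<n}. (G k)\<^sup>2) < 1/4" by auto
  \<comment> \<open>The terms before \<open>m\<close> go into the constant, so the bound below is
    independent of \<open>N\<close>.\<close>
  define C' where "C' = C + (\<Sum>k<m. G k * Y k)"
  have C': "C' \<ge> 0" unfolding C'_def by (intro add_nonneg_nonneg C sum_nonneg mult_nonneg_nonneg G Y)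
  have bound: "(\<Sum>k\<in>{m..<N}. (Y k)\<^sup>2) \<le> C'\<^sup>2" for N
  proof -
    let ?g = "L2_set G {m..<N}" and ?s = "L2_set Y {m..<N}"
    have "?g\<^sup>2 \<le> (1/2)\<^sup>2" using m[of N] unfolding L2_set_sq by (simp add: power2_eq_square)
    then have g: "0 \<le> ?g" "?g \<le> 1/2" by (auto intro: power2_le_imp_le)
    have s: "0 \<le> ?s" by simp
    have "Y n \<le> (C' + ?g * ?s) * G n" if n: "n \<in> {m..<N}" for n
    proof -
      have "{..n} = {..<m} \<union> {m..n}" "{..<m} \<inter> {m..n} = {}" using n by auto
      then have "(\<Sum>k\<le>n. G k * Y k) = (\<Sum>k<m. G k * Y k) + (\<Sum>k\<in>{m..n}. G k * Y k)"
        by (simp add: sum.union_disjoint)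
      also have "(\<Sum>k\<in>{m..n}. G k * Y k) \<le> (\<Sum>k\<in>{m..<N}. G k * Y k)"
        using n by (intro sum_mono2) (auto intro!: mult_nonneg_nonneg G Y)
      also have "\<dots> \<le> ?g * ?s"
        using L2_set_mult_ineq[of G Y "{m..<N}"] G Y by simp
      finally have "C + (\<Sum>k\<le>n. G k * Y k) \<le> C' + ?g * ?s" by (simp add: C'_def)
      then have "G n * (C + (\<Sum>k\<le>n. G k * Y k)) \<le> G n * (C' + ?g * ?s)" by (intro mult_left_mono G)
      then show ?thesis using le[of n] by (simp add: mult.commute)
    qed
    then have "?s \<le> L2_set (\<lambda>n. (C' + ?g * ?s) * G n) {m..<N}"
      by (intro L2_set_mono Y)
    also have "\<dots> = (C' + ?g * ?s) * ?g"
      using C' g s by (subst L2_set_right_distrib) (auto intro!: add_nonneg_nonneg mult_nonneg_nonneg)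
    also have "\<dots> \<le> (C' + 1/2 * ?s) * (1/2)"
      using C' g s by (intro mult_mono add_mono mult_right_mono order_refl) auto
    finally have "?s \<le> (C' + 1/2 * ?s) * (1/2)" .
    then have "3 * ?s \<le> 2 * C'" by simp
    then have "?s \<le> C'" using C' by linarith
    then have "?s\<^sup>2 \<le> C'\<^sup>2" using s by (intro power_mono)
    then show ?thesis by (simp add: L2_set_sq)
  qed
  show ?thesis
  proof (rule summableI_nonneg_bounded)
    fix N
    have "(\<Sum>k<N. (Y k)\<^sup>2) \<le> (\<Sum>k\<in>{..<m} \<union> {m..<N}. (Y k)\<^sup>2)"
      by (intro sum_mono2) auto
    also have "\<dots> = (\<Sum>k<m. (Y k)\<^sup>2) + (\<Sum>k\<in>{m..<N}. (Y k)\<^sup>2)"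
      by (intro sum.union_disjoint) auto
    also have "\<dots> \<le> (\<Sum>k<m. (Y k)\<^sup>2) + C'\<^sup>2" using bound by simp
    finally show "(\<Sum>k<N. (Y k)\<^sup>2) \<le> (\<Sum>k<m. (Y k)\<^sup>2) + C'\<^sup>2" .
  qed simp
qed

text \<open>The counting measure starts at 1 and the series at 0; one extra term does not affect
  convergence.\<close>

lemma L2_l2_iff: "f \<in> L2 l2_measure \<longleftrightarrow> summable (\<lambda>n. (cmod (f n))\<^sup>2)"
proof -
  have "integrable l2_measure (\<lambda>n. (cmod (f n))\<^sup>2)
      \<longleftrightarrow> Infinite_Set_Sum.abs_summable_on (\<lambda>n. (cmod (f n))\<^sup>2) {1..}"
    by (simp add: Infinite_Set_Sum.abs_summable_on_def)
  also have "\<dots> \<longleftrightarrow> summable (\<lambda>n. if n \<in> {1..} then (cmod (f n))\<^sup>2 else 0)"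
    by (simp add: abs_summable_on_nat_iff cong: if_cong)
  also have "\<dots> \<longleftrightarrow> summable (\<lambda>n. (cmod (f n))\<^sup>2)"
    by (intro summable_cong eventually_sequentiallyI[of 1]) auto
  finally show ?thesis by (simp add: L2_def)
qed

section \<open>Finitely supported sequences and the adjoint of a Jacobi operator\<close>

definition l2_support :: "(nat \<Rightarrow> complex) \<Rightarrow> nat set" where
  "l2_support w = {j. 1 \<le> j \<and> w j \<noteq> 0}"

lemma l2_support_iff: "j \<in> l2_support w \<longleftrightarrow> 1 \<le> j \<and> w j \<noteq> 0"
  by (simp add: l2_support_def)

lemma L2_l2_finite: "finite (l2_support f) \<Longrightarrow> f \<in> L2 l2_measure"
  unfolding L2_l2_iff
  by (rule summable_finite[of "insert 0 (l2_support f)"]) (auto simp: l2_support_iff Suc_le_eq)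

lemma L2_inner_l2_finite:
  assumes "finite S" "S \<subseteq> {1..}" "\<And>j. j \<ge> 1 \<Longrightarrow> j \<notin> S \<Longrightarrow> f j * cnj (g j) = 0"
  shows "L2_inner l2_measure f g = (\<Sum>j\<in>S. f j * cnj (g j))"
proof -
  have "{a \<in> {1..}. f a * cnj (g a) \<noteq> 0} \<subseteq> S" using assms(3) by auto
  then have fin: "finite {a \<in> {1..}. f a * cnj (g a) \<noteq> 0}" using assms(1) finite_subset by blast
  have "L2_inner l2_measure f g = (\<Sum>a | a \<in> {1..} \<and> f a * cnj (g a) \<noteq> 0. f a * cnj (g a))"
    unfolding L2_inner_def by (rule lebesgue_integral_count_space_finite_support[OF fin])
  also have "\<dots> = (\<Sum>j\<in>S. f j * cnj (g j))"
    using assms by (intro sum.mono_neutral_left) auto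
  finally show ?thesis .
qed

text \<open>The formal difference expression. It makes sense for sequences of infinite support, on
  which the adjoint acts; the case distinction keeps the meaningless entry at 0 out of the first
  row.\<close>

definition jacobi_row :: "(nat \<Rightarrow> real) \<Rightarrow> (nat \<Rightarrow> real) \<Rightarrow> (nat \<Rightarrow> complex) \<Rightarrow> nat \<Rightarrow> complex" where
  "jacobi_row u v f n = (if n = 1 then 0 else of_real (v (n - 1)) * f (n - 1)) + of_real (u n) * f n
     + of_real (v n) * f (n + 1)"

lemma jacobi_symmetric: "jacobi u v i j = jacobi u v j i"
  by (auto simp: jacobi_def)

text \<open>A row reaches only one index beyond its own, hence the upper limit
  \<open>N + 1\<close>.\<close>

lemma jacobi_sum:
  assumes "1 \<le> j" "j \<le> N"
  shows "(\<Sum>k\<in>{1..N + 1}. of_real (jacobi u v j k) * f k) = jacobi_row u v f j"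
proof (cases "j = 1")
  case True
  have "(\<Sum>k\<in>{1..N + 1}. of_real (jacobi u v j k) * f k) = (\<Sum>k\<in>{1, 2}. of_real (jacobi u v j k) * f k)"
    using assms True by (intro sum.mono_neutral_right) (auto simp: jacobi_def)
  then show ?thesis using True by (simp add: jacobi_row_def jacobi_def numeral_2_eq_2)
next
  case False
  then obtain m where j: "j = Suc (Suc m)" using assms(1) by (cases j; cases "j - 1") auto
  have "(\<Sum>k\<in>{1..N + 1}. of_real (jacobi u v j k) * f k) = (\<Sum>k\<in>{j - 1, j, j + 1}. of_real (jacobi u v j k) * f k)"
    using assms False by (intro sum.mono_neutral_right) (auto simp: jacobi_def)
  also have "\<dots> = of_real (jacobi u v j (j - 1)) * f (j - 1) + of_real (jacobi u v j j) * f j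
      + of_real (jacobi u v j (j + 1)) * f (j + 1)"
    by (simp add: j)
  finally show ?thesis by (simp add: j jacobi_row_def jacobi_def)
qed

definition matrix_apply :: "(nat \<Rightarrow> nat \<Rightarrow> real) \<Rightarrow> (nat \<Rightarrow> complex) \<Rightarrow> nat \<Rightarrow> complex" where
  "matrix_apply A w i = (\<Sum>j\<in>l2_support w. of_real (A i j) * w j)"

definition finite_op :: "(nat \<Rightarrow> nat \<Rightarrow> real) \<Rightarrow> nat graph" where
  "finite_op A = {(u, matrix_apply A u) | u. finite (l2_support u)}"

lemma min_op_eq: "min_op A = op_closure l2_measure (finite_op A)"
  by (simp add: min_op_def finite_op_def matrix_apply_def[abs_def] l2_support_def)

lemma finite_op_iff: "(w, g) \<in> finite_op A \<longleftrightarrow> finite (l2_support w) \<and> g = matrix_apply A w"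
  by (auto simp: finite_op_def)

lemma finite_support_bound:
  assumes "finite (l2_support w)" obtains N where "l2_support w \<subseteq> {1..N}"
proof -
  obtain N where "\<forall>n\<in>l2_support w. n \<le> N" using assms finite_nat_set_iff_bounded_le by blast
  then have "l2_support w \<subseteq> {1..N}" by (auto simp: l2_support_iff)
  then show thesis by (rule that)
qed

lemma matrix_apply_sum:
  assumes "l2_support w \<subseteq> S" "finite S" "S \<subseteq> {1..}"
  shows "matrix_apply A w i = (\<Sum>j\<in>S. of_real (A i j) * w j)"
  unfolding matrix_apply_def using assms by (intro sum.mono_neutral_left) (auto simp: l2_support_iff subset_iff)

lemma matrix_apply_jacobi:
  assumes "finite (l2_support w)" "i \<ge> 1"
  shows "matrix_apply (jacobi u v) w i = jacobi_row u v w i"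
proof -
  obtain N where N: "l2_support w \<subseteq> {1..N}" using finite_support_bound[OF assms(1)] .
  then have "l2_support w \<subseteq> {1..max N i + 1}" by (rule order_trans) auto
  then have "matrix_apply (jacobi u v) w i = (\<Sum>j\<in>{1..max N i + 1}. of_real (jacobi u v i j) * w j)"
    by (intro matrix_apply_sum) auto
  also have "\<dots> = jacobi_row u v w i" using assms(2) by (intro jacobi_sum) auto
  finally show ?thesis .
qed

lemma jacobi_row_support:
  assumes "l2_support w \<subseteq> {1..N}" "i \<ge> N + 2" shows "jacobi_row u v w i = 0"
proof -
  have "w j = 0" if "j \<ge> N + 1" for j
  proof (rule ccontr)
    assume "w j \<noteq> 0"
    then have "j \<in> l2_support w" using that by (simp add: l2_support_iff)
    then show False using assms(1) that by auto
  qed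
  then show ?thesis using assms(2) by (auto simp: jacobi_row_def)
qed

lemma jacobi_row_linear: "jacobi_row u v (\<lambda>t. c * f t + g t) i = c * jacobi_row u v f i + jacobi_row u v g i"
  by (simp add: jacobi_row_def algebra_simps)

lemma finite_op_L2: "finite_op (jacobi u v) \<subseteq> L2 l2_measure \<times> L2 l2_measure"
proof clarify
  fix w g assume "(w, g) \<in> finite_op (jacobi u v)"
  then have fin: "finite (l2_support w)" and g: "g = matrix_apply (jacobi u v) w"
    by (auto simp: finite_op_iff)
  obtain N where N: "l2_support w \<subseteq> {1..N}" using finite_support_bound[OF fin] .
  have "l2_support g \<subseteq> {..N + 1}"
  proof
    fix k assume "k \<in> l2_support g"
    then have "jacobi_row u v w k \<noteq> 0" using matrix_apply_jacobi[OF fin, of k u v] by (simp add: g l2_support_iff)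
    then have "\<not> N + 2 \<le> k" using jacobi_row_support[OF N] by blast
    then show "k \<in> {..N + 1}" by simp
  qed
  then have "finite (l2_support g)" using finite_subset by blast
  then show "w \<in> L2 l2_measure \<and> g \<in> L2 l2_measure" using fin L2_l2_finite by auto
qed

lemma finite_op_subspace: "graph_subspace l2_measure (finite_op (jacobi u v))"
proof -
  let ?A = "jacobi u v"
  have "\<exists>(p, q)\<in>finite_op ?A. (AE t in l2_measure. p t = c * w t + w' t) \<and> (AE t in l2_measure. q t = c * g t + g' t)"
    if "(w, g) \<in> finite_op ?A" "(w', g') \<in> finite_op ?A" for w g w' g' c
  proof -
    have fin: "finite (l2_support w)" "finite (l2_support w')"
      and g: "g = matrix_apply ?A w" "g' = matrix_apply ?A w'"
      using that by (auto simp: finite_op_iff)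
    let ?p = "\<lambda>t. c * w t + w' t"
    have "l2_support ?p \<subseteq> l2_support w \<union> l2_support w'" by (auto simp: l2_support_iff)
    then have finp: "finite (l2_support ?p)" using fin finite_subset by blast
    show ?thesis
      by (rule bexI[of _ "(?p, matrix_apply ?A ?p)"])
        (auto simp: AE_count_space g finp finite_op_iff matrix_apply_jacobi fin jacobi_row_linear simp del: One_nat_def)
  qed
  moreover have "(\<lambda>t. 0, matrix_apply ?A (\<lambda>t. 0)) \<in> finite_op ?A" by (simp add: finite_op_iff l2_support_def)
  ultimately show ?thesis by (intro graph_subspaceI finite_op_L2) blast+
qed

lemma finite_op_symmetric: "graph_symmetric l2_measure (finite_op (jacobi u v))"
proof -
  let ?A = "jacobi u v"
  have "L2_inner l2_measure g w' = L2_inner l2_measure w g'"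
    if "(w, g) \<in> finite_op ?A" "(w', g') \<in> finite_op ?A" for w g w' g'
  proof -
    have fin: "finite (l2_support w)" "finite (l2_support w')"
      and g: "g = matrix_apply ?A w" "g' = matrix_apply ?A w'"
      using that by (auto simp: finite_op_iff)
    have "L2_inner l2_measure g w' = (\<Sum>i\<in>l2_support w'. g i * cnj (w' i))"
      using fin by (intro L2_inner_l2_finite) (auto simp: l2_support_iff)
    also have "\<dots> = (\<Sum>i\<in>l2_support w'. \<Sum>j\<in>l2_support w. of_real (?A i j) * w j * cnj (w' i))"
      by (simp add: g matrix_apply_def sum_distrib_right)
    also have "\<dots> = (\<Sum>j\<in>l2_support w. \<Sum>i\<in>l2_support w'. of_real (?A i j) * w j * cnj (w' i))"
      by (rule sum.swap)
    also have "\<dots> = (\<Sum>j\<in>l2_support w. w j * cnj (g' j))"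
      by (simp add: g matrix_apply_def sum_distrib_left jacobi_symmetric[of u v _ j for j] algebra_simps)
    also have "\<dots> = L2_inner l2_measure w g'"
      using fin by (intro L2_inner_l2_finite[symmetric]) (auto simp: l2_support_iff)
    finally show ?thesis .
  qed
  then show ?thesis by (rule graph_symmetricI)
qed

text \<open>The adjoint is the maximal operator: testing with unit vectors reads off its entries,
  and the converse is a finite rearrangement using the symmetry of the matrix.\<close>

lemma adjoint_finite_op_iff:
  "(f, g) \<in> op_adjoint l2_measure (finite_op (jacobi u v)) \<longleftrightarrow>
    f \<in> L2 l2_measure \<and> g \<in> L2 l2_measure \<and> (\<forall>n\<ge>1. g n = jacobi_row u v f n)"
proof -
  let ?A = "jacobi u v"
  have inner: "L2_inner l2_measure (matrix_apply ?A w) f = (\<Sum>j\<in>l2_support w. w j * cnj (jacobi_row u v f j))"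
    if fin: "finite (l2_support w)" for w
  proof -
    obtain N where N: "l2_support w \<subseteq> {1..N}" using finite_support_bound[OF fin] .
    have z: "matrix_apply ?A w j = 0" if "j \<ge> 1" "j \<notin> {1..N + 1}" for j
      using that jacobi_row_support[OF N, of j] matrix_apply_jacobi[OF fin, of j] by auto
    have "L2_inner l2_measure (matrix_apply ?A w) f = (\<Sum>k\<in>{1..N + 1}. matrix_apply ?A w k * cnj (f k))"
      using z by (intro L2_inner_l2_finite) auto
    also have "\<dots> = (\<Sum>k\<in>{1..N + 1}. \<Sum>j\<in>l2_support w. of_real (?A k j) * w j * cnj (f k))"
      by (simp add: matrix_apply_def sum_distrib_right)
    also have "\<dots> = (\<Sum>j\<in>l2_support w. \<Sum>k\<in>{1..N + 1}. of_real (?A k j) * w j * cnj (f k))"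
      by (rule sum.swap)
    also have "\<dots> = (\<Sum>j\<in>l2_support w. w j * cnj (\<Sum>k\<in>{1..N + 1}. of_real (?A j k) * f k))"
      unfolding cnj_sum sum_distrib_left
      by (intro sum.cong refl) (simp add: jacobi_symmetric[of u v])
    also have "\<dots> = (\<Sum>j\<in>l2_support w. w j * cnj (jacobi_row u v f j))"
      using N by (intro sum.cong refl) (subst jacobi_sum, auto)
    finally show ?thesis .
  qed
  have inner': "L2_inner l2_measure w g = (\<Sum>j\<in>l2_support w. w j * cnj (g j))"
    if "finite (l2_support w)" for w
    using that by (intro L2_inner_l2_finite) (auto simp: l2_support_iff)
  have "(\<forall>(w, h)\<in>finite_op ?A. L2_inner l2_measure h f = L2_inner l2_measure w g)
    \<longleftrightarrow> (\<forall>n\<ge>1. g n = jacobi_row u v f n)" (is "?L = ?R")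
  proof
    assume ?L
    show ?R
    proof clarify
      fix n :: nat assume n: "n \<ge> 1"
      define w where "w j = (if j = n then 1 else 0::complex)" for j
      have sup: "l2_support w = {n}" using n by (auto simp: w_def l2_support_iff split: if_splits)
      then have "(w, matrix_apply ?A w) \<in> finite_op ?A" by (simp add: finite_op_iff)
      then have "L2_inner l2_measure (matrix_apply ?A w) f = L2_inner l2_measure w g" using \<open>?L\<close> by blast
      then have "cnj (jacobi_row u v f n) = cnj (g n)"
        using inner[of w] inner'[of w] unfolding sup by (simp add: w_def)
      then show "g n = jacobi_row u v f n" by simp
    qed
  next
    assume ?R
    then show ?L by (auto simp: finite_op_iff inner inner' l2_support_iff simp del: One_nat_def intro!: sum.cong)
  qed
  then show ?thesis by (simp add: op_adjoint_def)
qed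

text \<open>Solution of the eigenvalue equations in the rows \<open>n \<ge> 2\<close> with given entries \<open>a\<close>, \<open>b\<close> at \<open>1\<close>, \<open>2\<close>.\<close>

fun jacobi_sol :: "(nat \<Rightarrow> real) \<Rightarrow> (nat \<Rightarrow> real) \<Rightarrow> complex \<Rightarrow> complex \<Rightarrow> complex \<Rightarrow> nat \<Rightarrow> complex" where
  "jacobi_sol u v z a b 0 = 0"
| "jacobi_sol u v z a b (Suc 0) = a"
| "jacobi_sol u v z a b (Suc (Suc 0)) = b"
| "jacobi_sol u v z a b (Suc (Suc (Suc n))) =
    ((z - of_real (u (n + 2))) * jacobi_sol u v z a b (Suc (Suc n)) - of_real (v (n + 1)) * jacobi_sol u v z a b (Suc n))
      / of_real (v (n + 2))"

lemma jacobi_row_sol: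
  assumes "n \<ge> 2" "v n \<noteq> 0"
  shows "jacobi_row u v (jacobi_sol u v z a b) n = z * jacobi_sol u v z a b n"
proof -
  obtain m where n: "n = Suc (Suc m)" using assms(1) by (metis add_2_eq_Suc le_Suc_ex)
  show ?thesis using assms(2) by (simp add: jacobi_row_def n field_simps)
qed

lemma jacobi_sol_unique:
  assumes v: "\<And>n. n \<ge> 2 \<Longrightarrow> v n \<noteq> 0"
    and f: "\<And>n. n \<ge> 2 \<Longrightarrow> jacobi_row u v f n = z * f n" and n: "n \<ge> 1"
  shows "f n = jacobi_sol u v z (f 1) (f 2) n"
  using n
proof (induction n rule: less_induct)
  case (less n)
  have "n = 1 \<or> n = 2 \<or> n = Suc (Suc (Suc (n - 3)))" using less.prems by arith
  then consider "n = 1" | "n = 2" | m where "n = Suc (Suc (Suc m))" by metis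
  then show ?case
  proof cases
    case 3
    have IH: "f (Suc (Suc m)) = jacobi_sol u v z (f 1) (f 2) (Suc (Suc m))"
      "f (Suc m) = jacobi_sol u v z (f 1) (f 2) (Suc m)" by (rule less.IH; simp add: 3)+
    have "of_real (v (m + 1)) * f (Suc m) + of_real (u (m + 2)) * f (Suc (Suc m)) + of_real (v (m + 2)) * f n
        = z * f (Suc (Suc m))"
      using f[of "Suc (Suc m)"] 3 by (simp add: jacobi_row_def)
    moreover have "v (m + 2) \<noteq> 0" using v by simp
    ultimately have "f n = ((z - of_real (u (m + 2))) * f (Suc (Suc m)) - of_real (v (m + 1)) * f (Suc m)) / of_real (v (m + 2))"
      by (simp add: field_simps)
    then show ?thesis unfolding 3 IH by simp
  qed (auto simp: numeral_2_eq_2)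
qed

lemma jacobi_sol_scale: "jacobi_sol u v z (c * a) (c * b) n = c * jacobi_sol u v z a b n"
  by (induction u v z a b n rule: jacobi_sol.induct) (auto simp: algebra_simps)

lemma jacobi_sol_cnj: "cnj (jacobi_sol u v z a b n) = jacobi_sol u v (cnj z) (cnj a) (cnj b) n"
  by (induction u v z a b n rule: jacobi_sol.induct) auto

text \<open>The orthogonal polynomials of the first kind at \<open>z\<close>: entry 1 is normalised,
  and entry 2 is forced by the first row, which acts as the boundary condition.\<close>

definition jacobi_P :: "(nat \<Rightarrow> real) \<Rightarrow> (nat \<Rightarrow> real) \<Rightarrow> complex \<Rightarrow> nat \<Rightarrow> complex" where
  "jacobi_P u v z = jacobi_sol u v z 1 ((z - of_real (u 1)) / of_real (v 1))"

lemma jacobi_P_row: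
  assumes v: "\<And>n. n \<ge> 1 \<Longrightarrow> v n \<noteq> 0" and n: "n \<ge> 1"
  shows "jacobi_row u v (jacobi_P u v z) n = z * jacobi_P u v z n"
proof (cases "n = 1")
  case True
  then show ?thesis using v[of 1] by (simp add: jacobi_row_def jacobi_P_def numeral_2_eq_2)
next
  case False
  then show ?thesis unfolding jacobi_P_def using n v by (intro jacobi_row_sol) auto
qed

lemma jacobi_P_cnj: "cnj (jacobi_P u v z n) = jacobi_P u v (cnj z) n"
  by (simp add: jacobi_P_def jacobi_sol_cnj)

text \<open>With nonzero off-diagonal entries every row determines the next entry, the first row
  included, so an eigenvector is fixed by its first entry.\<close>

lemma eigenspace_finite_op:
  assumes v: "\<And>n. n \<ge> 1 \<Longrightarrow> v n \<noteq> 0"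
  shows "op_eigenspace (op_adjoint l2_measure (finite_op (jacobi u v))) z
    = {f \<in> L2 l2_measure. \<exists>c. AE n in l2_measure. f n = c * jacobi_P u v z n}"
proof -
  have iff: "(\<forall>n\<ge>1. z * f n = jacobi_row u v f n) \<longleftrightarrow> (\<exists>c. \<forall>n\<ge>1. f n = c * jacobi_P u v z n)" (is "?L = ?R") for f
  proof
    assume L: ?L
    have "f 2 = f 1 * ((z - of_real (u 1)) / of_real (v 1))"
      using L[rule_format, of 1] v[of 1] by (simp add: jacobi_row_def field_simps numeral_2_eq_2)
    then have "f n = f 1 * jacobi_P u v z n" if "n \<ge> 1" for n
      unfolding jacobi_P_def jacobi_sol_scale[symmetric]
      using jacobi_sol_unique[of v u f z n] v L that by auto
    then show ?R by blast
  next
    assume ?R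
    then obtain c where c: "\<And>n. n \<ge> 1 \<Longrightarrow> f n = c * jacobi_P u v z n" by blast
    have "jacobi_row u v f n = c * jacobi_row u v (jacobi_P u v z) n" if "n \<ge> 1" for n
      using that c by (auto simp: jacobi_row_def algebra_simps)
    then show ?L using c jacobi_P_row[OF v] by (simp add: algebra_simps)
  qed
  show ?thesis
  proof (rule set_eqI)
    fix f
    have "f \<in> op_eigenspace (op_adjoint l2_measure (finite_op (jacobi u v))) z
        \<longleftrightarrow> f \<in> L2 l2_measure \<and> (\<forall>n\<ge>1. z * f n = jacobi_row u v f n)"
      using L2_scale[of f l2_measure z] unfolding op_eigenspace_def adjoint_finite_op_iff mem_Collect_eq by blast
    also have "\<dots> \<longleftrightarrow> f \<in> {f \<in> L2 l2_measure. \<exists>c. AE n in l2_measure. f n = c * jacobi_P u v z n}"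
      unfolding iff by (simp add: AE_count_space Ball_def)
    finally show "f \<in> op_eigenspace (op_adjoint l2_measure (finite_op (jacobi u v))) z
        \<longleftrightarrow> f \<in> {f \<in> L2 l2_measure. \<exists>c. AE n in l2_measure. f n = c * jacobi_P u v z n}" .
  qed
qed

text \<open>Discrete Wronskian; the weight \<open>v n\<close> makes it constant for two solutions at
  the same energy.\<close>

definition jacobi_W :: "(nat \<Rightarrow> real) \<Rightarrow> (nat \<Rightarrow> complex) \<Rightarrow> (nat \<Rightarrow> complex) \<Rightarrow> nat \<Rightarrow> complex" where
  "jacobi_W v y p n = of_real (v n) * (y n * p (n + 1) - y (n + 1) * p n)"

text \<open>Discrete Lagrange identity: the diagonal terms of
  \<open>y n * row p - p n * row y\<close> cancel and the rest telescopes.\<close>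

lemma jacobi_W_step:
  assumes "n \<ge> 2" "jacobi_row u v y n = z * y n" "jacobi_row u v p n = \<zeta> * p n"
  shows "jacobi_W v y p n = jacobi_W v y p (n - 1) + (\<zeta> - z) * (y n * p n)"
proof -
  have "y n * jacobi_row u v p n - p n * jacobi_row u v y n = (\<zeta> - z) * (y n * p n)"
    using assms by (simp add: algebra_simps)
  moreover have "y n * jacobi_row u v p n - p n * jacobi_row u v y n = jacobi_W v y p n - jacobi_W v y p (n - 1)"
    using assms(1) by (simp add: jacobi_row_def jacobi_W_def algebra_simps)
  ultimately show ?thesis by (simp add: algebra_simps)
qed

text \<open>Distance at most 1 between the energies covers the passages between 0 and \<i>, -\<i>,
  and removes the factor \<open>\<zeta> - z\<close>.\<close>

lemma jacobi_W_bound: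
  assumes y: "\<And>n. n \<ge> 2 \<Longrightarrow> jacobi_row u v y n = z * y n"
    and p: "\<And>n. n \<ge> 2 \<Longrightarrow> jacobi_row u v p n = \<zeta> * p n" and z: "cmod (\<zeta> - z) \<le> 1"
  shows "cmod (jacobi_W v y p (Suc n)) \<le> cmod (jacobi_W v y p 1) + (\<Sum>k\<le>n. cmod (p (Suc k)) * cmod (y (Suc k)))"
proof (induction n)
  case 0 show ?case by simp
next
  case (Suc n)
  have "jacobi_W v y p (Suc (Suc n)) = jacobi_W v y p (Suc n) + (\<zeta> - z) * (y (Suc (Suc n)) * p (Suc (Suc n)))"
    using jacobi_W_step[OF _ y p, of "Suc (Suc n)"] by simp
  then have "cmod (jacobi_W v y p (Suc (Suc n))) \<le> cmod (jacobi_W v y p (Suc n))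
      + cmod (\<zeta> - z) * cmod (y (Suc (Suc n)) * p (Suc (Suc n)))"
    by (metis norm_mult norm_triangle_ineq)
  also have "cmod (\<zeta> - z) * cmod (y (Suc (Suc n)) * p (Suc (Suc n))) \<le> cmod (y (Suc (Suc n)) * p (Suc (Suc n)))"
    using z by (intro mult_left_le_one_le) auto
  finally show ?case using Suc.IH by (simp add: norm_mult mult.commute)
qed

text \<open>The identity \<open>y W(p, q) = p W(y, q) - q W(y, p)\<close> bounds \<open>y\<close> by itself in the form required
  by the Gronwall lemma.\<close>

lemma jacobi_all_l2:
  assumes y: "\<And>n. n \<ge> 2 \<Longrightarrow> jacobi_row u v y n = z * y n"
    and p: "\<And>n. n \<ge> 2 \<Longrightarrow> jacobi_row u v p n = \<zeta> * p n" and z: "cmod (\<zeta> - z) \<le> 1"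
    and q: "\<And>n. n \<ge> 2 \<Longrightarrow> jacobi_row u v q n = \<eta> * q n" and z': "cmod (\<eta> - z) \<le> 1"
    and W: "\<kappa> > 0" "\<And>n. n \<ge> 1 \<Longrightarrow> cmod (jacobi_W v p q n) \<ge> \<kappa>"
    and L2: "p \<in> L2 l2_measure" "q \<in> L2 l2_measure"
  shows "y \<in> L2 l2_measure"
proof -
  \<comment> \<open>One weight for two purposes: it dominates |p| and |q| inside the sum, and (|p| +
    |q|) / \<kappa> in front of it.\<close>
  define G where "G n = (1 + 1 / \<kappa>) * (cmod (p (Suc n)) + cmod (q (Suc n)))" for n
  define C where "C = cmod (jacobi_W v y p 1) + cmod (jacobi_W v y q 1)"
  have G0: "0 \<le> G n" for n unfolding G_def using W(1) by (intro mult_nonneg_nonneg add_nonneg_nonneg) auto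
  have Gpq: "cmod (p (Suc n)) + cmod (q (Suc n)) \<le> G n" for n
  proof -
    have "1 * (cmod (p (Suc n)) + cmod (q (Suc n))) \<le> G n"
      unfolding G_def using W(1) by (intro mult_right_mono) auto
    then show ?thesis by simp
  qed
  have "summable (\<lambda>n. (cmod (y (Suc n)))\<^sup>2)"
  proof (rule summable_square_Gronwall[where G=G and C=C])
    have "(\<lambda>n. complex_of_real (cmod (p n)) + complex_of_real (cmod (q n))) \<in> L2 l2_measure"
      using L2 by (intro L2_add) (simp_all only: L2_l2_iff norm_of_real abs_norm_cancel)
    then have "summable (\<lambda>n. (cmod (p n) + cmod (q n))\<^sup>2)"
      unfolding L2_l2_iff of_real_add[symmetric] norm_of_real by simp
    then have "summable (\<lambda>n. (cmod (p (Suc n)) + cmod (q (Suc n)))\<^sup>2)" by (subst summable_Suc_iff)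
    then show "summable (\<lambda>n. (G n)\<^sup>2)" unfolding G_def power_mult_distrib by (intro summable_mult)
    fix n
    define R where "R = C + (\<Sum>k\<le>n. G k * cmod (y (Suc k)))"
    have bW: "cmod (jacobi_W v y r (Suc n)) \<le> R"
      if "cmod (jacobi_W v y r (Suc n)) \<le> cmod (jacobi_W v y r 1) + (\<Sum>k\<le>n. cmod (r (Suc k)) * cmod (y (Suc k)))"
        "cmod (jacobi_W v y r 1) \<le> C" "\<And>n. cmod (r (Suc n)) \<le> G n" for r
    proof -
      have "(\<Sum>k\<le>n. cmod (r (Suc k)) * cmod (y (Suc k))) \<le> (\<Sum>k\<le>n. G k * cmod (y (Suc k)))"
        using that(3) by (intro sum_mono mult_right_mono) auto
      then show ?thesis using that by (simp add: R_def)
    qed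
    have cp: "cmod (p (Suc n)) \<le> G n" "cmod (q (Suc n)) \<le> G n" for n
      using Gpq[of n] norm_ge_zero[of "p (Suc n)"] norm_ge_zero[of "q (Suc n)"] by linarith+
    have Rp: "cmod (jacobi_W v y p (Suc n)) \<le> R"
      by (rule bW[OF jacobi_W_bound[OF y p z]]) (auto simp: C_def cp)
    have Rq: "cmod (jacobi_W v y q (Suc n)) \<le> R"
      by (rule bW[OF jacobi_W_bound[OF y q z']]) (auto simp: C_def cp)
    have "\<kappa> * cmod (y (Suc n)) \<le> cmod (jacobi_W v p q (Suc n)) * cmod (y (Suc n))"
      using W(2)[of "Suc n"] by (intro mult_right_mono) auto
    also have "\<dots> = cmod (p (Suc n) * jacobi_W v y q (Suc n) - q (Suc n) * jacobi_W v y p (Suc n))"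
      unfolding norm_mult[symmetric] by (rule arg_cong[of _ _ cmod]) (simp add: jacobi_W_def algebra_simps)
    also have "\<dots> \<le> cmod (p (Suc n)) * cmod (jacobi_W v y q (Suc n)) + cmod (q (Suc n)) * cmod (jacobi_W v y p (Suc n))"
      by (metis norm_mult norm_triangle_ineq4)
    also have "\<dots> \<le> cmod (p (Suc n)) * R + cmod (q (Suc n)) * R"
      by (intro add_mono mult_left_mono Rp Rq) auto
    finally have "cmod (y (Suc n)) \<le> 1 / \<kappa> * (cmod (p (Suc n)) + cmod (q (Suc n))) * R"
      using W(1) by (simp add: field_simps)
    also have "\<dots> \<le> G n * R"
      using order_trans[OF norm_ge_zero Rp] W(1) unfolding G_def by (intro mult_right_mono) auto
    finally show "cmod (y (Suc n)) \<le> G n * (C + (\<Sum>k\<le>n. G k * cmod (y (Suc k))))" by (simp add: R_def)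
  qed (auto simp: G0 C_def)
  then have "summable (\<lambda>n. (cmod (y n))\<^sup>2)" by (subst (asm) summable_Suc_iff)
  then show ?thesis by (simp only: L2_l2_iff)
qed

text \<open>The limit circle property does not depend on the energy. On the right the first row is
  not imposed, so the whole two-dimensional solution space at energy 0 is meant.\<close>

lemma jacobi_P_l2_iff:
  assumes v: "\<And>n. n \<ge> 1 \<Longrightarrow> v n \<noteq> 0"
  shows "jacobi_P u v \<i> \<in> L2 l2_measure \<longleftrightarrow>
    (\<forall>y. (\<forall>n\<ge>2. jacobi_row u v y n = 0) \<longrightarrow> y \<in> L2 l2_measure)" (is "?L = ?R")
proof
  let ?p = "jacobi_P u v \<i>" and ?q = "jacobi_P u v (- \<i>)"
  have q: "?q = (\<lambda>n. cnj (?p n))" by (simp add: jacobi_P_cnj)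
  assume L: ?L
  then have L': "?q \<in> L2 l2_measure" unfolding q by (rule L2_cnj)
  \<comment> \<open>Each row contributes the energy difference -2 \<i> times |p|^2, and these
    contributions cannot cancel; the first entry, where \<open>?p\<close> is 1, already gives
    modulus 2.\<close>
  have W: "jacobi_W v ?p ?q (Suc n) = - 2 * \<i> * of_real (\<Sum>k\<le>n. (cmod (?p (Suc k)))\<^sup>2)" for n
  proof (induction n)
    case 0
    show ?case using v[of 1] by (simp add: jacobi_W_def jacobi_P_def numeral_2_eq_2 field_simps)
  next
    case (Suc n)
    have "jacobi_W v ?p ?q (Suc (Suc n)) = jacobi_W v ?p ?q (Suc n) + (- \<i> - \<i>) * (?p (Suc (Suc n)) * ?q (Suc (Suc n)))"
      using jacobi_W_step[of "Suc (Suc n)" u v ?p \<i> ?q "- \<i>"] jacobi_P_row[OF v] by simp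
    also have "?p (Suc (Suc n)) * ?q (Suc (Suc n)) = of_real ((cmod (?p (Suc (Suc n))))\<^sup>2)"
      unfolding q by (rule complex_norm_square[symmetric])
    finally show ?case using Suc.IH by (simp add: algebra_simps)
  qed
  have "cmod (jacobi_W v ?p ?q n) \<ge> 2" if ge: "n \<ge> 1" for n
  proof -
    obtain m where n: "n = Suc m" using ge by (cases n) auto
    have "1 = (\<Sum>k\<in>{0}. (cmod (?p (Suc k)))\<^sup>2)" by (simp add: jacobi_P_def)
    also have "\<dots> \<le> (\<Sum>k\<le>m. (cmod (?p (Suc k)))\<^sup>2)" by (intro sum_mono2) auto
    finally show ?thesis unfolding n W norm_mult norm_of_real by simp
  qed
  then show ?R
    using jacobi_all_l2[of u v _ 0 ?p \<i> ?q "- \<i>" 2] jacobi_P_row[OF v] L L' by simp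
next
  assume R: ?R
  \<comment> \<open>A fundamental system at energy 0, whose Wronskian is the constant
    \<open>v 1\<close>.\<close>
  let ?p = "jacobi_sol u v 0 1 0" and ?q = "jacobi_sol u v 0 0 1"
  have row: "jacobi_row u v (jacobi_sol u v 0 a b) n = 0" if "n \<ge> 2" for a b n
    using jacobi_row_sol[OF that, of v u 0] v[of n] that by simp
  have W: "jacobi_W v ?p ?q (Suc n) = of_real (v 1)" for n
  proof (induction n)
    case 0 show ?case by (simp add: jacobi_W_def)
  next
    case (Suc n)
    then show ?case using jacobi_W_step[of "Suc (Suc n)" u v ?p 0 ?q 0] row by simp
  qed
  have "cmod (jacobi_W v ?p ?q n) \<ge> \<bar>v 1\<bar>" if "n \<ge> 1" for n
    using W[of "n - 1"] that by simp
  then show ?L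
    using jacobi_all_l2[of u v "jacobi_P u v \<i>" \<i> ?p 0 ?q 0 "\<bar>v 1\<bar>"] jacobi_P_row[OF v] row R v[of 1] by simp
qed

text \<open>\<open>lc\<close> is left open so that both matrices can be given the same condition as
  H.\<close>

theorem jacobi_deficiency:
  assumes v: "\<And>n. n \<ge> 1 \<Longrightarrow> v n \<noteq> 0"
    and lc: "(\<forall>y. (\<forall>n\<ge>2. jacobi_row u v y n = 0) \<longrightarrow> y \<in> L2 l2_measure) \<longleftrightarrow> lc"
  shows "n_plus l2_measure (min_op (jacobi u v)) = (if lc then 1 else 0)"
    and "n_minus l2_measure (min_op (jacobi u v)) = (if lc then 1 else 0)"
    and "op_selfadjoint l2_measure (min_op (jacobi u v)) \<longleftrightarrow> \<not> lc"
proof -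
  let ?\<phi> = "jacobi_P u v \<i>"
  have lc': "?\<phi> \<in> L2 l2_measure \<longleftrightarrow> lc" using jacobi_P_l2_iff[of v u] v lc by simp
  have "\<not> (AE n in l2_measure. ?\<phi> n = 0)"
    by (auto simp: AE_count_space jacobi_P_def intro!: bexI[of _ 1])
  note D = deficiency_dichotomy[OF finite_op_subspace finite_op_symmetric _ this, of u v]
  have eig: "op_eigenspace (op_adjoint l2_measure (finite_op (jacobi u v))) (- \<i>)
      = {f \<in> L2 l2_measure. \<exists>c. AE n in l2_measure. f n = c * cnj (?\<phi> n)}"
    using eigenspace_finite_op[OF v, where u=u and z="- \<i>"] by (simp add: jacobi_P_cnj)
  show "n_plus l2_measure (min_op (jacobi u v)) = (if lc then 1 else 0)"
    and "n_minus l2_measure (min_op (jacobi u v)) = (if lc then 1 else 0)"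
    and "op_selfadjoint l2_measure (min_op (jacobi u v)) \<longleftrightarrow> \<not> lc"
    using D[OF _ eigenspace_finite_op[OF v] eig] unfolding min_op_eq lc' by auto
qed


section \<open>Absolutely continuous functions\<close>

lemma abs_cont_onD:
  assumes "abs_cont_on S f" "e > 0"
  obtains \<delta> where "\<delta> > 0" "\<forall>D. D division_of \<Union>D \<longrightarrow> \<Union>D \<subseteq> S \<longrightarrow> (\<Sum>k\<in>D. Sup k - Inf k) < \<delta> \<longrightarrow>
     (\<Sum>k\<in>D. cmod (f (Sup k) - f (Inf k))) < e"
proof -
  from assms obtain \<delta> where "\<delta> > 0" "\<forall>D. D division_of \<Union>D \<and> \<Union>D \<subseteq> S \<and> (\<Sum>k\<in>D. Sup k - Inf k) < \<delta> \<longrightarrow>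
     (\<Sum>k\<in>D. cmod (f (Sup k) - f (Inf k))) < e"
    unfolding abs_cont_on_def by blast
  then show thesis by (intro that[of \<delta>]) simp_all
qed

lemma division_Sup_Inf:
  fixes D :: "real set set"
  assumes "D division_of \<Union>D" "k \<in> D"
  shows "Inf k \<le> Sup k" "Inf k \<in> k" "Sup k \<in> k" "k = {Inf k..Sup k}"
proof -
  obtain a c where "k = cbox a c" using division_ofD(4)[OF assms] by blast
  then have k: "k = {a..c}" "k \<noteq> {}" using division_ofD(3)[OF assms] by auto
  then have "a \<le> c" by simp
  then show "Inf k \<le> Sup k" "Inf k \<in> k" "Sup k \<in> k" "k = {Inf k..Sup k}" unfolding k by auto
qed

text \<open>Comparison of increments; it yields Lipschitz functions, multiples, conjugates and
  functions that agree with \<open>f\<close> on \<open>S\<close>.\<close>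

lemma abs_cont_on_bound:
  assumes f: "abs_cont_on S f" and K: "K \<ge> 0"
    and le: "\<And>s t. s \<in> S \<Longrightarrow> t \<in> S \<Longrightarrow> cmod (g s - g t) \<le> K * (cmod (f s - f t) + \<bar>s - t\<bar>)"
  shows "abs_cont_on S g"
  unfolding abs_cont_on_def
proof (intro allI impI)
  fix e :: real assume e: "e > 0"
  \<comment> \<open>Both sums are kept below \<open>d\<close>; \<open>K + 1\<close> in place of
    \<open>K\<close> makes the final inequality strict even for \<open>K = 0\<close>.\<close>
  have "\<exists>d>0. (K + 1) * d = e / 2" using e K by (intro exI[of _ "e / 2 / (K + 1)"]) (simp add: divide_simps)
  then obtain d where d: "d > 0" "(K + 1) * d = e / 2" by blast
  obtain \<delta> where \<delta>: "\<delta> > 0" "\<forall>D. D division_of \<Union>D \<longrightarrow> \<Union>D \<subseteq> S \<longrightarrow> (\<Sum>k\<in>D. Sup k - Inf k) < \<delta> \<longrightarrow>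
     (\<Sum>k\<in>D. cmod (f (Sup k) - f (Inf k))) < d"
    by (rule abs_cont_onD[OF f d(1)])
  note \<delta> = \<delta>(1) \<delta>(2)[rule_format]
  show "\<exists>\<delta>>0. \<forall>D. D division_of \<Union>D \<and> \<Union>D \<subseteq> S \<and> (\<Sum>k\<in>D. Sup k - Inf k) < \<delta> \<longrightarrow>
     (\<Sum>k\<in>D. cmod (g (Sup k) - g (Inf k))) < e"
  proof (intro exI[of _ "min \<delta> d"] conjI allI impI)
    show "min \<delta> d > 0" using \<delta> d by simp
    fix D assume D: "D division_of \<Union>D \<and> \<Union>D \<subseteq> S \<and> (\<Sum>k\<in>D. Sup k - Inf k) < min \<delta> d"
    have "cmod (g (Sup k) - g (Inf k)) \<le> K * (cmod (f (Sup k) - f (Inf k)) + (Sup k - Inf k))" if "k \<in> D" for k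
    proof -
      note * = division_Sup_Inf[OF conjunct1[OF D] that]
      have "Inf k \<in> S" "Sup k \<in> S" using D that *(2,3) by blast+
      then show ?thesis using le[of "Sup k" "Inf k"] *(1) by simp
    qed
    then have "(\<Sum>k\<in>D. cmod (g (Sup k) - g (Inf k))) \<le> (\<Sum>k\<in>D. K * (cmod (f (Sup k) - f (Inf k)) + (Sup k - Inf k)))"
      by (rule sum_mono)
    also have "\<dots> = K * ((\<Sum>k\<in>D. cmod (f (Sup k) - f (Inf k))) + (\<Sum>k\<in>D. Sup k - Inf k))"
      by (simp only: sum_distrib_left[symmetric] sum.distrib)
    also have "\<dots> \<le> K * (d + d)"
      using D \<delta>(2)[of D] K by (intro mult_left_mono add_mono) auto
    also have "\<dots> < (K + 1) * (d + d)" using d(1) by (intro mult_strict_right_mono) auto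
    also have "\<dots> = e" using d(2) by (simp add: distrib_left)
    finally show "(\<Sum>k\<in>D. cmod (g (Sup k) - g (Inf k))) < e" .
  qed
qed

lemma abs_cont_on_const: "abs_cont_on S (\<lambda>t. c)"
  unfolding abs_cont_on_def by (auto intro: exI[of _ 1])

lemma abs_cont_on_Lipschitz:
  assumes "K \<ge> 0" "\<And>s t. s \<in> S \<Longrightarrow> t \<in> S \<Longrightarrow> cmod (g s - g t) \<le> K * \<bar>s - t\<bar>"
  shows "abs_cont_on S g"
  by (rule abs_cont_on_bound[OF abs_cont_on_const[of _ 0] assms(1)]) (use assms(2) in auto)

lemma abs_cont_on_add:
  assumes "abs_cont_on S f" "abs_cont_on S g" shows "abs_cont_on S (\<lambda>t. f t + g t)"
  unfolding abs_cont_on_def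
proof (intro allI impI)
  fix e :: real assume "e > 0"
  then have e: "e/2 > 0" by simp
  obtain \<delta> where \<delta>: "\<delta> > 0" "\<forall>D. D division_of \<Union>D \<longrightarrow> \<Union>D \<subseteq> S \<longrightarrow> (\<Sum>k\<in>D. Sup k - Inf k) < \<delta> \<longrightarrow>
     (\<Sum>k\<in>D. cmod (f (Sup k) - f (Inf k))) < e/2"
    by (rule abs_cont_onD[OF assms(1) e])
  note \<delta> = \<delta>(1) \<delta>(2)[rule_format]
  obtain \<delta>' where \<delta>': "\<delta>' > 0" "\<forall>D. D division_of \<Union>D \<longrightarrow> \<Union>D \<subseteq> S \<longrightarrow> (\<Sum>k\<in>D. Sup k - Inf k) < \<delta>' \<longrightarrow>
     (\<Sum>k\<in>D. cmod (g (Sup k) - g (Inf k))) < e/2"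
    by (rule abs_cont_onD[OF assms(2) e])
  note \<delta>' = \<delta>'(1) \<delta>'(2)[rule_format]
  show "\<exists>\<delta>>0. \<forall>D. D division_of \<Union>D \<and> \<Union>D \<subseteq> S \<and> (\<Sum>k\<in>D. Sup k - Inf k) < \<delta> \<longrightarrow>
     (\<Sum>k\<in>D. cmod (f (Sup k) + g (Sup k) - (f (Inf k) + g (Inf k)))) < e"
  proof (intro exI[of _ "min \<delta> \<delta>'"] conjI allI impI)
    fix D assume D: "D division_of \<Union>D \<and> \<Union>D \<subseteq> S \<and> (\<Sum>k\<in>D. Sup k - Inf k) < min \<delta> \<delta>'"
    have "(\<Sum>k\<in>D. cmod (f (Sup k) + g (Sup k) - (f (Inf k) + g (Inf k))))
        \<le> (\<Sum>k\<in>D. cmod (f (Sup k) - f (Inf k)) + cmod (g (Sup k) - g (Inf k)))"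
      by (intro sum_mono norm_diff_triangle_ineq)
    also have "\<dots> = (\<Sum>k\<in>D. cmod (f (Sup k) - f (Inf k))) + (\<Sum>k\<in>D. cmod (g (Sup k) - g (Inf k)))"
      by (rule sum.distrib)
    also have "\<dots> < e/2 + e/2" using D \<delta>(2) \<delta>'(2) by (intro add_strict_mono) auto
    finally show "(\<Sum>k\<in>D. cmod (f (Sup k) + g (Sup k) - (f (Inf k) + g (Inf k)))) < e" by simp
  qed (use \<delta> \<delta>' in auto)
qed

lemma abs_cont_on_scale: "abs_cont_on S f \<Longrightarrow> abs_cont_on S (\<lambda>t. c * f t)"
  by (erule abs_cont_on_bound[of _ _ "cmod c"])
    (auto simp: right_diff_distrib[symmetric] norm_mult intro!: mult_left_mono)

lemma abs_cont_on_cnj: "abs_cont_on S f \<Longrightarrow> abs_cont_on S (\<lambda>t. cnj (f t))"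
  by (erule abs_cont_on_bound[of _ _ 1])
    (auto simp flip: complex_cnj_diff)

lemma abs_cont_on_diff: "abs_cont_on S f \<Longrightarrow> abs_cont_on S g \<Longrightarrow> abs_cont_on S (\<lambda>t. f t - g t)"
  using abs_cont_on_add[of S f "\<lambda>t. -1 * g t"] abs_cont_on_scale[of S g "-1"] by simp

lemma abs_cont_on_continuous:
  assumes "abs_cont_on {a..c} f" shows "continuous_on {a..c} f"
  unfolding continuous_on_iff
proof (intro ballI allI impI)
  fix t and e :: real assume t: "t \<in> {a..c}" and e: "e > 0"
  obtain \<delta> where \<delta>: "\<delta> > 0" "\<forall>D. D division_of \<Union>D \<longrightarrow> \<Union>D \<subseteq> {a..c} \<longrightarrow> (\<Sum>k\<in>D. Sup k - Inf k) < \<delta> \<longrightarrow>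
     (\<Sum>k\<in>D. cmod (f (Sup k) - f (Inf k))) < e"
    by (rule abs_cont_onD[OF assms e])
  note \<delta> = \<delta>(1) \<delta>(2)[rule_format]
  have *: "cmod (f s - f r) < e" if "r \<le> s" "r \<in> {a..c}" "s \<in> {a..c}" "s - r < \<delta>" for r s
  proof -
    have "{{r..s}} division_of \<Union>{{r..s}}" using that(1) division_of_self[of r s] by simp
    moreover have "\<Union>{{r..s}} \<subseteq> {a..c}" using that by auto
    ultimately show ?thesis using \<delta>(2)[of "{{r..s}}"] that by simp
  qed
  show "\<exists>d>0. \<forall>s\<in>{a..c}. dist s t < d \<longrightarrow> dist (f s) (f t) < e"
  proof (intro exI[of _ \<delta>] conjI ballI impI)
    fix s assume s: "s \<in> {a..c}" "dist s t < \<delta>"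
    show "dist (f s) (f t) < e"
      using *[of s t] *[of t s] s t by (cases "s \<le> t") (auto simp: dist_norm norm_minus_commute)
  qed (rule \<delta>)
qed

lemma abs_cont_on_mult:
  assumes f: "abs_cont_on {a..c} f" and g: "abs_cont_on {a..c} g"
  shows "abs_cont_on {a..c} (\<lambda>t. f t * g t)"
proof -
  have "bounded (f ` {a..c})" "bounded (g ` {a..c})"
    using abs_cont_on_continuous[OF f] abs_cont_on_continuous[OF g]
    by (auto intro!: compact_imp_bounded compact_continuous_image)
  then obtain A B where "\<forall>y\<in>f ` {a..c}. cmod y \<le> A" "\<forall>y\<in>g ` {a..c}. cmod y \<le> B"
    unfolding bounded_iff by blast
  then have AB: "\<And>t. t \<in> {a..c} \<Longrightarrow> cmod (f t) \<le> A" "\<And>t. t \<in> {a..c} \<Longrightarrow> cmod (g t) \<le> B"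
    by blast+
  define K where "K = max (max A B) 0 + 1"
  have K: "K > 0" "\<And>t. t \<in> {a..c} \<Longrightarrow> cmod (f t) \<le> K" "\<And>t. t \<in> {a..c} \<Longrightarrow> cmod (g t) \<le> K"
    using AB by (force simp: K_def)+
  show ?thesis unfolding abs_cont_on_def
  proof (intro allI impI)
    fix e :: real assume "e > 0"
    then have e: "e / (2 * K) > 0" using K by simp
    obtain \<delta> where \<delta>: "\<delta> > 0" "\<forall>D. D division_of \<Union>D \<longrightarrow> \<Union>D \<subseteq> {a..c} \<longrightarrow> (\<Sum>k\<in>D. Sup k - Inf k) < \<delta> \<longrightarrow>
       (\<Sum>k\<in>D. cmod (f (Sup k) - f (Inf k))) < e / (2 * K)"
      by (rule abs_cont_onD[OF f e])
    note \<delta> = \<delta>(1) \<delta>(2)[rule_format]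
    obtain \<delta>' where \<delta>': "\<delta>' > 0" "\<forall>D. D division_of \<Union>D \<longrightarrow> \<Union>D \<subseteq> {a..c} \<longrightarrow> (\<Sum>k\<in>D. Sup k - Inf k) < \<delta>' \<longrightarrow>
       (\<Sum>k\<in>D. cmod (g (Sup k) - g (Inf k))) < e / (2 * K)"
      by (rule abs_cont_onD[OF g e])
    note \<delta>' = \<delta>'(1) \<delta>'(2)[rule_format]
    show "\<exists>\<delta>>0. \<forall>D. D division_of \<Union>D \<and> \<Union>D \<subseteq> {a..c} \<and> (\<Sum>k\<in>D. Sup k - Inf k) < \<delta> \<longrightarrow>
       (\<Sum>k\<in>D. cmod (f (Sup k) * g (Sup k) - f (Inf k) * g (Inf k))) < e"
    proof (intro exI[of _ "min \<delta> \<delta>'"] conjI allI impI)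
      fix D assume D: "D division_of \<Union>D \<and> \<Union>D \<subseteq> {a..c} \<and> (\<Sum>k\<in>D. Sup k - Inf k) < min \<delta> \<delta>'"
      have "cmod (f (Sup k) * g (Sup k) - f (Inf k) * g (Inf k))
          \<le> K * (cmod (f (Sup k) - f (Inf k)) + cmod (g (Sup k) - g (Inf k)))" if "k \<in> D" for k
      proof -
        note * = division_Sup_Inf[OF conjunct1[OF D] that]
        have m: "Inf k \<in> {a..c}" "Sup k \<in> {a..c}" using D that *(2,3) by blast+
        have "f (Sup k) * g (Sup k) - f (Inf k) * g (Inf k)
          = (f (Sup k) - f (Inf k)) * g (Sup k) + f (Inf k) * (g (Sup k) - g (Inf k))" by (simp add: algebra_simps)
        also have "cmod \<dots> \<le> cmod (f (Sup k) - f (Inf k)) * cmod (g (Sup k)) + cmod (f (Inf k)) * cmod (g (Sup k) - g (Inf k))"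
          by (metis norm_mult norm_triangle_ineq)
        also have "\<dots> \<le> cmod (f (Sup k) - f (Inf k)) * K + K * cmod (g (Sup k) - g (Inf k))"
          using K m by (intro add_mono mult_mono) auto
        finally show ?thesis by (simp add: algebra_simps)
      qed
      then have "(\<Sum>k\<in>D. cmod (f (Sup k) * g (Sup k) - f (Inf k) * g (Inf k)))
          \<le> (\<Sum>k\<in>D. K * (cmod (f (Sup k) - f (Inf k)) + cmod (g (Sup k) - g (Inf k))))"
        by (rule sum_mono)
      also have "\<dots> = K * ((\<Sum>k\<in>D. cmod (f (Sup k) - f (Inf k))) + (\<Sum>k\<in>D. cmod (g (Sup k) - g (Inf k))))"
        by (simp only: sum_distrib_left[symmetric] sum.distrib)
      also have "\<dots> < K * (e / (2 * K) + e / (2 * K))"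
        using D \<delta>(2) \<delta>'(2) K by (intro mult_strict_left_mono add_strict_mono) auto
      also have "\<dots> = e" using K by simp
      finally show "(\<Sum>k\<in>D. cmod (f (Sup k) * g (Sup k) - f (Inf k) * g (Inf k))) < e" .
    qed (use \<delta> \<delta>' in auto)
  qed
qed

text \<open>Over the intervals tagged in the null set \<open>N\<close>, which lie in an open set of small measure,
  absolute continuity controls the increments of \<open>f\<close>; elsewhere the argument is that of the
  fundamental theorem of calculus.\<close>

lemma abs_cont_on_FTC:
  fixes f f' :: "real \<Rightarrow> complex"
  assumes ab: "a \<le> c" and ac: "abs_cont_on {a..c} f" and N: "negligible N"
    and deriv: "\<And>t. t \<in> {a..c} - N \<Longrightarrow> (f has_vector_derivative f' t) (at t within {a..c})"
  shows "(f' has_integral (f c - f a)) {a..c}"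
proof (cases "a = c")
  case True then show ?thesis using has_integral_refl(2)[of f' a] by simp
next
  case False
  then have less: "a < c" using ab by simp
  \<comment> \<open>\<open>f'\<close> is arbitrary on \<open>N\<close>. With 0 in its place, only
    the increment of \<open>f\<close> remains for a tag in \<open>N\<close>; the change on a null
    set is undone at the end.\<close>
  define g where "g t = (if t \<in> N then 0 else f' t)" for t
  have "(g has_integral (f c - f a)) (cbox a c)"
    unfolding has_integral_factor_content
  proof (intro allI impI)
    fix e :: real assume e: "e > 0"
    have "\<forall>t. \<exists>d>0. t \<in> {a..c} - N \<longrightarrow>
         (\<forall>y\<in>{a..c}. norm (y-t) < d \<longrightarrow> norm (f y - f t - (y-t) *\<^sub>R f' t) \<le> e/2 * norm (y-t))"
    proof
      fix t
      show "\<exists>d>0. t \<in> {a..c} - N \<longrightarrow>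
         (\<forall>y\<in>{a..c}. norm (y-t) < d \<longrightarrow> norm (f y - f t - (y-t) *\<^sub>R f' t) \<le> e/2 * norm (y-t))"
      proof (cases "t \<in> {a..c} - N")
        case True
        then show ?thesis
          using deriv[OF True, unfolded has_vector_derivative_def has_derivative_within_alt] half_gt_zero[OF e] by blast
      qed (auto intro: exI[of _ 1])
    qed
    then obtain d where d: "\<And>t. 0 < d t"
       "\<And>t y. \<lbrakk>t \<in> {a..c} - N; y \<in> {a..c}; norm (y-t) < d t\<rbrakk>
                        \<Longrightarrow> norm (f y - f t - (y-t) *\<^sub>R f' t) \<le> e/2 * norm (y-t)"
      by metis
    have e': "e/2 * (c - a) > 0" using e less by simp
    obtain \<delta> where \<delta>: "\<delta> > 0" "\<forall>D. D division_of \<Union>D \<longrightarrow> \<Union>D \<subseteq> {a..c} \<longrightarrow> (\<Sum>k\<in>D. Sup k - Inf k) < \<delta> \<longrightarrow>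
       (\<Sum>k\<in>D. cmod (f (Sup k) - f (Inf k))) < e/2 * (c - a)"
      by (rule abs_cont_onD[OF ac e'])
    note \<delta> = \<delta>(1) \<delta>(2)[rule_format]
    have Nset: "N \<in> sets lebesgue" "N \<in> null_sets lebesgue" using N negligible_iff_null_sets by auto
    \<comment> \<open>The open set around \<open>N\<close> has measure below the \<delta> that
      absolute continuity gives for \<open>e/2 * (c - a)\<close>.\<close>
    obtain U where U: "open U" "N \<subseteq> U" "U - N \<in> lmeasurable" "emeasure lebesgue (U - N) < ennreal \<delta>"
      using sets_lebesgue_outer_open[OF Nset(1) \<delta>(1)] by blast
    have Umeas: "U \<in> lmeasurable" "measure lebesgue U < \<delta>"
    proof -
      have eq: "emeasure lebesgue U = emeasure lebesgue (U - N)"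
        using U(1) Nset(2) by (simp add: emeasure_Diff_null_set)
      then show "U \<in> lmeasurable" using U(1,4) \<delta>(1)
        by (intro fmeasurableI) (auto intro: less_trans)
      then show "measure lebesgue U < \<delta>" using U(4) \<delta>(1) eq
        by (metis emeasure_eq_measure2 ennreal_less_iff measure_nonneg)
    qed
    have "\<exists>r>0. t \<in> U \<longrightarrow> ball t r \<subseteq> U" for t using U(1) openE by (metis zero_less_one)
    then obtain r where r: "\<And>t. r t > 0" "\<And>t. t \<in> U \<Longrightarrow> ball t (r t) \<subseteq> U" by metis
    \<comment> \<open>Intervals tagged in \<open>N\<close> are forced into \<open>U\<close>; at all
      other tags the gauge is the one of the derivative estimate.\<close>
    define \<gamma> where "\<gamma> t = ball t (if t \<in> N then r t else d t)" for t
    have gauge: "gauge \<gamma>" unfolding \<gamma>_def using r d by (intro gauge_ball_dependent) auto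
    have bound: "norm ((\<Sum>(t, k)\<in>p. measure lborel k *\<^sub>R g t) - (f c - f a)) \<le> e * measure lborel (cbox a c)"
      if p: "p tagged_division_of cbox a c" and fine: "\<gamma> fine p" for p
    proof -
      have finp: "finite p" using p by (simp add: tagged_division_of_def tagged_partial_division_of_def)
      have K: "\<exists>u v. k = {u..v} \<and> u \<le> v \<and> t \<in> k \<and> k \<subseteq> {a..c} \<and> k \<subseteq> \<gamma> t \<and> Inf k = u \<and> Sup k = v"
        if tk: "(t, k) \<in> p" for t k
      proof -
        obtain u v where k: "k = cbox u v" using tagged_division_ofD(4)[OF p tk] by blast
        have "t \<in> k" "k \<subseteq> cbox a c" using tagged_division_ofD(2,3)[OF p tk] by auto
        moreover have "k \<subseteq> \<gamma> t" using fine tk by (auto simp: fine_def)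
        ultimately show ?thesis using k by (intro exI[of _ u] exI[of _ v]) auto
      qed
      let ?q = "{(t, k) \<in> p. t \<in> N}" and ?q' = "{(t, k) \<in> p. t \<notin> N}"
      have pq: "p = ?q \<union> ?q'" "?q \<inter> ?q' = {}" by auto
      have finq: "finite ?q" "finite ?q'" using finp by (auto intro: finite_subset)
      define E where "E tk = (case tk of (t, k) \<Rightarrow> measure lborel k *\<^sub>R g t - (f (Sup k) - f (Inf k)))" for tk :: "real \<times> real set"
      have "(\<Sum>(t, k)\<in>p. f (Sup k) - f (Inf k)) = f c - f a"
        using additive_tagged_division_1[of a c p f] p ab by simp
      then have "(\<Sum>(t, k)\<in>p. measure lborel k *\<^sub>R g t) - (f c - f a) = sum E p"
        unfolding E_def by (simp add: split_def sum_subtractf)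
      also have "sum E p = sum E ?q + sum E ?q'"
        using finq pq(2) by (subst pq(1)) (rule sum.union_disjoint)
      also have "norm \<dots> \<le> norm (sum E ?q) + norm (sum E ?q')" by (rule norm_triangle_ineq)
      also have "norm (sum E ?q) \<le> e/2 * (c - a)"
      proof -
        let ?D = "snd ` ?q"
        \<comment> \<open>The passage from tagged intervals to the division requires the value 0 on
          every interval without interior, the empty one included.\<close>
        define h where "h k = (if k = {} then 0 else cmod (f (Sup k) - f (Inf k)))" for k :: "real set"
        have part: "?q tagged_partial_division_of cbox a c"
          using p tagged_partial_division_subset[of p "cbox a c" ?q] unfolding tagged_division_of_def by auto
        note D = partial_division_of_tagged_division[OF part]
        note tag = tagged_partial_division_of_Union_self[OF part]
        have sub: "\<Union>?D \<subseteq> {a..c}" using K by fastforce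
        have subU: "\<Union>?D \<subseteq> U"
        proof clarify
          fix s t k assume "s \<in> snd (t, k)" "(t, k) \<in> p" "t \<in> N"
          then have "s \<in> ball t (r t)" "t \<in> U" using K[of t k] U(2) by (auto simp: \<gamma>_def)
          then show "s \<in> U" using r(2) by blast
        qed
        have "(\<Sum>k\<in>?D. Sup k - Inf k) = (\<Sum>k\<in>?D. measure lebesgue k)"
        proof (rule sum.cong[OF refl])
          fix k assume "k \<in> ?D"
          then obtain t where "(t, k) \<in> p" by auto
          then obtain u v where "k = {u..v}" "u \<le> v" using K by blast
          then show "Sup k - Inf k = measure lebesgue k" by simp
        qed
        also have "\<dots> = measure lebesgue (\<Union>?D)" by (rule content_division[OF D])
        also have "\<dots> \<le> measure lebesgue U"
          using Umeas(1) subU lmeasurable_division[OF D] by (intro measure_mono_fmeasurable) auto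
        also have "\<dots> < \<delta>" by (rule Umeas)
        finally have small: "(\<Sum>k\<in>?D. cmod (f (Sup k) - f (Inf k))) < e/2 * (c - a)"
          by (rule \<delta>(2)[OF D sub])
        have "norm (sum E ?q) \<le> (\<Sum>(t, k)\<in>?q. h k)"
        proof (rule sum_norm_le)
          fix tk assume tk: "tk \<in> ?q"
          then obtain t k where "tk = (t, k)" "(t, k) \<in> p" "t \<in> N" by auto
          then show "norm (E tk) \<le> (case tk of (t, k) \<Rightarrow> h k)" using K[of t k]
            by (auto simp: E_def g_def h_def norm_minus_commute)
        qed
        also have "\<dots> = sum h ?D"
        proof (rule sum.over_tagged_division_lemma[OF tag])
          fix u v :: real assume "box u v = {}"
          then have "v \<le> u" by simp
          then show "h (cbox u v) = 0" by (cases "u = v") (auto simp: h_def)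
        qed
        also have "\<dots> = (\<Sum>k\<in>?D. cmod (f (Sup k) - f (Inf k)))"
        proof (intro sum.cong refl)
          fix k assume "k \<in> ?D"
          then obtain t where "(t, k) \<in> p" by auto
          then have "k \<noteq> {}" using K by blast
          then show "h k = cmod (f (Sup k) - f (Inf k))" by (simp add: h_def)
        qed
        finally show ?thesis using small by simp
      qed
      also have "norm (sum E ?q') \<le> e/2 * (c - a)"
      proof -
        have "norm (sum E ?q') \<le> (\<Sum>(t, k)\<in>?q'. e/2 * (Sup k - Inf k))"
        proof (rule sum_norm_le)
          fix tk assume "tk \<in> ?q'"
          then obtain t k where tk: "tk = (t, k)" "(t, k) \<in> p" "t \<notin> N" by auto
          obtain u v where k: "k = {u..v}" "u \<le> v" "t \<in> k" "k \<subseteq> {a..c}" "k \<subseteq> \<gamma> t" using K[OF tk(2)] by blast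
          have "u \<in> \<gamma> t" "v \<in> \<gamma> t" using k by auto
          then have uv: "u \<in> {a..c}" "v \<in> {a..c}" "t \<in> {a..c} - N" "norm (u - t) < d t" "norm (v - t) < d t"
            using k tk(3) by (auto simp: \<gamma>_def dist_norm norm_minus_commute)
          \<comment> \<open>The increment is split at the tag, so the derivative estimate at
            \<open>t\<close> applies to both end points.\<close>
          have "(v - u) *\<^sub>R f' t - (f v - f u) = (f u - f t - (u - t) *\<^sub>R f' t) - (f v - f t - (v - t) *\<^sub>R f' t)"
            by (simp add: algebra_simps)
          also have "norm \<dots> \<le> e/2 * norm (u - t) + e/2 * norm (v - t)"
            by (rule order_trans[OF norm_triangle_ineq4 add_mono[OF d(2)[OF uv(3,1,4)] d(2)[OF uv(3,2,5)]]])
          also have "\<dots> = e/2 * (v - u)"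
          proof -
            have "norm (u - t) = t - u" "norm (v - t) = v - t" using k by auto
            then have "e/2 * norm (u - t) + e/2 * norm (v - t) = e/2 * ((t - u) + (v - t))" by (simp only: distrib_left)
            then show ?thesis by simp
          qed
          finally show "norm (E tk) \<le> (case tk of (t, k) \<Rightarrow> e/2 * (Sup k - Inf k))"
            using tk k by (simp add: E_def g_def)
        qed
        also have "\<dots> \<le> (\<Sum>(t, k)\<in>p. e/2 * (Sup k - Inf k))"
        proof (rule sum_mono2[OF finp])
          fix tk assume "tk \<in> p - ?q'"
          then obtain t k where "tk = (t, k)" "(t, k) \<in> p" by (cases tk) auto
          then show "0 \<le> (case tk of (t, k) \<Rightarrow> e/2 * (Sup k - Inf k))" using K[of t k] e by auto
        qed auto
        also have "\<dots> = e/2 * (\<Sum>(t, k)\<in>p. Sup k - Inf k)" by (simp add: sum_distrib_left split_def)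
        also have "(\<Sum>(t, k)\<in>p. Sup k - Inf k) = c - a"
          using additive_tagged_division_1[of a c p "\<lambda>x. x"] p ab by simp
        finally show ?thesis .
      qed
      finally show ?thesis using ab by (simp add: field_simps)
    qed
    show "\<exists>\<gamma>. gauge \<gamma> \<and> (\<forall>p. p tagged_division_of cbox a c \<and> \<gamma> fine p \<longrightarrow>
      norm ((\<Sum>(t, k)\<in>p. measure lborel k *\<^sub>R g t) - (f c - f a)) \<le> e * measure lborel (cbox a c))"
    proof (intro exI[of _ \<gamma>] conjI allI impI gauge)
      fix p assume "p tagged_division_of cbox a c \<and> \<gamma> fine p"
      then show "norm ((\<Sum>(t, k)\<in>p. measure lborel k *\<^sub>R g t) - (f c - f a)) \<le> e * measure lborel (cbox a c)"
        by (intro bound) auto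
    qed
  qed
  then show ?thesis using has_integral_spike[OF N, of "cbox a c" f' g] by (simp add: g_def)
qed


section \<open>The Schroedinger operator and Green's formula\<close>

lemma AE_lebesgue_on_iff:
  assumes "S \<in> sets lebesgue"
  shows "(AE t in lebesgue_on S. P t) \<longleftrightarrow> (\<exists>N. negligible N \<and> (\<forall>t\<in>S - N. P t))"
proof -
  have "(AE t in lebesgue_on S. P t) \<longleftrightarrow> (AE t in lebesgue. t \<in> S \<longrightarrow> P t)"
    using assms by (intro AE_restrict_space_iff) auto
  also have "\<dots> \<longleftrightarrow> (\<exists>N. negligible N \<and> (\<forall>t\<in>S - N. P t))"
    unfolding eventually_ae_filter_negligible by (intro arg_cong[where f=Ex] ext) blast
  finally show ?thesis .
qed

text \<open>Completeness of Lebesgue measure. It gives measurability of second derivatives, which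
  are identified only off a null set.\<close>

lemma borel_measurable_lebesgue_on_AE:
  fixes f g :: "real \<Rightarrow> complex"
  assumes S: "S \<in> sets lebesgue" and f: "f \<in> borel_measurable (lebesgue_on S)"
    and ae: "AE t in lebesgue_on S. f t = g t"
  shows "g \<in> borel_measurable (lebesgue_on S)"
proof -
  have iff: "h \<in> borel_measurable (lebesgue_on S) \<longleftrightarrow> (\<lambda>t. indicator S t *\<^sub>R h t) \<in> borel_measurable lebesgue"
    for h :: "real \<Rightarrow> complex"
    using S by (intro borel_measurable_restrict_space_iff) auto
  have "AE t in lebesgue. t \<in> S \<longrightarrow> f t = g t"
    using ae S by (subst (asm) AE_restrict_space_iff) auto
  then have "AE t in lebesgue. indicator S t *\<^sub>R f t = indicator S t *\<^sub>R g t"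
    by eventually_elim (auto simp: indicator_def)
  from borel_measurable_AE[OF f[unfolded iff] this] show ?thesis unfolding iff .
qed

locale point_interactions =
  fixes b :: ereal and x \<alpha> :: "nat \<Rightarrow> real"
  assumes x0: "x 0 = 0" and x_strict: "strict_mono x" and x_less_b: "\<And>n. ereal (x n) < b"
    and x_lim: "(\<lambda>n. ereal (x n)) \<longlonglongrightarrow> b"
begin

section \<open>The points \<open>x n\<close> and the pieces between them\<close>

definition "I = half_open b"
definition "X = x ` {1..}"
abbreviation "L \<equiv> lebesgue_on I"
abbreviation "D1 \<equiv> deriv_in I"
abbreviation "D2 f \<equiv> deriv_in I (deriv_in I f)"

lemma x_mono: "m \<le> n \<Longrightarrow> x m \<le> x n"
  using x_strict by (simp add: strict_mono_less_eq)

lemma x_less: "x n < x (Suc n)"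
  using x_strict by (simp add: strict_mono_def)

lemma x_nonneg: "0 \<le> x n"
  using x_mono[of 0 n] x0 by simp

lemma ex_x_gt: assumes "ereal t < b" obtains n where "t < x n"
proof -
  have "\<forall>\<^sub>F n in sequentially. ereal t < ereal (x n)" by (rule order_tendstoD(1)[OF x_lim assms])
  then show thesis using that by (auto simp: eventually_sequentially)
qed

text \<open>Replaces the possibly infinite end point \<open>b\<close> by the points
  \<open>x n\<close>.\<close>

lemma mem_I: "t \<in> I \<longleftrightarrow> 0 \<le> t \<and> (\<exists>n. t < x n)"
proof
  assume t: "t \<in> I"
  then have "ereal t < b" by (simp add: I_def half_open_def)
  then obtain n where "t < x n" by (rule ex_x_gt)
  then show "0 \<le> t \<and> (\<exists>n. t < x n)" using t by (auto simp: I_def half_open_def)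
next
  assume "0 \<le> t \<and> (\<exists>n. t < x n)"
  then obtain n where "0 \<le> t" "t < x n" by blast
  moreover have "ereal t < b" using \<open>t < x n\<close> less_trans[of "ereal t" "ereal (x n)" b] x_less_b by simp
  ultimately show "t \<in> I" by (simp add: I_def half_open_def)
qed

lemma piece_ex: assumes "t \<in> I" obtains n where "x n \<le> t" "t < x (Suc n)"
proof -
  define m where "m = (LEAST n. t < x n)"
  have m: "t < x m" using assms unfolding m_def mem_I by (metis LeastI)
  then obtain n where n: "m = Suc n" using assms x0 by (cases m) (auto simp: mem_I)
  have "x n \<le> t" using not_less_Least[of n "\<lambda>n. t < x n"] n by (auto simp: m_def[symmetric])
  then show thesis using that m n by blast
qed

lemma I_subset: "c < x n \<Longrightarrow> 0 \<le> a \<Longrightarrow> {a..c} \<subseteq> I"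
  by (auto simp: mem_I intro!: exI[of _ n])

lemma piece_in_I: "{x n..x (Suc n)} \<subseteq> I"
  using I_subset[OF x_less[of "Suc n"] x_nonneg] .

lemma interval_in_I: "{0..x n} \<subseteq> I"
  using I_subset[OF x_less] by simp

lemma X_iff: "t \<in> X \<longleftrightarrow> (\<exists>n\<ge>1. t = x n)"
  by (auto simp: X_def)

lemma piece_not_X: "x n < t \<Longrightarrow> t < x (Suc n) \<Longrightarrow> t \<in> I - X"
proof -
  assume t: "x n < t" "t < x (Suc n)"
  have "t \<noteq> x m" for m using t x_mono[of m n] x_mono[of "Suc n" m] by (cases "m \<le> n") auto
  moreover have "t \<in> I" using t x_nonneg[of n] by (auto simp: mem_I intro!: exI[of _ "Suc n"])
  ultimately show ?thesis by (auto simp: X_iff)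
qed

lemma zero_not_X: "t \<ge> 0 \<Longrightarrow> t < x 1 \<Longrightarrow> t \<in> I - X"
proof -
  assume t: "t \<ge> 0" "t < x 1"
  have "t \<noteq> x m" if "m \<ge> 1" for m using t x_mono[OF that] by auto
  then show ?thesis using t by (auto simp: X_iff mem_I)
qed

text \<open>The point 0 is not in \<open>X\<close> and belongs to the first piece, hence the extra
  case.\<close>

lemma I_minus_X: assumes "t \<in> I - X" shows "\<exists>n. (x n < t \<or> n = 0 \<and> t = 0) \<and> t < x (Suc n)"
proof -
  obtain n where n: "x n \<le> t" "t < x (Suc n)" using piece_ex assms by blast
  have "x n < t \<or> n = 0 \<and> t = 0"
  proof (cases "n = 0")
    case False
    then have "t \<noteq> x n" using assms by (auto simp: X_iff)
    then show ?thesis using n by auto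
  qed (use n x0 in auto)
  then show ?thesis using n by blast
qed

lemma X_negligible: "negligible X"
  unfolding X_def negligible_iff_null_sets by (intro null_sets_completionI countable_imp_null_set_lborel) auto

lemma I_sets: "I \<in> sets lebesgue"
proof -
  have "I = (\<Union>n. {0..<x n})" by (auto simp: mem_I)
  then have "I \<in> sets borel" by auto
  then show ?thesis by (simp add: lborelD sets_completionI_sets)
qed

lemma at_I_nontrivial: assumes "t \<in> I" shows "at t within I \<noteq> bot"
proof -
  obtain n where n: "t < x n" using assms by (auto simp: mem_I)
  have "{t..x n} \<subseteq> I" using assms I_subset[OF x_less[of n], of t] by (auto simp: mem_I)
  then have "t islimpt I" using n islimpt_subset[of t "{t..x n}" I] by auto
  then show ?thesis by (simp add: trivial_limit_within)
qed

lemma D1_eq: "(f has_vector_derivative d) (at t within I) \<Longrightarrow> t \<in> I \<Longrightarrow> D1 f t = d"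
  unfolding deriv_in_def using vector_derivative_within at_I_nontrivial by blast

lemma D1_works: "f differentiable (at t within I) \<Longrightarrow> (f has_vector_derivative D1 f t) (at t within I)"
  unfolding deriv_in_def by (simp add: vector_derivative_works)

text \<open>\<open>I - X\<close> is relatively open in \<open>I\<close>; therefore derivatives
  relative to \<open>I\<close> at its points do not see the values on \<open>X\<close>.\<close>

lemma near_I: assumes "t \<in> I - X" obtains d where "d > 0" "\<And>s. s \<in> I \<Longrightarrow> dist s t < d \<Longrightarrow> s \<in> I - X"
proof -
  obtain n where n: "x n < t \<or> n = 0 \<and> t = 0" "t < x (Suc n)" using I_minus_X[OF assms] by blast
  show thesis
  proof (cases "x n < t")
    case True
    show ?thesis
    proof (rule that[of "min (t - x n) (x (Suc n) - t)"])
      fix s assume "dist s t < min (t - x n) (x (Suc n) - t)"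
      then have "x n < s" "s < x (Suc n)" by (auto simp: dist_real_def)
      then show "s \<in> I - X" by (rule piece_not_X)
    qed (use True n in auto)
  next
    case False
    then have t: "n = 0" "t = 0" using n by auto
    show ?thesis
    proof (rule that[of "x 1"])
      show "x 1 > 0" using x_less[of 0] x0 by simp
      fix s assume "s \<in> I" "dist s t < x 1"
      then show "s \<in> I - X" using t by (intro zero_not_X) (auto simp: dist_real_def mem_I)
    qed
  qed
qed

lemma has_deriv_cong_near:
  assumes t: "t \<in> I - X" and eq: "\<And>s. s \<in> I - X \<Longrightarrow> f s = g s"
    and d: "(f has_vector_derivative d) (at t within I)"
  shows "(g has_vector_derivative d) (at t within I)"
proof -
  obtain r where r: "r > 0" "\<And>s. s \<in> I \<Longrightarrow> dist s t < r \<Longrightarrow> s \<in> I - X" using near_I[OF t] by blast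
  show ?thesis using d r t eq by (intro has_vector_derivative_transform_within[OF d r(1)]) auto
qed

section \<open>The space \<open>W22\<close>\<close>

lemma W22_D:
  assumes "f \<in> W22 I X"
  shows "f \<in> L2 L" "AC_loc (I - X) f" "\<And>t. t \<in> I - X \<Longrightarrow> (f has_vector_derivative D1 f t) (at t within I)"
    "AC_loc (I - X) (D1 f)" "D2 f \<in> L2 L"
    "\<exists>N. negligible N \<and> (\<forall>t\<in>I - N. (D1 f has_vector_derivative D2 f t) (at t within I))"
proof -
  have W: "f \<in> L2 L" "AC_loc (I - X) f" "\<And>t. t \<in> I - X \<Longrightarrow> f differentiable (at t within I)"
    "AC_loc (I - X) (D1 f)" "D2 f \<in> L2 L" "AE t in L. D1 f differentiable (at t within I)"
    using assms by (auto simp: W22_def)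
  show "f \<in> L2 L" "AC_loc (I - X) f" "\<And>t. t \<in> I - X \<Longrightarrow> (f has_vector_derivative D1 f t) (at t within I)"
    "AC_loc (I - X) (D1 f)" "D2 f \<in> L2 L" using W D1_works by auto
  show "\<exists>N. negligible N \<and> (\<forall>t\<in>I - N. (D1 f has_vector_derivative D2 f t) (at t within I))"
    using W(6) D1_works unfolding AE_lebesgue_on_iff[OF I_sets] by blast
qed

text \<open>Membership and the identification of the derivatives come together, because
  \<open>D1\<close> and \<open>D2\<close> are defined by choice: candidates \<open>f'\<close> and
  \<open>f''\<close> are supplied and then recognised, the second one off a null set.\<close>

lemma W22_I:
  assumes "f \<in> L2 L" "AC_loc (I - X) f" "\<And>t. t \<in> I - X \<Longrightarrow> (f has_vector_derivative f' t) (at t within I)"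
    and "AC_loc (I - X) f'" and N: "negligible N" "\<And>t. t \<in> I - X - N \<Longrightarrow> (f' has_vector_derivative f'' t) (at t within I)"
    and "f'' \<in> L2 L"
  shows "f \<in> W22 I X" "\<And>t. t \<in> I - X \<Longrightarrow> D1 f t = f' t" "\<And>t. t \<in> I - X - N \<Longrightarrow> D2 f t = f'' t"
    "AE t in L. D2 f t = f'' t"
proof -
  show D1: "D1 f t = f' t" if "t \<in> I - X" for t using D1_eq[OF assms(3)[OF that]] that by auto
  have der: "(D1 f has_vector_derivative f'' t) (at t within I)" if "t \<in> I - X - N" for t
    using N(2)[OF that] that D1 by (intro has_deriv_cong_near[of t f' "D1 f"]) auto
  then show D2: "D2 f t = f'' t" if "t \<in> I - X - N" for t using D1_eq that by auto
  have XN: "negligible (X \<union> N)" using X_negligible N(1) by (rule negligible_Un)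
  show ae: "AE t in L. D2 f t = f'' t"
    unfolding AE_lebesgue_on_iff[OF I_sets] using D2 by (intro exI[of _ "X \<union> N"] conjI XN) auto
  have ae': "AE t in L. D1 f differentiable (at t within I)"
    unfolding AE_lebesgue_on_iff[OF I_sets]
    using der differentiableI_vector by (intro exI[of _ "X \<union> N"] conjI XN) blast
  have "D2 f \<in> borel_measurable L"
    using ae by (intro borel_measurable_lebesgue_on_AE[OF I_sets L2_D(1)[OF assms(7)]]) auto
  then have D2L: "D2 f \<in> L2 L" using ae by (intro L2_cong_AE[OF assms(7)])
  have "AC_loc (I - X) (D1 f)"
    unfolding AC_loc_def
  proof (intro allI impI)
    fix a c assume ac: "{a..c} \<subseteq> I - X"
    have "abs_cont_on {a..c} f'" using assms(4) ac by (auto simp: AC_loc_def)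
    then show "abs_cont_on {a..c} (D1 f)"
      using D1 ac by (elim abs_cont_on_bound[of _ _ 1]) (auto simp: subset_iff)
  qed
  moreover have "\<forall>t\<in>I - X. f differentiable (at t within I)" using assms(3) differentiableI_vector by blast
  ultimately show "f \<in> W22 I X" unfolding W22_def using assms(1,2) ae' D2L by (intro CollectI conjI)
qed

lemma W22_linear:
  assumes f: "f \<in> W22 I X" and g: "g \<in> W22 I X"
  shows "(\<lambda>t. c * f t + g t) \<in> W22 I X" "\<And>t. t \<in> I - X \<Longrightarrow> D1 (\<lambda>t. c * f t + g t) t = c * D1 f t + D1 g t"
    "AE t in L. D2 (\<lambda>t. c * f t + g t) t = c * D2 f t + D2 g t"
proof -
  note F = W22_D[OF f] and G = W22_D[OF g]
  obtain N N' where N: "negligible N" "\<forall>t\<in>I - N. (D1 f has_vector_derivative D2 f t) (at t within I)"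
    and N': "negligible N'" "\<forall>t\<in>I - N'. (D1 g has_vector_derivative D2 g t) (at t within I)"
    using F(6) G(6) by blast
  have 1: "(\<lambda>t. c * f t + g t) \<in> L2 L" "(\<lambda>t. c * D2 f t + D2 g t) \<in> L2 L"
    using F G by (auto intro!: L2_add L2_scale)
  have 2: "AC_loc (I - X) (\<lambda>t. c * f t + g t)" "AC_loc (I - X) (\<lambda>t. c * D1 f t + D1 g t)"
    using F G unfolding AC_loc_def by (auto intro!: abs_cont_on_add abs_cont_on_scale)
  have 3: "((\<lambda>t. c * f t + g t) has_vector_derivative c * D1 f t + D1 g t) (at t within I)" if "t \<in> I - X" for t
    using F(3)[OF that] G(3)[OF that] by (intro has_vector_derivative_add has_vector_derivative_mult_right)
  have 4: "((\<lambda>t. c * D1 f t + D1 g t) has_vector_derivative c * D2 f t + D2 g t) (at t within I)"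
    if "t \<in> I - X - (N \<union> N')" for t
    using N N' that by (intro has_vector_derivative_add has_vector_derivative_mult_right) auto
  note W = W22_I[OF 1(1) 2(1) 3 2(2) negligible_Un[OF N(1) N'(1)] 4 1(2)]
  show "(\<lambda>t. c * f t + g t) \<in> W22 I X" "\<And>t. t \<in> I - X \<Longrightarrow> D1 (\<lambda>t. c * f t + g t) t = c * D1 f t + D1 g t"
    "AE t in L. D2 (\<lambda>t. c * f t + g t) t = c * D2 f t + D2 g t"
    using W by blast+
qed

section \<open>One-sided limits and Green's formula\<close>

lemma eventually_right: "eventually (\<lambda>t. t \<in> I - X \<and> x n < t \<and> t < x (Suc n)) (at_right (x n))"
  using x_less[of n] piece_not_X by (auto simp: eventually_at_right_field intro!: exI[of _ "x (Suc n)"])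

lemma eventually_left: "eventually (\<lambda>t. t \<in> I - X \<and> x n < t \<and> t < x (Suc n)) (at_left (x (Suc n)))"
  using x_less[of n] piece_not_X by (auto simp: eventually_at_left_field intro!: exI[of _ "x n"])

lemma tendsto_right_piece:
  assumes "(g \<longlongrightarrow> l) (at_right (x n))" "\<And>t. t \<in> I - X \<Longrightarrow> x n < t \<Longrightarrow> t < x (Suc n) \<Longrightarrow> f t = g t"
  shows "(f \<longlongrightarrow> l) (at_right (x n))"
proof (rule Lim_transform_eventually[OF assms(1)])
  show "\<forall>\<^sub>F t in at_right (x n). g t = f t" using eventually_right[of n] by eventually_elim (simp add: assms(2))
qed

lemma tendsto_left_piece:
  assumes "(g \<longlongrightarrow> l) (at_left (x (Suc n)))" "\<And>t. t \<in> I - X \<Longrightarrow> x n < t \<Longrightarrow> t < x (Suc n) \<Longrightarrow> f t = g t"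
  shows "(f \<longlongrightarrow> l) (at_left (x (Suc n)))"
proof (rule Lim_transform_eventually[OF assms(1)])
  show "\<forall>\<^sub>F t in at_left (x (Suc n)). g t = f t" using eventually_left[of n] by eventually_elim (simp add: assms(2))
qed

text \<open>The boundary form of the operator, sesquilinear to match \<open>L2_inner\<close>;
  \<open>green_density\<close> is its derivative off a null set.\<close>

definition wron :: "(real \<Rightarrow> complex) \<Rightarrow> (real \<Rightarrow> complex) \<Rightarrow> real \<Rightarrow> complex" where
  "wron u v t = D1 u t * cnj (v t) - u t * cnj (D1 v t)"

definition green_density :: "(real \<Rightarrow> complex) \<Rightarrow> (real \<Rightarrow> complex) \<Rightarrow> real \<Rightarrow> complex" where
  "green_density u v t = D2 u t * cnj (v t) - u t * cnj (D2 v t)"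

lemma green_density_integrable:
  assumes "u \<in> W22 I X" "v \<in> W22 I X" shows "integrable L (green_density u v)"
  unfolding green_density_def using W22_D(1,5)[OF assms(1)] W22_D(1,5)[OF assms(2)]
  by (intro Bochner_Integration.integrable_diff L2_inner_integrable)

lemma wron_abs_cont:
  assumes u: "u \<in> W22 I X" and v: "v \<in> W22 I X" and ac: "{a..c} \<subseteq> I - X"
  shows "abs_cont_on {a..c} (wron u v)"
proof -
  have "abs_cont_on {a..c} u" "abs_cont_on {a..c} (D1 u)" "abs_cont_on {a..c} v" "abs_cont_on {a..c} (D1 v)"
    using W22_D(2,4)[OF u] W22_D(2,4)[OF v] ac by (auto simp: AC_loc_def)
  then show ?thesis unfolding wron_def[abs_def] by (intro abs_cont_on_diff abs_cont_on_mult abs_cont_on_cnj)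
qed

lemma green_piece:
  assumes u: "u \<in> W22 I X" and v: "v \<in> W22 I X" and ac: "{a..c} \<subseteq> I - X" "a \<le> c"
  shows "(green_density u v has_integral (wron u v c - wron u v a)) {a..c}"
proof -
  obtain N N' where N: "negligible N" "\<forall>t\<in>I - N. (D1 u has_vector_derivative D2 u t) (at t within I)"
    and N': "negligible N'" "\<forall>t\<in>I - N'. (D1 v has_vector_derivative D2 v t) (at t within I)"
    using W22_D(6)[OF u] W22_D(6)[OF v] by blast
  show ?thesis
  proof (rule abs_cont_on_FTC[OF ac(2) wron_abs_cont[OF u v ac(1)] negligible_Un[OF N(1) N'(1)]])
    fix t assume t: "t \<in> {a..c} - (N \<union> N')"
    then have tI: "t \<in> I - X" using ac(1) by blast
    have "(u has_vector_derivative D1 u t) (at t within I)" "(v has_vector_derivative D1 v t) (at t within I)"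
      "(D1 u has_vector_derivative D2 u t) (at t within I)" "(D1 v has_vector_derivative D2 v t) (at t within I)"
      using W22_D(3)[OF u tI] W22_D(3)[OF v tI] N(2) N'(2) t tI by auto
    then have d: "(u has_vector_derivative D1 u t) (at t within {a..c})" "(v has_vector_derivative D1 v t) (at t within {a..c})"
      "(D1 u has_vector_derivative D2 u t) (at t within {a..c})" "(D1 v has_vector_derivative D2 v t) (at t within {a..c})"
      using ac(1) by (auto intro: has_vector_derivative_within_subset)
    show "(wron u v has_vector_derivative green_density u v t) (at t within {a..c})"
      unfolding wron_def[abs_def] green_density_def
      by (rule has_vector_derivative_eq_rhs[OF has_vector_derivative_diff[OF
          has_vector_derivative_mult[OF d(3) has_vector_derivative_cnj[OF d(2)]]
          has_vector_derivative_mult[OF d(1) has_vector_derivative_cnj[OF d(4)]]]]) simp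
  qed
qed

lemma green_density_on:
  assumes u: "u \<in> W22 I X" and v: "v \<in> W22 I X" and ac: "{a..c} \<subseteq> I"
  shows "green_density u v integrable_on {a..c}"
  using integrable_on_subinterval[OF integrable_on_lebesgue_on[OF green_density_integrable[OF u v] I_sets], of a c] ac
  by simp

text \<open>The end points may belong to \<open>X\<close>, where the Wronskian itself need not be
  continuous. Inside the piece it differs by a constant from the indefinite integral of the density,
  which is continuous up to both ends.\<close>

lemma green_interval:
  assumes u: "u \<in> W22 I X" and v: "v \<in> W22 I X"
    and wl: "(wron u v \<longlongrightarrow> wl) (at_right (x n))" and wr: "(wron u v \<longlongrightarrow> wr) (at_left (x (Suc n)))"
  shows "(green_density u v has_integral (wr - wl)) {x n..x (Suc n)}"
proof -
  let ?h = "green_density u v" and ?a = "x n" and ?c = "x (Suc n)"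
  define F where "F t = integral {?a..t} ?h" for t
  have int: "?h integrable_on {?a..?c}" by (rule green_density_on[OF u v piece_in_I])
  have cont: "continuous_on {?a..?c} F"
    unfolding F_def by (rule indefinite_integral_continuous_1[OF int])
  define m where "m = (?a + ?c) / 2"
  have m: "?a < m" "m < ?c" using x_less[of n] by (auto simp: m_def)
  have eq: "wron u v t = wron u v m + (F t - F m)" if t: "?a < t" "t < ?c" for t
  proof -
    have *: "wron u v s - wron u v r = F s - F r" if "?a < r" "r \<le> s" "s < ?c" for r s
    proof -
      have "{r..s} \<subseteq> I - X" using that by (auto intro!: piece_not_X[of n])
      from green_piece[OF u v this that(2)] have A: "integral {r..s} ?h = wron u v s - wron u v r"
        by (rule integral_unique)
      have "F r + integral {r..s} ?h = F s"
        unfolding F_def using that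
        by (intro Henstock_Kurzweil_Integration.integral_combine integrable_on_subinterval[OF int]) auto
      then have "F s = F r + (wron u v s - wron u v r)" unfolding A by simp
      then show ?thesis by simp
    qed
    show ?thesis using *[of m t] *[of t m] m t by (cases "m \<le> t") (auto simp: algebra_simps)
  qed
  have "(F \<longlongrightarrow> F ?c) (at ?c within {?a..?c})" "(F \<longlongrightarrow> F ?a) (at ?a within {?a..?c})"
    using cont x_less[of n] by (auto simp: continuous_on_def)
  then have Fl: "(F \<longlongrightarrow> F ?c) (at_left ?c)" "(F \<longlongrightarrow> F ?a) (at_right ?a)"
    using x_less[of n] by (auto simp: at_within_Icc_at_left at_within_Icc_at_right)
  have "((\<lambda>t. wron u v m + (F t - F m)) \<longlongrightarrow> wr) (at_left ?c)"
    using eventually_left[of n] by (intro Lim_transform_eventually[OF wr]) (auto elim!: eventually_mono simp: eq)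
  moreover have "((\<lambda>t. wron u v m + (F t - F m)) \<longlongrightarrow> wron u v m + (F ?c - F m)) (at_left ?c)"
    by (intro tendsto_intros Fl)
  ultimately have wr': "wr = wron u v m + (F ?c - F m)"
    by (intro tendsto_unique[of "at_left ?c"]) auto
  have "((\<lambda>t. wron u v m + (F t - F m)) \<longlongrightarrow> wl) (at_right ?a)"
    using eventually_right[of n] by (intro Lim_transform_eventually[OF wl]) (auto elim!: eventually_mono simp: eq)
  moreover have "((\<lambda>t. wron u v m + (F t - F m)) \<longlongrightarrow> wron u v m + (F ?a - F m)) (at_right ?a)"
    by (intro tendsto_intros Fl)
  ultimately have wl': "wl = wron u v m + (F ?a - F m)"
    by (intro tendsto_unique[of "at_right ?a"]) auto
  have "F ?a = 0" by (simp add: F_def)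
  then have "integral {?a..?c} ?h = wr - wl" using wr' wl' by (simp add: F_def)
  then show ?thesis using int by (metis integrable_integral)
qed

text \<open>The jumps of the two derivatives contribute \<open>\<beta> * c * cnj c'\<close> with
  opposite signs; this uses that \<beta> is real.\<close>

lemma wron_delta:
  assumes "delta_condition I y \<beta> u" "delta_condition I y \<beta> v"
  obtains w where "(wron u v \<longlongrightarrow> w) (at_right y)" "(wron u v \<longlongrightarrow> w) (at_left y)"
proof -
  obtain c p m where u: "(u \<longlongrightarrow> c) (at_right y)" "(u \<longlongrightarrow> c) (at_left y)"
     "(D1 u \<longlongrightarrow> p) (at_right y)" "(D1 u \<longlongrightarrow> m) (at_left y)" "p - m = of_real \<beta> * c"
    using assms(1) unfolding delta_condition_def by blast
  obtain c' p' m' where v: "(v \<longlongrightarrow> c') (at_right y)" "(v \<longlongrightarrow> c') (at_left y)"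
     "(D1 v \<longlongrightarrow> p') (at_right y)" "(D1 v \<longlongrightarrow> m') (at_left y)" "p' - m' = of_real \<beta> * c'"
    using assms(2) unfolding delta_condition_def by blast
  have "p = m + of_real \<beta> * c" "p' = m' + of_real \<beta> * c'" using u(5) v(5) by (auto simp: algebra_simps)
  then have "p * cnj c' - c * cnj p' = m * cnj c' - c * cnj m'" by (simp add: algebra_simps)
  moreover have "(wron u v \<longlongrightarrow> p * cnj c' - c * cnj p') (at_right y)" "(wron u v \<longlongrightarrow> m * cnj c' - c * cnj m') (at_left y)"
    unfolding wron_def[abs_def] by (intro tendsto_intros tendsto_cnj u v)+
  ultimately show thesis using that by auto
qed

text \<open>A compact subset of the half-open \<open>I\<close> has a maximum, and some
  \<open>x N\<close> lies beyond it.\<close>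

lemma W22_comp_vanish:
  assumes "f \<in> W22_comp I X" obtains N where "\<And>t. t \<in> I - X \<Longrightarrow> x N < t \<Longrightarrow> f t = 0"
proof -
  let ?S = "{t \<in> I - X. f t \<noteq> 0}"
  have comp: "compact (I \<inter> closure ?S)" using assms by (simp add: W22_comp_def)
  show thesis
  proof (cases "I \<inter> closure ?S = {}")
    case True
    then have "?S = {}" using closure_subset[of ?S] by blast
    then show ?thesis using that by blast
  next
    case False
    then obtain m where m: "m \<in> I \<inter> closure ?S" "\<And>t. t \<in> I \<inter> closure ?S \<Longrightarrow> t \<le> m"
      using compact_attains_sup[OF comp] by blast
    then obtain N where N: "m < x N" by (auto simp: mem_I)
    show ?thesis
    proof (rule that[of N])
      fix t assume t: "t \<in> I - X" "x N < t"
      show "f t = 0"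
      proof (rule ccontr)
        assume "f t \<noteq> 0"
        then have "t \<in> I \<inter> closure ?S" using t closure_subset[of ?S] by blast
        then show False using m(2) N t by fastforce
      qed
    qed
  qed
qed

lemma D1_vanish:
  assumes f: "\<And>t. t \<in> I - X \<Longrightarrow> x N < t \<Longrightarrow> f t = 0" and t: "t \<in> I - X" "x N < t"
  shows "D1 f t = 0"
proof -
  obtain r where r: "r > 0" "\<And>s. s \<in> I \<Longrightarrow> dist s t < r \<Longrightarrow> s \<in> I - X" using near_I[OF t(1)] by blast
  have "(f has_vector_derivative 0) (at t within I)"
  proof (rule has_vector_derivative_transform_within[OF has_vector_derivative_const])
    show "0 < min r (t - x N)" using r t by simp
    fix s assume "s \<in> I" "dist s t < min r (t - x N)"
    then have "s \<in> I - X" "x N < s" using r(2)[of s] by (auto simp: dist_real_def)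
    then show "0 = f s" using f by simp
  qed (use t in auto)
  then show ?thesis using D1_eq t by auto
qed

lemma H_dom_iff:
  "f \<in> H_dom b x \<alpha> \<longleftrightarrow> f \<in> W22_comp I X \<and> D1 f 0 = 0 \<and> (\<forall>n\<ge>1. delta_condition I (x n) (\<alpha> n) f)"
  by (simp add: H_dom_def I_def X_def Let_def)

text \<open>Only \<open>u\<close> has compact support, so that \<open>v\<close> may be a square
  integrable solution. The boundary terms telescope over the pieces: they match at each
  \<open>x n\<close>, vanish at 0, and vanish beyond the support of \<open>u\<close>.\<close>

theorem green_formula:
  assumes u: "u \<in> H_dom b x \<alpha>" and v: "v \<in> W22 I X" "D1 v 0 = 0"
    and dv: "\<And>n. n \<ge> 1 \<Longrightarrow> delta_condition I (x n) (\<alpha> n) v"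
  shows "L2_inner L (\<lambda>t. - D2 u t) v = L2_inner L u (\<lambda>t. - D2 v t)"
proof -
  have uW: "u \<in> W22 I X" and u0: "D1 u 0 = 0" and du: "\<And>n. n \<ge> 1 \<Longrightarrow> delta_condition I (x n) (\<alpha> n) u"
    using u by (auto simp: H_dom_iff W22_comp_def)
  let ?h = "green_density u v"
  obtain N where N: "\<And>t. t \<in> I - X \<Longrightarrow> x N < t \<Longrightarrow> u t = 0"
    using W22_comp_vanish u unfolding H_dom_iff by blast
  have D1N: "D1 u t = 0" if "t \<in> I - X" "x N < t" for t using D1_vanish[of N u] N that by blast
  then have D2N: "D2 u t = 0" if "t \<in> I - X" "x N < t" for t using D1_vanish[of N "D1 u"] that by blast
  have "\<exists>w. n \<ge> 1 \<longrightarrow> (wron u v \<longlongrightarrow> w) (at_right (x n)) \<and> (wron u v \<longlongrightarrow> w) (at_left (x n))" for n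
    using wron_delta[OF du dv] by metis
  then obtain w where w: "\<And>n. n \<ge> 1 \<Longrightarrow> (wron u v \<longlongrightarrow> w n) (at_right (x n))"
    "\<And>n. n \<ge> 1 \<Longrightarrow> (wron u v \<longlongrightarrow> w n) (at_left (x n))" by metis
  \<comment> \<open>The common one-sided limits of the Wronskian; at 0 it vanishes because both
    derivatives do.\<close>
  define W where "W n = (if n = 0 then 0 else w n)" for n
  have Wr: "(wron u v \<longlongrightarrow> W n) (at_right (x n))" for n
  proof (cases "n = 0")
    case True
    have pos: "0 < x 1 / 2" "x 1 / 2 < x 1" using x_less[of 0] x0 by auto
    then have sub: "{0..x 1 / 2} \<subseteq> I - X" using zero_not_X by auto
    have "continuous_on {0..x 1 / 2} (wron u v)"
      by (rule abs_cont_on_continuous[OF wron_abs_cont[OF uW v(1) sub]])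
    then have "(wron u v \<longlongrightarrow> wron u v 0) (at 0 within {0..x 1 / 2})" using pos by (auto simp: continuous_on_def)
    moreover have "wron u v 0 = 0" using u0 v(2) by (simp add: wron_def)
    ultimately show ?thesis using True pos x0 by (simp add: W_def at_within_Icc_at_right)
  qed (use w in \<open>auto simp: W_def\<close>)
  have Wl: "(wron u v \<longlongrightarrow> W (Suc n)) (at_left (x (Suc n)))" for n using w(2)[of "Suc n"] by (simp add: W_def)
  have int: "(?h has_integral W n) {0..x n}" for n
  proof (induction n)
    case 0 show ?case using x0 has_integral_refl(2)[of ?h 0] by (simp add: W_def)
  next
    case (Suc n)
    from has_integral_combine[OF _ _ Suc green_interval[OF uW v(1) Wr Wl]]
    show ?case using x_nonneg[of n] x_less[of n] by simp
  qed
  \<comment> \<open>To the right of \<open>x N\<close> both \<open>u\<close> and \<open>D1 u\<close>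
    are 0.\<close>
  have "W N = 0"
  proof -
    have "((\<lambda>t. 0) \<longlongrightarrow> W N) (at_right (x N))"
      using eventually_right[of N]
      by (intro Lim_transform_eventually[OF Wr]) (auto elim!: eventually_mono simp: wron_def N D1N)
    then show ?thesis using tendsto_unique[OF _ tendsto_const, of "at_right (x N)" 0 "W N"] by simp
  qed
  then have "(?h has_integral 0) {0..x N}" using int[of N] by simp
  then have "((\<lambda>t. if t \<in> {0..x N} then ?h t else 0) has_integral 0) I"
    using has_integral_restrict[OF interval_in_I] by blast
  then have "(?h has_integral 0) I"
    by (rule has_integral_spike[OF X_negligible, rotated]) (auto simp: green_density_def N D2N mem_I)
  then have "integral\<^sup>L L ?h = 0"
    using lebesgue_integral_eq_integral[OF green_density_integrable[OF uW v(1)] I_sets] by (simp add: integral_unique)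
  moreover have "integral\<^sup>L L ?h = L2_inner L (D2 u) v - L2_inner L u (D2 v)"
    unfolding green_density_def L2_inner_def
    by (intro Bochner_Integration.integral_diff L2_inner_integrable W22_D(1,5)[OF uW] W22_D(1,5)[OF v(1)])
  ultimately have "L2_inner L (D2 u) v = L2_inner L u (D2 v)" by simp
  then show ?thesis using L2_inner_scale_left[of L "-1" "D2 u" v] L2_inner_scale_right[of L u "-1" "D2 v"] by simp
qed

section \<open>The operator before taking the closure\<close>

definition H0 :: "real graph" where
  "H0 = {(f, \<lambda>t. - D2 f t) | f. f \<in> H_dom b x \<alpha>}"

lemma H_op_eq: "H_op b x \<alpha> = op_closure L H0"
  by (simp add: H_op_def H0_def I_def Let_def)

lemma H0_symmetric: "graph_symmetric L H0"
proof (rule graph_symmetricI)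
  fix f g f' g' assume "(f, g) \<in> H0" "(f', g') \<in> H0"
  then have f: "f \<in> H_dom b x \<alpha>" "g = (\<lambda>t. - D2 f t)" and f': "f' \<in> H_dom b x \<alpha>" "g' = (\<lambda>t. - D2 f' t)"
    by (auto simp: H0_def)
  show "L2_inner L g f' = L2_inner L f g'"
    unfolding f(2) f'(2) using f'(1) by (intro green_formula[OF f(1)]) (auto simp: H_dom_iff W22_comp_def)
qed

lemma H0_L2: "H0 \<subseteq> L2 L \<times> L2 L"
  using W22_D(1,5) by (auto simp: H0_def H_dom_iff W22_comp_def intro!: L2_minus)

lemma W22_compI:
  assumes f: "f \<in> W22 I X" and van: "\<And>t. t \<in> I - X \<Longrightarrow> x N < t \<Longrightarrow> f t = 0"
  shows "f \<in> W22_comp I X"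
proof -
  let ?S = "{t \<in> I - X. f t \<noteq> 0}"
  have "?S \<subseteq> {0..x N}" using van by (force simp: mem_I)
  then have sub: "closure ?S \<subseteq> {0..x N}" by (intro closure_minimal) auto
  then have "I \<inter> closure ?S = closure ?S" using interval_in_I[of N] by blast
  moreover have "compact (closure ?S)"
    using sub bounded_subset[OF bounded_closed_interval sub] by (simp add: compact_eq_bounded_closed)
  ultimately show ?thesis using f by (simp add: W22_comp_def)
qed

lemma delta_linear:
  assumes f: "f \<in> W22 I X" "delta_condition I (x n) \<beta> f" and g: "g \<in> W22 I X" "delta_condition I (x n) \<beta> g"
    and n: "n \<ge> 1"
  shows "delta_condition I (x n) \<beta> (\<lambda>t. k * f t + g t)"
proof -
  obtain c p m where u: "(f \<longlongrightarrow> c) (at_right (x n))" "(f \<longlongrightarrow> c) (at_left (x n))"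
     "(D1 f \<longlongrightarrow> p) (at_right (x n))" "(D1 f \<longlongrightarrow> m) (at_left (x n))" "p - m = of_real \<beta> * c"
    using f(2) unfolding delta_condition_def by blast
  obtain c' p' m' where v: "(g \<longlongrightarrow> c') (at_right (x n))" "(g \<longlongrightarrow> c') (at_left (x n))"
     "(D1 g \<longlongrightarrow> p') (at_right (x n))" "(D1 g \<longlongrightarrow> m') (at_left (x n))" "p' - m' = of_real \<beta> * c'"
    using g(2) unfolding delta_condition_def by blast
  obtain l where l: "n = Suc l" using n by (cases n) auto
  let ?h = "\<lambda>t. k * f t + g t"
  have "(?h \<longlongrightarrow> k * c + c') (at_right (x n))" "(?h \<longlongrightarrow> k * c + c') (at_left (x n))"
    by (intro tendsto_intros u v)+
  moreover have "(D1 ?h \<longlongrightarrow> k * p + p') (at_right (x n))"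
    by (rule tendsto_right_piece[OF tendsto_add[OF tendsto_mult_left[OF u(3), of k] v(3)]]) (simp add: W22_linear(2)[OF f(1) g(1)])
  moreover have "(D1 ?h \<longlongrightarrow> k * m + m') (at_left (x n))"
    using u(4) v(4) unfolding l
    by (intro tendsto_left_piece[OF tendsto_add[OF tendsto_mult_left]]) (simp_all add: W22_linear(2)[OF f(1) g(1)])
  moreover have "(k * p + p') - (k * m + m') = of_real \<beta> * (k * c + c')"
  proof -
    have "(k * p + p') - (k * m + m') = k * (p - m) + (p' - m')" by (simp add: algebra_simps)
    then show ?thesis unfolding u(5) v(5) by (simp add: algebra_simps)
  qed
  ultimately show ?thesis unfolding delta_condition_def by blast
qed

lemma H_dom_linear:
  assumes f: "f \<in> H_dom b x \<alpha>" and g: "g \<in> H_dom b x \<alpha>"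
  shows "(\<lambda>t. c * f t + g t) \<in> H_dom b x \<alpha>"
proof -
  have F: "f \<in> W22 I X" "f \<in> W22_comp I X" "D1 f 0 = 0" "\<And>n. n \<ge> 1 \<Longrightarrow> delta_condition I (x n) (\<alpha> n) f"
    and G: "g \<in> W22 I X" "g \<in> W22_comp I X" "D1 g 0 = 0" "\<And>n. n \<ge> 1 \<Longrightarrow> delta_condition I (x n) (\<alpha> n) g"
    using f g by (auto simp: H_dom_iff W22_comp_def)
  obtain N where N: "\<And>t. t \<in> I - X \<Longrightarrow> x N < t \<Longrightarrow> f t = 0" using W22_comp_vanish[OF F(2)] by blast
  obtain N' where N': "\<And>t. t \<in> I - X \<Longrightarrow> x N' < t \<Longrightarrow> g t = 0" using W22_comp_vanish[OF G(2)] by blast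
  have "(\<lambda>t. c * f t + g t) \<in> W22_comp I X"
  proof (rule W22_compI[OF W22_linear(1)[OF F(1) G(1)], of "max N N'"])
    fix t assume t: "t \<in> I - X" "x (max N N') < t"
    have "x N \<le> x (max N N')" "x N' \<le> x (max N N')" by (auto intro: x_mono)
    then show "c * f t + g t = 0" using N N' t by force
  qed
  moreover have "D1 (\<lambda>t. c * f t + g t) 0 = 0"
    using W22_linear(2)[OF F(1) G(1), of 0] zero_not_X[of 0] x_less[of 0] x0 F(3) G(3) by simp
  ultimately show ?thesis unfolding H_dom_iff using F(4) G(4) delta_linear[OF F(1) _ G(1)] by blast
qed

lemma H_dom_zero: "(\<lambda>t. 0) \<in> H_dom b x \<alpha>"
proof -
  have ac: "AC_loc (I - X) (\<lambda>t. 0)" by (simp add: AC_loc_def abs_cont_on_const)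
  note W = W22_I[of "\<lambda>t. 0" "\<lambda>t. 0" "{}" "\<lambda>t. 0", OF L2_zero ac _ ac _ _ L2_zero]
  have "(\<lambda>t. 0) \<in> W22 I X" by (rule W(1)) auto
  then have "(\<lambda>t. 0) \<in> W22_comp I X" by (rule W22_compI[of _ 0]) simp
  moreover have z: "D1 (\<lambda>t. 0) t = 0" if "t \<in> I" for t by (rule D1_eq[OF _ that]) auto
  have "delta_condition I (x n) (\<alpha> n) (\<lambda>t. 0)" if n1: "n \<ge> 1" for n
  proof -
    obtain l where l: "n = Suc l" using n1 by (cases n) auto
    have "(D1 (\<lambda>t. 0) \<longlongrightarrow> 0) (at_right (x n))"
      by (rule tendsto_right_piece[OF tendsto_const]) (simp add: z)
    moreover have "(D1 (\<lambda>t. 0) \<longlongrightarrow> 0) (at_left (x n))"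
      unfolding l by (rule tendsto_left_piece[OF tendsto_const]) (simp add: z)
    ultimately show ?thesis unfolding delta_condition_def by (intro exI[of _ 0]) auto
  qed
  ultimately show ?thesis unfolding H_dom_iff using z[of 0] zero_not_X[of 0] x_less[of 0] x0 by auto
qed

text \<open>The second derivative of a combination is the combination of the second derivatives only
  where both exist, so linearity of this graph holds almost everywhere.\<close>

lemma H0_subspace: "graph_subspace L H0"
proof (rule graph_subspaceI[OF _ H0_L2])
  show "H0 \<noteq> {}" using H_dom_zero by (auto simp: H0_def)
  fix f g f' g' c assume "(f, g) \<in> H0" "(f', g') \<in> H0"
  then have f: "f \<in> H_dom b x \<alpha>" "g = (\<lambda>t. - D2 f t)" and f': "f' \<in> H_dom b x \<alpha>" "g' = (\<lambda>t. - D2 f' t)"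
    by (auto simp: H0_def)
  let ?p = "\<lambda>t. c * f t + f' t"
  have "AE t in L. D2 ?p t = c * D2 f t + D2 f' t"
    using f f' by (intro W22_linear) (auto simp: H_dom_iff W22_comp_def)
  then have "AE t in L. - D2 ?p t = c * g t + g' t" unfolding f(2) f'(2) by eventually_elim simp
  moreover have "(?p, \<lambda>t. - D2 ?p t) \<in> H0" using H_dom_linear[OF f(1) f'(1)] by (auto simp: H0_def)
  ultimately show "\<exists>(p, q)\<in>H0. (AE t in L. p t = c * f t + f' t) \<and> (AE t in L. q t = c * g t + g' t)"
    by (intro bexI[of _ "(?p, \<lambda>t. - D2 ?p t)"]) auto
qed

end


section \<open>Piecewise smooth functions and solutions\<close>

lemma continuous_on_L2_interval:
  fixes f :: "real \<Rightarrow> complex"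
  assumes "continuous_on {a..c} f" shows "f \<in> L2 (lebesgue_on {a..c})"
proof -
  have "integrable (lebesgue_on {a..c}) f" "integrable (lebesgue_on {a..c}) (\<lambda>t. (cmod (f t))\<^sup>2)"
    using assms by (auto intro!: continuous_imp_integrable_real continuous_intros)
  then show ?thesis by (simp add: L2_def)
qed

lemma Lipschitz_of_vector_derivative:
  fixes f :: "real \<Rightarrow> complex"
  assumes d: "\<And>t. t \<in> {a..c} \<Longrightarrow> (f has_vector_derivative f' t) (at t within {a..c})"
    and B: "\<And>t. t \<in> {a..c} \<Longrightarrow> cmod (f' t) \<le> B" and st: "s \<in> {a..c}" "t \<in> {a..c}"
  shows "cmod (f s - f t) \<le> B * \<bar>s - t\<bar>"
proof -
  have "norm (f s - f t) \<le> B * norm (s - t)"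
  proof (rule differentiable_bound[of "{a..c}" f "\<lambda>t h. h *\<^sub>R f' t"])
    fix r assume r: "r \<in> {a..c}"
    show "(f has_derivative (\<lambda>h. h *\<^sub>R f' r)) (at r within {a..c})"
      using d[OF r] by (simp add: has_vector_derivative_def)
    show "onorm (\<lambda>h. h *\<^sub>R f' r) \<le> B"
    proof (rule onorm_bound)
      show "0 \<le> B" using B[OF r] norm_ge_zero order_trans by blast
      show "norm (h *\<^sub>R f' r) \<le> B * norm h" for h :: real
        using mult_left_mono[OF B[OF r], of "\<bar>h\<bar>"] by (simp add: mult.commute)
    qed
  qed (use st in auto)
  then show ?thesis by simp
qed

text \<open>Cosine and sine type solutions of \<open>- y'' = z * y\<close>, written with cosh, sinh
  and a square root \<open>w\<close> of \<open>- z\<close>; dividing by \<open>w\<close> separates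
  the case \<open>z = 0\<close>.\<close>

lemma complex_solution_exists:
  fixes z :: complex
  obtains C S :: "real \<Rightarrow> complex" where "C 0 = 1" "S 0 = 0"
    "\<And>t. (C has_vector_derivative - z * S t) (at t)" "\<And>t. (S has_vector_derivative C t) (at t)"
proof (cases "z = 0")
  case True
  have "((\<lambda>t. complex_of_real t) has_vector_derivative 1) (at t)" for t :: real
    using has_vector_derivative_of_real[OF DERIV_ident[THEN DERIV_subset, of _ UNIV]]
    by (auto intro!: derivative_eq_intros simp: has_vector_derivative_def scaleR_conv_of_real)
  then show ?thesis using that[of "\<lambda>t. 1" "\<lambda>t. complex_of_real t"] True by auto
next
  case False
  define w where "w = csqrt (- z)"
  have w2: "w * w = - z" unfolding w_def power2_eq_square[symmetric] by (rule power2_csqrt)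
  have w: "w \<noteq> 0" using False w2 by auto
  show ?thesis
  proof (rule that[of "\<lambda>t. cosh (w * of_real t)" "\<lambda>t. sinh (w * of_real t) / w"])
    fix t :: real
    have "((\<lambda>s. cosh (w * s)) has_field_derivative sinh (w * of_real t) * w) (at (of_real t))"
      by (auto intro!: derivative_eq_intros)
    from has_vector_derivative_real_field[OF this]
    show "((\<lambda>t. cosh (w * of_real t)) has_vector_derivative - z * (sinh (w * of_real t) / w)) (at t)"
      unfolding w2[symmetric] using w by (simp add: mult.commute)
    have "((\<lambda>s. sinh (w * s) / w) has_field_derivative cosh (w * of_real t)) (at (of_real t))"
      using w by (auto intro!: derivative_eq_intros)
    from has_vector_derivative_real_field[OF this]
    show "((\<lambda>t. sinh (w * of_real t) / w) has_vector_derivative cosh (w * of_real t)) (at t)" .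
  qed auto
qed

context point_interactions
begin

abbreviation piece :: "nat \<Rightarrow> real set" where
  "piece n \<equiv> {x n..x (Suc n)}"

text \<open>A family \<open>y\<close> gives the values on the pieces; at the points of \<open>X\<close> the value from the right is taken.\<close>

definition glue :: "(nat \<Rightarrow> real \<Rightarrow> complex) \<Rightarrow> real \<Rightarrow> complex" where
  "glue y t = y (LEAST n. t < x (Suc n)) t"

lemma glue_eq: assumes "x n \<le> t" "t < x (Suc n)" shows "glue y t = y n t"
proof -
  have "(LEAST n. t < x (Suc n)) = n"
  proof (rule Least_equality[where P="\<lambda>n. t < x (Suc n)"])
    fix m assume "t < x (Suc m)"
    then show "n \<le> m" using assms(1) x_mono[of "Suc m" n] by (cases "n \<le> m") auto
  qed (rule assms)
  then show ?thesis by (simp add: glue_def)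
qed

text \<open>Closed pieces are used, so a family keeps the limits from both sides at each point of
  \<open>X\<close>, which the glued function does not.\<close>

definition piecewise_cont :: "(nat \<Rightarrow> real \<Rightarrow> complex) \<Rightarrow> bool" where
  "piecewise_cont y \<longleftrightarrow> (\<forall>n. continuous_on (piece n) (y n))"

definition piecewise_deriv :: "(nat \<Rightarrow> real \<Rightarrow> complex) \<Rightarrow> (nat \<Rightarrow> real \<Rightarrow> complex) \<Rightarrow> bool" where
  "piecewise_deriv y y' \<longleftrightarrow>
     (\<forall>n. \<forall>t\<in>piece n. (y n has_vector_derivative y' n t) (at t within piece n))"

lemma piecewise_deriv_cont: "piecewise_deriv y y' \<Longrightarrow> piecewise_cont y"
  unfolding piecewise_deriv_def piecewise_cont_def
  by (auto intro!: has_vector_derivative_continuous simp: continuous_on_eq_continuous_within)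

lemma glue_measurable:
  assumes "piecewise_cont y" shows "glue y \<in> borel_measurable L"
proof (rule measurable_piecewise_restrict2[where A="\<lambda>n. {x n..<x (Suc n)}"])
  have in_I: "{x n..<x (Suc n)} \<subseteq> I" for n using piece_in_I[of n] by auto
  show "space L = (\<Union>n. {x n..<x (Suc n)})"
    using in_I piece_ex by (auto simp: space_restrict_space) blast
  fix n
  have "{x n..<x (Suc n)} \<in> sets lebesgue" by simp
  then show "{x n..<x (Suc n)} \<in> sets L"
    using in_I[of n] I_sets by (auto simp: sets_restrict_space_iff)
  have "(\<lambda>t. indicator (piece n) t *\<^sub>R y n t) \<in> borel_measurable borel"
    using assms by (intro borel_measurable_continuous_on_indicator) (auto simp: piecewise_cont_def)
  then have "(\<lambda>t. indicator (piece n) t *\<^sub>R y n t) \<in> borel_measurable L"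
    by (intro measurable_restrict_space1 measurable_completion) simp
  moreover have "\<forall>t\<in>{x n..<x (Suc n)}. glue y t = indicator (piece n) t *\<^sub>R y n t"
    by (simp add: glue_eq)
  ultimately show "\<exists>h\<in>borel_measurable L. \<forall>t\<in>{x n..<x (Suc n)}. glue y t = h t"
    by (intro bexI[of _ "\<lambda>t. indicator (piece n) t *\<^sub>R y n t"])
qed

lemma interval_in_piece:
  assumes "{a..c} \<subseteq> I - X" "a \<le> c" obtains n where "{a..c} \<subseteq> {x n..<x (Suc n)}"
proof -
  have "a \<in> I" using assms by auto
  then obtain n where n: "x n \<le> a" "a < x (Suc n)" by (rule piece_ex)
  have "c < x (Suc n)"
  proof (rule ccontr)
    assume "\<not> c < x (Suc n)"
    then have "x (Suc n) \<in> {a..c}" using n by auto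
    moreover have "x (Suc n) \<in> X" by (auto simp: X_iff)
    ultimately show False using assms(1) by auto
  qed
  then have "{a..c} \<subseteq> {x n..<x (Suc n)}" using n by auto
  then show thesis by (rule that)
qed

text \<open>A compact interval avoiding \<open>X\<close> lies in one piece, where the bounded
  derivative makes the function Lipschitz.\<close>

lemma glue_AC:
  assumes y: "piecewise_deriv y y'" and y': "piecewise_cont y'"
  shows "AC_loc (I - X) (glue y)"
  unfolding AC_loc_def
proof (intro allI impI)
  fix a c assume ac: "{a..c} \<subseteq> I - X"
  show "abs_cont_on {a..c} (glue y)"
  proof (cases "a \<le> c")
    case True
    obtain n where n: "{a..c} \<subseteq> {x n..<x (Suc n)}" using interval_in_piece[OF ac True] .
    have "bounded (y' n ` piece n)"
      using y' by (intro compact_imp_bounded compact_continuous_image) (auto simp: piecewise_cont_def)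
    then obtain B where "\<forall>y\<in>y' n ` piece n. cmod y \<le> B" unfolding bounded_iff by blast
    then have B: "\<And>t. t \<in> piece n \<Longrightarrow> cmod (y' n t) \<le> max B 0" by (simp add: le_max_iff_disj)
    show ?thesis
    proof (rule abs_cont_on_Lipschitz[of "max B 0"])
      fix s t assume "s \<in> {a..c}" "t \<in> {a..c}"
      then have st: "s \<in> {x n..<x (Suc n)}" "t \<in> {x n..<x (Suc n)}" using n by blast+
      then have "cmod (y n s - y n t) \<le> max B 0 * \<bar>s - t\<bar>"
        using y B by (intro Lipschitz_of_vector_derivative[of "x n" "x (Suc n)" _ "y' n"]) (auto simp: piecewise_deriv_def)
      then show "cmod (glue y s - glue y t) \<le> max B 0 * \<bar>s - t\<bar>" using st by (simp add: glue_eq[of n])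
    qed simp
  next
    case False
    then show ?thesis by (intro abs_cont_on_Lipschitz[of 0]) auto
  qed
qed

lemma glue_deriv:
  assumes y: "piecewise_deriv y y'" and t: "t \<in> I - X"
  shows "(glue y has_vector_derivative glue y' t) (at t within I)"
proof -
  obtain n where n: "x n < t \<or> n = 0 \<and> t = 0" "t < x (Suc n)" using I_minus_X[OF t] by blast
  have tn: "x n \<le> t" using n x0 by auto
  \<comment> \<open>For \<open>n = 0\<close> the neighbourhood extends below 0, so that it is open
    and still contains 0, where the derivative is one-sided.\<close>
  define U where "U = {(if n = 0 then -1 else x n)<..<x (Suc n)}"
  have U: "t \<in> U" "open U" "U \<inter> I \<subseteq> {x n..<x (Suc n)}" "U \<inter> piece n \<subseteq> I"
    using n tn x0 x_nonneg[of n] piece_in_I[of n] by (auto simp: U_def mem_I split: if_splits)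
  have "at t within I = at t within piece n"
    using U piece_in_I[of n] by (intro at_within_nhd[of t U]) auto
  moreover have "(y n has_vector_derivative y' n t) (at t within piece n)"
    using y n tn by (auto simp: piecewise_deriv_def)
  ultimately have d: "(y n has_vector_derivative glue y' t) (at t within I)" using tn n(2) by (simp add: glue_eq)
  obtain e where e: "e > 0" "ball t e \<subseteq> U" using U openE by blast
  show ?thesis
  proof (rule has_vector_derivative_transform_within[OF d e(1)])
    fix s assume "s \<in> I" "dist s t < e"
    then have "s \<in> ball t e" by (simp add: dist_commute)
    then have "s \<in> {x n..<x (Suc n)}" using e(2) U(3) \<open>s \<in> I\<close> by blast
    then show "y n s = glue y s" by (simp add: glue_eq[of n])
  qed (use t in auto)
qed

lemma glue_W22:
  assumes y: "piecewise_deriv y y'" "piecewise_deriv y' y''" "piecewise_cont y''"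
    and L2: "glue y \<in> L2 L" "glue y'' \<in> L2 L"
  shows "glue y \<in> W22 I X" "\<And>t. t \<in> I - X \<Longrightarrow> D1 (glue y) t = glue y' t" "AE t in L. D2 (glue y) t = glue y'' t"
  using W22_I[of "glue y" "glue y'" "{}" "glue y''", OF L2(1) glue_AC[OF y(1) piecewise_deriv_cont[OF y(2)]]
      glue_deriv[OF y(1)] glue_AC[OF y(2,3)] negligible_empty glue_deriv[OF y(2)] L2(2)]
  by auto

text \<open>The interface conditions as an update rule from the right end of one piece to the left
  end of the next.\<close>

definition matched :: "(nat \<Rightarrow> real \<Rightarrow> complex) \<Rightarrow> (nat \<Rightarrow> real \<Rightarrow> complex) \<Rightarrow> bool" where
  "matched y y' \<longleftrightarrow> (\<forall>n. y (Suc n) (x (Suc n)) = y n (x (Suc n)) \<and>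
     y' (Suc n) (x (Suc n)) = y' n (x (Suc n)) + of_real (\<alpha> (Suc n)) * y n (x (Suc n)))"

lemma piece_tendsto:
  assumes "piecewise_cont y"
  shows "(y n \<longlongrightarrow> y n (x n)) (at_right (x n))" "(y n \<longlongrightarrow> y n (x (Suc n))) (at_left (x (Suc n)))"
proof -
  have "continuous_on (piece n) (y n)" using assms by (simp add: piecewise_cont_def)
  then have "(y n \<longlongrightarrow> y n (x n)) (at (x n) within piece n)" "(y n \<longlongrightarrow> y n (x (Suc n))) (at (x (Suc n)) within piece n)"
    using x_less[of n] by (auto simp: continuous_on_def)
  then show "(y n \<longlongrightarrow> y n (x n)) (at_right (x n))" "(y n \<longlongrightarrow> y n (x (Suc n))) (at_left (x (Suc n)))"
    using x_less[of n] by (auto simp: at_within_Icc_at_left at_within_Icc_at_right)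
qed

lemma glue_delta:
  assumes y: "piecewise_deriv y y'" "piecewise_cont y'" and m: "matched y y'"
    and D: "\<And>t. t \<in> I - X \<Longrightarrow> D1 (glue y) t = glue y' t" and n: "n \<ge> 1"
  shows "delta_condition I (x n) (\<alpha> n) (glue y)"
proof -
  obtain l where l: "n = Suc l" using n by (cases n) auto
  note c = piecewise_deriv_cont[OF y(1)]
  have 1: "(glue y \<longlongrightarrow> y n (x n)) (at_right (x n))"
    by (rule tendsto_right_piece[OF piece_tendsto(1)[OF c]]) (simp add: glue_eq)
  have 2: "(glue y \<longlongrightarrow> y l (x (Suc l))) (at_left (x (Suc l)))"
    by (rule tendsto_left_piece[OF piece_tendsto(2)[OF c]]) (simp add: glue_eq)
  have 3: "(D1 (glue y) \<longlongrightarrow> y' n (x n)) (at_right (x n))"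
    by (rule tendsto_right_piece[OF piece_tendsto(1)[OF y(2)]]) (simp add: D glue_eq)
  have 4: "(D1 (glue y) \<longlongrightarrow> y' l (x (Suc l))) (at_left (x (Suc l)))"
    by (rule tendsto_left_piece[OF piece_tendsto(2)[OF y(2)]]) (simp add: D glue_eq)
  have "y n (x n) = y l (x n)" "y' n (x n) = y' l (x n) + of_real (\<alpha> n) * y l (x n)"
    using m unfolding matched_def l by auto
  then show ?thesis
    unfolding delta_condition_def using 1 2 3 4 l
    by (intro exI[of _ "y n (x n)"] exI[of _ "y' n (x n)"] exI[of _ "y' l (x n)"]) simp
qed

text \<open>Solutions of \<open>-y'' = z y\<close> with the interface conditions at the points of \<open>X\<close>.\<close>

definition solution :: "complex \<Rightarrow> (nat \<Rightarrow> real \<Rightarrow> complex) \<Rightarrow> (nat \<Rightarrow> real \<Rightarrow> complex) \<Rightarrow> bool" where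
  "solution z y y' \<longleftrightarrow> piecewise_deriv y y' \<and> piecewise_deriv y' (\<lambda>n t. - z * y n t) \<and> matched y y'"

lemma solution_exists:
  obtains y y' where "solution z y y'" "y 0 0 = a" "y' 0 0 = p"
proof -
  obtain C S where CS: "C 0 = 1" "S 0 = 0" "\<And>t. (C has_vector_derivative - z * S t) (at t)"
    "\<And>t. (S has_vector_derivative C t) (at t)"
    by (rule complex_solution_exists[of z]) blast
  \<comment> \<open>The pair holds value and slope at the left end of a piece; it is carried to the
    right end by \<open>C\<close> and \<open>S\<close>, and then the slope jumps.\<close>
  define step where "step n c = (let d = x (Suc n) - x n; a' = fst c * C d + snd c * S d in
    (a', - z * fst c * S d + snd c * C d + of_real (\<alpha> (Suc n)) * a'))" for n and c :: "complex \<times> complex"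
  define c where "c = rec_nat (a, p) step"
  have c0: "c 0 = (a, p)" and cS: "c (Suc n) = step n (c n)" for n by (simp_all add: c_def)
  define y where "y n t = fst (c n) * C (t - x n) + snd (c n) * S (t - x n)" for n t
  define y' where "y' n t = - z * fst (c n) * S (t - x n) + snd (c n) * C (t - x n)" for n t
  have sh: "((\<lambda>t. f (t - r)) has_vector_derivative f' (t - r)) (at t within A)"
    if "\<And>t. (f has_vector_derivative f' t) (at t)" for f f' :: "real \<Rightarrow> complex" and r t A
  proof -
    have "((\<lambda>t. t - r) has_vector_derivative 1) (at t)" by (auto intro!: derivative_eq_intros)
    from vector_diff_chain_at[OF this that[of "t - r"]]
    have "((\<lambda>t. f (t - r)) has_vector_derivative f' (t - r)) (at t)" by (simp add: o_def)
    then show ?thesis by (rule has_vector_derivative_at_within)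
  qed
  have "piecewise_deriv y y'"
    unfolding piecewise_deriv_def y_def[abs_def] y'_def[abs_def]
  proof (intro allI ballI)
    fix n t
    show "((\<lambda>t. fst (c n) * C (t - x n) + snd (c n) * S (t - x n)) has_vector_derivative
       - z * fst (c n) * S (t - x n) + snd (c n) * C (t - x n)) (at t within piece n)"
      by (rule has_vector_derivative_eq_rhs[OF has_vector_derivative_add[OF
        has_vector_derivative_mult_right[OF sh[OF CS(3)]] has_vector_derivative_mult_right[OF sh[OF CS(4)]]]])
        (simp add: algebra_simps)
  qed
  moreover have "piecewise_deriv y' (\<lambda>n t. - z * y n t)"
    unfolding piecewise_deriv_def y_def[abs_def] y'_def[abs_def]
  proof (intro allI ballI)
    fix n t
    show "((\<lambda>t. - z * fst (c n) * S (t - x n) + snd (c n) * C (t - x n)) has_vector_derivative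
       - z * (fst (c n) * C (t - x n) + snd (c n) * S (t - x n))) (at t within piece n)"
      by (rule has_vector_derivative_eq_rhs[OF has_vector_derivative_add[OF
        has_vector_derivative_mult_right[OF sh[OF CS(4)]] has_vector_derivative_mult_right[OF sh[OF CS(3)]]]])
        (simp add: algebra_simps)
  qed
  moreover have "matched y y'"
    unfolding matched_def y_def y'_def cS step_def Let_def using CS(1,2) by simp
  moreover have "y 0 0 = a" "y' 0 0 = p" using CS(1,2) x0 by (simp_all add: y_def y'_def c0)
  ultimately show thesis using that unfolding solution_def by blast
qed

lemma solution_cnj:
  assumes "solution z y y'" shows "solution (cnj z) (\<lambda>n t. cnj (y n t)) (\<lambda>n t. cnj (y' n t))"
proof -
  have d: "piecewise_deriv (\<lambda>n t. cnj (f n t)) (\<lambda>n t. cnj (f' n t))" if "piecewise_deriv f f'" for f f'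
    using that by (auto simp: piecewise_deriv_def intro!: has_vector_derivative_cnj)
  have "piecewise_deriv (\<lambda>n t. cnj (y' n t)) (\<lambda>n t. - cnj z * cnj (y n t))"
    using d[of y' "\<lambda>n t. - z * y n t"] assms by (simp add: solution_def)
  then show ?thesis using assms d[of y y'] by (auto simp: solution_def matched_def)
qed

lemma solution_scale:
  assumes "solution z y y'" shows "solution z (\<lambda>n t. c * y n t) (\<lambda>n t. c * y' n t)"
proof -
  have d: "piecewise_deriv (\<lambda>n t. c * f n t) (\<lambda>n t. c * f' n t)" if "piecewise_deriv f f'" for f f'
    using that by (auto simp: piecewise_deriv_def intro!: has_vector_derivative_mult_right)
  have "piecewise_deriv (\<lambda>n t. c * y' n t) (\<lambda>n t. - z * (c * y n t))"
    using d[of y' "\<lambda>n t. - z * y n t"] assms by (simp add: solution_def mult.left_commute)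
  then show ?thesis using assms d[of y y'] by (auto simp: solution_def matched_def algebra_simps)
qed

lemma solution_W22:
  assumes s: "solution z y y'" and L2: "glue y \<in> L2 L"
  shows "glue y \<in> W22 I X" "\<And>t. t \<in> I - X \<Longrightarrow> D1 (glue y) t = glue y' t"
    "AE t in L. D2 (glue y) t = - z * glue y t" "\<And>n. n \<ge> 1 \<Longrightarrow> delta_condition I (x n) (\<alpha> n) (glue y)"
proof -
  have y: "piecewise_deriv y y'" "piecewise_deriv y' (\<lambda>n t. - z * y n t)" "matched y y'"
    using s by (auto simp: solution_def)
  have eq: "glue (\<lambda>n t. - z * y n t) = (\<lambda>t. - z * glue y t)" by (simp add: glue_def[abs_def])
  have c: "piecewise_cont (\<lambda>n t. - z * y n t)"
    using piecewise_deriv_cont[OF y(1)] by (auto simp: piecewise_cont_def intro!: continuous_intros)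
  note W = glue_W22[OF y(1,2) c L2]
  have L2': "glue (\<lambda>n t. - z * y n t) \<in> L2 L" unfolding eq by (rule L2_scale[OF L2])
  show "glue y \<in> W22 I X" "AE t in L. D2 (glue y) t = - z * glue y t" using W(1)[OF L2'] W(3)[OF L2', unfolded eq] by blast+
  show D: "\<And>t. t \<in> I - X \<Longrightarrow> D1 (glue y) t = glue y' t" using W(2)[OF L2'] by blast
  show "delta_condition I (x n) (\<alpha> n) (glue y)" if "n \<ge> 1" for n
    using glue_delta[OF y(1) piecewise_deriv_cont[OF y(2)] y(3) D that] .
qed

text \<open>Bilinear and of opposite sign, unlike \<open>wron\<close>: conjugate solutions are
  passed explicitly, since Wronskians at unrelated energies are needed.\<close>

definition W :: "(nat \<Rightarrow> real \<Rightarrow> complex) \<Rightarrow> (nat \<Rightarrow> real \<Rightarrow> complex) \<Rightarrow>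
    (nat \<Rightarrow> real \<Rightarrow> complex) \<Rightarrow> (nat \<Rightarrow> real \<Rightarrow> complex) \<Rightarrow> nat \<Rightarrow> real \<Rightarrow> complex" where
  "W y y' p p' n t = y n t * p' n t - y' n t * p n t"

lemma W_deriv:
  assumes y: "solution z y y'" and p: "solution \<zeta> p p'"
  shows "piecewise_deriv (W y y' p p') (\<lambda>n t. (z - \<zeta>) * (y n t * p n t))"
  unfolding piecewise_deriv_def
proof (intro allI ballI)
  fix n t assume t: "t \<in> piece n"
  have d: "(y n has_vector_derivative y' n t) (at t within piece n)" "(y' n has_vector_derivative - z * y n t) (at t within piece n)"
    "(p n has_vector_derivative p' n t) (at t within piece n)" "(p' n has_vector_derivative - \<zeta> * p n t) (at t within piece n)"
    using y p t by (auto simp: solution_def piecewise_deriv_def)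
  show "(W y y' p p' n has_vector_derivative (z - \<zeta>) * (y n t * p n t)) (at t within piece n)"
    unfolding W_def[abs_def]
    by (rule has_vector_derivative_eq_rhs[OF has_vector_derivative_diff[OF
      has_vector_derivative_mult[OF d(1,4)] has_vector_derivative_mult[OF d(2,3)]]]) (simp add: algebra_simps)
qed

text \<open>The jumps of both slopes have the same coefficient and cancel.\<close>

lemma W_match:
  assumes "solution z y y'" "solution \<zeta> p p'"
  shows "W y y' p p' (Suc n) (x (Suc n)) = W y y' p p' n (x (Suc n))"
  using assms unfolding solution_def matched_def W_def by (simp add: algebra_simps)

lemma W_diff:
  assumes y: "solution z y y'" and p: "solution \<zeta> p p'" and t: "t \<in> piece n"
  shows "((\<lambda>t. (z - \<zeta>) * (y n t * p n t)) has_integral (W y y' p p' n t - W y y' p p' n (x n))) {x n..t}"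
proof (rule fundamental_theorem_of_calculus)
  fix s assume "s \<in> {x n..t}"
  then have "s \<in> piece n" using t by auto
  then have "(W y y' p p' n has_vector_derivative (z - \<zeta>) * (y n s * p n s)) (at s within piece n)"
    using W_deriv[OF y p] by (auto simp: piecewise_deriv_def)
  then show "(W y y' p p' n has_vector_derivative (z - \<zeta>) * (y n s * p n s)) (at s within {x n..t})"
    by (rule has_vector_derivative_within_subset) (use t in auto)
qed (use t in auto)

lemma W_const:
  assumes y: "solution z y y'" and p: "solution z p p'" and t: "t \<in> piece n"
  shows "W y y' p p' n t = W y y' p p' 0 0"
proof -
  have eq: "W y y' p p' n t = W y y' p p' n (x n)" if "t \<in> piece n" for n t
    using has_integral_unique[OF W_diff[OF y p that], of 0] by simp
  have "W y y' p p' n (x n) = W y y' p p' 0 0" for n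
  proof (induction n)
    case (Suc n)
    then show ?case using W_match[OF y p, of n] eq[of "x (Suc n)" n] x_less[of n] by simp
  qed (simp add: x0)
  then show ?thesis using eq[OF t] by simp
qed

end


section \<open>The eigenspaces of the adjoint\<close>

text \<open>Lebesgue differentiation: off a null set the averages over \<open>{t..t + h}\<close>
  converge to the value at \<open>t\<close>, and all of them are 0.\<close>

lemma AE_zero_if_integrals_zero:
  fixes g :: "real \<Rightarrow> complex"
  assumes g: "integrable (lebesgue_on {0..c}) g" and zero: "\<And>r. r \<in> {0..c} \<Longrightarrow> integral {0..r} g = 0"
  shows "AE t in lebesgue_on {0..c}. g t = 0"
proof -
  have int: "g integrable_on {0..c}" by (rule integrable_on_lebesgue_on[OF g]) simp
  define G where "G t = (if t \<in> {0..c} then g t else 0)" for t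
  have "G integrable_on UNIV"
    unfolding G_def[abs_def] using int by (simp only: Henstock_Kurzweil_Integration.integrable_restrict_UNIV)
  then have "G integrable_on cbox a d" for a d by (rule integrable_on_subcbox) simp
  then obtain N where N: "negligible N" "\<And>t e. t \<notin> N \<Longrightarrow> 0 < e \<Longrightarrow>
      \<exists>d>0. \<forall>h. 0 < h \<and> h < d \<longrightarrow> norm (integral (cbox t (t + h *\<^sub>R One)) G /\<^sub>R h ^ DIM(real) - G t) < e"
    by (rule integrable_ccontinuous_explicit[of G]) auto
  \<comment> \<open>The right end \<open>c\<close> is excluded to leave room for
    \<open>{t..t + h}\<close>.\<close>
  have G0: "g t = 0" if t: "t \<in> {0..c} - (N \<union> {c})" for t
  proof (rule ccontr)
    assume "g t \<noteq> 0"
    then have e: "cmod (G t) > 0" using t by (simp add: G_def)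
    obtain d where d: "d > 0" "\<And>h. 0 < h \<and> h < d \<Longrightarrow> norm (integral (cbox t (t + h *\<^sub>R One)) G /\<^sub>R h ^ DIM(real) - G t) < cmod (G t)"
      using N(2)[OF _ e] t by blast
    define h where "h = min d (c - t) / 2"
    have h: "0 < h" "h < d" "t + h \<le> c" using d t by (auto simp: h_def min_def field_simps)
    have "integral {t..t + h} G = integral {t..t + h} g"
      using t h by (intro Henstock_Kurzweil_Integration.integral_cong) (auto simp: G_def)
    also have "integral {0..t} g + integral {t..t + h} g = integral {0..t + h} g"
      using t h by (intro Henstock_Kurzweil_Integration.integral_combine integrable_on_subinterval[OF int]) auto
    then have "integral {t..t + h} g = 0" using zero[of t] zero[of "t + h"] t h by simp
    finally have "integral (cbox t (t + h *\<^sub>R One)) G = 0" by simp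
    then show False using d(2)[of h] h by simp
  qed
  have "negligible (N \<union> {c})" using N(1) by (intro negligible_Un) auto
  moreover have "{0..c} \<in> sets lebesgue" by simp
  ultimately show ?thesis using G0 by (simp only: AE_lebesgue_on_iff) blast
qed

text \<open>Fundamental lemma of the calculus of variations, by approximation of the indicator of
  \<open>{..r}\<close>.\<close>

lemma AE_zero_if_orthogonal_to_continuous:
  fixes g :: "real \<Rightarrow> complex"
  assumes g: "integrable (lebesgue_on {0..c}) g"
    and zero: "\<And>k :: real \<Rightarrow> real. continuous_on UNIV k \<Longrightarrow> (LINT t|lebesgue_on {0..c}. of_real (k t) * g t) = 0"
  shows "AE t in lebesgue_on {0..c}. g t = 0"
proof (rule AE_zero_if_integrals_zero[OF g])
  fix r assume r: "r \<in> {0..c}"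
  let ?M = "lebesgue_on {0..c}"
  \<comment> \<open>Continuous ramps falling from 1 to 0 on an interval of length 1/m to the right
    of \<open>r\<close>.\<close>
  define k where "k m s = max 0 (min 1 (1 - real m * (s - r)))" for m s
  have kc: "continuous_on UNIV (k m)" for m unfolding k_def by (intro continuous_intros)
  have lim: "(\<lambda>m. k m s) \<longlonglongrightarrow> indicator {..r} s" for s
  proof (cases "s \<le> r")
    case True
    then have "k m s = 1" for m by (simp add: k_def mult_nonneg_nonpos)
    then show ?thesis using True by simp
  next
    case False
    then obtain m0 where m0: "real m0 * (s - r) > 1" using reals_Archimedean3[of "s - r"] by auto
    have "k m s = 0" if "m \<ge> m0" for m
    proof -
      have "real m0 * (s - r) \<le> real m * (s - r)" using that False by (intro mult_right_mono) auto
      then show ?thesis using m0 by (simp add: k_def)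
    qed
    then have "\<forall>\<^sub>F m in sequentially. k m s = 0" using eventually_sequentially by blast
    then show ?thesis using False by (simp add: tendsto_eventually)
  qed
  have [measurable]: "g \<in> borel_measurable ?M" using g by simp
  have km [measurable]: "k m \<in> borel_measurable ?M" for m
    using borel_measurable_continuous_onI[OF kc[of m]] by (intro measurable_restrict_space1 measurable_completion) simp
  have im [measurable]: "(\<lambda>s. indicator {..r} s :: real) \<in> borel_measurable ?M"
    by (intro measurable_restrict_space1 measurable_completion) simp
  have "(\<lambda>m. LINT t|?M. of_real (k m t) * g t) \<longlonglongrightarrow> (LINT t|?M. of_real (indicator {..r} t) * g t)"
  proof (rule integral_dominated_convergence)
    show "integrable ?M (\<lambda>t. cmod (g t))" using g by simp
    show "AE t in ?M. (\<lambda>m. of_real (k m t) * g t) \<longlonglongrightarrow> of_real (indicator {..r} t) * g t"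
      by (intro AE_I2 tendsto_intros lim)
    show "AE t in ?M. cmod (of_real (k m t) * g t) \<le> cmod (g t)" for m
      by (intro AE_I2) (auto simp: norm_mult k_def intro!: mult_left_le_one_le)
  qed measurable
  then have "(\<lambda>m::nat. 0) \<longlonglongrightarrow> (LINT t|?M. of_real (indicator {..r} t) * g t)" by (simp add: zero[OF kc])
  then have "(LINT t|?M. of_real (indicator {..r} t) * g t) = 0" using LIMSEQ_unique tendsto_const by blast
  also have "(LINT t|?M. of_real (indicator {..r} t) * g t) = integral {0..c} (\<lambda>t. of_real (indicator {..r} t) * g t)"
  proof (rule lebesgue_integral_eq_integral)
    show "integrable ?M (\<lambda>t. of_real (indicator {..r} t) * g t)"
    proof (rule Bochner_Integration.integrable_bound[OF g])
      show "(\<lambda>t. of_real (indicator {..r} t) * g t) \<in> borel_measurable ?M" by measurable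
    qed (auto simp: norm_mult indicator_def)
  qed simp
  also have "\<dots> = integral {0..c} (\<lambda>t. if t \<in> {0..r} then g t else 0)"
    by (intro Henstock_Kurzweil_Integration.integral_cong) auto
  also have "\<dots> = integral ({0..r} \<inter> {0..c}) g" by (rule integral_restrict_Int)
  also have "{0..r} \<inter> {0..c} = {0..r}" using r by auto
  finally show "integral {0..r} g = 0" .
qed

context point_interactions
begin

section \<open>Restriction to the intervals \<open>{0..x N}\<close>\<close>

abbreviation "M N \<equiv> lebesgue_on {0..x N}"

lemma integral_L_eq_M:
  assumes "\<And>t. t \<in> I \<Longrightarrow> x N < t \<Longrightarrow> F t = 0"
  shows "(LINT t|L. F t) = (LINT t|M N. F t :: complex)"
proof -
  have "(LINT t|L. F t) = (LINT t|lebesgue. indicator I t *\<^sub>R F t)"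
    using I_sets by (intro integral_restrict_space) auto
  also have "\<dots> = (LINT t|lebesgue. indicator {0..x N} t *\<^sub>R F t)"
  proof (intro Bochner_Integration.integral_cong refl)
    fix t
    show "indicator I t *\<^sub>R F t = indicator {0..x N} t *\<^sub>R F t"
    proof (cases "t \<in> {0..x N}")
      case True
      then have "t \<in> I" using interval_in_I by blast
      then show ?thesis using True by simp
    next
      case False
      then have "t \<in> I \<Longrightarrow> x N < t" by (auto simp: mem_I)
      then show ?thesis using False assms by (cases "t \<in> I") auto
    qed
  qed
  also have "\<dots> = (LINT t|M N. F t)"
    by (intro integral_restrict_space[symmetric]) auto
  finally show ?thesis .
qed

lemma L2_restrict:
  assumes "f \<in> L2 L" shows "f \<in> L2 (M N)"
proof -
  let ?g = "\<lambda>t. (cmod (f t))\<^sup>2"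
  have "f \<in> borel_measurable (M N)"
    by (rule measurable_restrict_mono[OF L2_D(1)[OF assms] interval_in_I])
  moreover have "integrable (M N) ?g"
  proof -
    have "integrable lebesgue (\<lambda>t. indicator I t *\<^sub>R ?g t)"
      using L2_D(2)[OF assms] I_sets by (subst (asm) integrable_restrict_space) auto
    then have "integrable lebesgue (\<lambda>t. indicator {0..x N} t *\<^sub>R (indicator I t *\<^sub>R ?g t))"
      by (rule integrable_mult_indicator[rotated]) simp
    also have "(\<lambda>t. indicator {0..x N} t *\<^sub>R (indicator I t *\<^sub>R ?g t)) = (\<lambda>t. indicator {0..x N} t *\<^sub>R ?g t)"
      using interval_in_I[of N] by (auto simp: indicator_def fun_eq_iff subset_iff)
    finally show ?thesis by (subst integrable_restrict_space) auto
  qed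
  ultimately show ?thesis by (simp add: L2_def)
qed

lemma glue_L2_finite:
  assumes y: "piecewise_cont y" and van: "\<And>n t. n \<ge> N \<Longrightarrow> y n t = 0"
  shows "glue y \<in> L2 L"
proof -
  have "\<exists>B. \<forall>t\<in>piece n. cmod (y n t) \<le> B" for n
  proof -
    have "bounded (y n ` piece n)"
      using y by (intro compact_imp_bounded compact_continuous_image) (auto simp: piecewise_cont_def)
    then show ?thesis unfolding bounded_iff by blast
  qed
  then obtain B where B: "\<And>n t. t \<in> piece n \<Longrightarrow> cmod (y n t) \<le> B n" by metis
  define C where "C = (\<Sum>n<N. \<bar>B n\<bar>)"
  show ?thesis
  proof (rule L2_bound[OF glue_measurable[OF y], where g = "\<lambda>t. C\<^sup>2 * indicator {0..x N} t"])
    have "integrable lebesgue (indicat_real {0..x N})" by (intro integrable_real_indicator) (auto simp: x_nonneg)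
    then show "integrable L (\<lambda>t. C\<^sup>2 * indicator {0..x N} t)"
      using I_sets interval_in_I[of N]
      by (intro integrable_mult_right) (subst integrable_restrict_space, auto simp: indicator_inter_arith[symmetric] Int_absorb1)
    fix t assume "t \<in> space L"
    then have t: "t \<in> I" by (simp add: space_restrict_space)
    then obtain n where n: "x n \<le> t" "t < x (Suc n)" by (rule piece_ex)
    show "(cmod (glue y t))\<^sup>2 \<le> C\<^sup>2 * indicator {0..x N} t"
    proof (cases "n < N")
      case True
      have "cmod (y n t) \<le> B n" using B n by simp
      also have "\<dots> \<le> \<bar>B n\<bar>" by simp
      also have "\<dots> \<le> C" unfolding C_def using True by (intro member_le_sum) auto
      finally have "(cmod (y n t))\<^sup>2 \<le> C\<^sup>2" by (intro power_mono) auto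
      moreover have "t \<in> {0..x N}" using n True x_mono[of "Suc n" N] x_nonneg[of n] by auto
      ultimately show ?thesis using n by (simp add: glue_eq)
    next
      case False
      then show ?thesis using van[of n t] n by (simp add: glue_eq)
    qed
  qed
qed

text \<open>Whole pieces are removed, which preserves continuity on every closed piece without any
  condition at \<open>x N\<close>.\<close>

definition truncate :: "nat \<Rightarrow> (nat \<Rightarrow> real \<Rightarrow> complex) \<Rightarrow> nat \<Rightarrow> real \<Rightarrow> complex" where
  "truncate N y n t = (if n < N then y n t else 0)"

lemma truncate_cont: "piecewise_cont y \<Longrightarrow> piecewise_cont (truncate N y)"
  unfolding piecewise_cont_def truncate_def[abs_def] by (intro allI, case_tac "n < N") auto

lemma glue_truncate: "0 \<le> t \<Longrightarrow> t < x N \<Longrightarrow> glue (truncate N y) t = glue y t"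
proof -
  assume t: "0 \<le> t" "t < x N"
  then have "t \<in> I" by (auto simp: mem_I)
  then obtain n where n: "x n \<le> t" "t < x (Suc n)" by (rule piece_ex)
  then have "x n < x N" using t by simp
  then have "n < N" using x_strict by (simp add: strict_mono_less)
  then show ?thesis using n by (simp add: glue_eq truncate_def)
qed

lemma AE_M_truncate: "AE t in M N. glue (truncate N y) t = glue y t"
  by (subst AE_lebesgue_on_iff) (auto intro!: exI[of _ "{x N}"] glue_truncate)

lemma AE_M_subset:
  assumes "AE t in M N. P t" "k \<le> N" shows "AE t in M k. P t"
proof -
  have "{0..x k} \<subseteq> {0..x N}" using x_mono[OF assms(2)] by auto
  then show ?thesis using assms(1) by (auto simp: AE_lebesgue_on_iff)
qed

lemma glue_L2_M: assumes "piecewise_cont y" shows "glue y \<in> L2 (M N)"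
proof (rule L2_cong_AE)
  show "glue (truncate N y) \<in> L2 (M N)"
    by (rule L2_restrict, rule glue_L2_finite[OF truncate_cont[OF assms], of N]) (simp add: truncate_def)
  show "glue y \<in> borel_measurable (M N)"
    by (rule measurable_restrict_mono[OF glue_measurable[OF assms] interval_in_I])
  show "AE t in M N. glue y t = glue (truncate N y) t" using AE_M_truncate[of N y] by auto
qed

lemma glue_has_integral_piece:
  assumes "piecewise_cont F" shows "(glue F has_integral integral (piece n) (F n)) (piece n)"
proof -
  have "(F n has_integral integral (piece n) (F n)) (piece n)"
    using assms by (intro integrable_integral integrable_continuous_real) (auto simp: piecewise_cont_def)
  then show ?thesis
    using has_integral_spike_interior[of "F n" _ "x n" "x (Suc n)" "glue F"] by (simp add: glue_eq)
qed

lemma glue_has_integral: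
  assumes "piecewise_cont F"
  shows "(glue F has_integral (\<Sum>n<N. integral (piece n) (F n))) {0..x N}"
proof (induction N)
  case 0 show ?case using x0 has_integral_refl(2)[of "glue F" 0] by simp
next
  case (Suc n)
  from has_integral_combine[OF _ _ Suc glue_has_integral_piece[OF assms]]
  show ?case using x_nonneg[of n] x_less[of n] by simp
qed

lemma piecewise_cont_mult: "piecewise_cont y \<Longrightarrow> piecewise_cont p \<Longrightarrow> piecewise_cont (\<lambda>n t. y n t * p n t)"
  unfolding piecewise_cont_def by (auto intro!: continuous_intros)

lemma solution_cont: "solution z y y' \<Longrightarrow> piecewise_cont y" "solution z y y' \<Longrightarrow> piecewise_cont y'"
  using piecewise_deriv_cont unfolding solution_def by blast+

text \<open>Variation of constants solves \<open>-u'' - \<zeta> u = h\<close>. To the right of the support of \<open>h\<close> the solution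
  vanishes because the multiple \<open>c\<close> of \<open>\<psi>\<close> is subtracted and \<open>h\<close> is orthogonal to \<open>\<psi>\<close>.\<close>

lemma test_function:
  assumes \<psi>: "solution \<zeta> \<psi> \<psi>'" "\<psi> 0 0 = 1" "\<psi>' 0 0 = 0"
    and h: "piecewise_cont h" "\<And>n t. n \<ge> N \<Longrightarrow> h n t = 0"
    and orth: "(\<Sum>n<N. integral (piece n) (\<lambda>t. \<psi> n t * h n t)) = 0"
  obtains u where "u \<in> H_dom b x \<alpha>" "AE t in L. - D2 u t - \<zeta> * u t = glue h t"
proof -
  \<comment> \<open>The second fundamental solution, normalised to Wronskian 1 with
    \<open>\<psi>\<close>.\<close>
  obtain \<theta> \<theta>' where \<theta>: "solution \<zeta> \<theta> \<theta>'" "\<theta> 0 0 = 0" "\<theta>' 0 0 = 1" by (rule solution_exists)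
  have W1: "\<psi> n t * \<theta>' n t - \<psi>' n t * \<theta> n t = 1" if "t \<in> piece n" for n t
    using W_const[OF \<psi>(1) \<theta>(1) that] \<psi>(2,3) \<theta>(2,3) by (simp add: W_def)
  \<comment> \<open>The running integral of \<open>y * h\<close> from 0, itself written as a family
    so that it can be differentiated on closed pieces.\<close>
  define P where "P y n t = (\<Sum>k<n. integral (piece k) (\<lambda>t. y k t * h k t)) + integral {x n..t} (\<lambda>t. y n t * h n t)"
    for y :: "nat \<Rightarrow> real \<Rightarrow> complex" and n t
  have P_deriv: "piecewise_deriv (P y) (\<lambda>n t. y n t * h n t)" if "piecewise_cont y" for y
    unfolding piecewise_deriv_def
  proof (intro allI ballI)
    fix n t assume t: "t \<in> piece n"
    have "continuous_on (piece n) (\<lambda>t. y n t * h n t)"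
      using piecewise_cont_mult[OF that h(1)] by (simp add: piecewise_cont_def)
    from has_vector_derivative_add[OF has_vector_derivative_const integral_has_vector_derivative[OF this t]]
    show "(P y n has_vector_derivative y n t * h n t) (at t within piece n)" unfolding P_def by simp
  qed
  have P_match: "P y (Suc n) (x (Suc n)) = P y n (x (Suc n))" for y n by (simp add: P_def)
  have P_late: "P y n t = (\<Sum>k<N. integral (piece k) (\<lambda>t. y k t * h k t))" if "n \<ge> N" for y n t
  proof -
    have "(\<Sum>k<n. integral (piece k) (\<lambda>t. y k t * h k t)) = (\<Sum>k<N. integral (piece k) (\<lambda>t. y k t * h k t))"
      using that h(2) by (intro sum.mono_neutral_right) auto
    then show ?thesis using h(2)[OF that] by (simp add: P_def)
  qed
  define c where "c = (\<Sum>k<N. integral (piece k) (\<lambda>t. \<theta> k t * h k t))"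
  define A where "A n t = P \<theta> n t - c" for n t
  define B where "B n t = P \<psi> n t" for n t
  have A: "piecewise_deriv A (\<lambda>n t. \<theta> n t * h n t)"
    using P_deriv[OF solution_cont(1)[OF \<theta>(1)]] unfolding piecewise_deriv_def A_def[abs_def]
    by (auto intro!: derivative_eq_intros)
  have B: "piecewise_deriv B (\<lambda>n t. \<psi> n t * h n t)"
    using P_deriv[OF solution_cont(1)[OF \<psi>(1)]] unfolding B_def[abs_def] .
  define u where "u n t = \<psi> n t * A n t - \<theta> n t * B n t" for n t
  define u' where "u' n t = \<psi>' n t * A n t - \<theta>' n t * B n t" for n t
  define u'' where "u'' n t = - \<zeta> * u n t - h n t" for n t
  have derivs: "(\<psi> n has_vector_derivative \<psi>' n t) (at t within piece n)" "(\<psi>' n has_vector_derivative - \<zeta> * \<psi> n t) (at t within piece n)"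
    "(\<theta> n has_vector_derivative \<theta>' n t) (at t within piece n)" "(\<theta>' n has_vector_derivative - \<zeta> * \<theta> n t) (at t within piece n)"
    "(A n has_vector_derivative \<theta> n t * h n t) (at t within piece n)" "(B n has_vector_derivative \<psi> n t * h n t) (at t within piece n)"
    if "t \<in> piece n" for n t
    using \<psi>(1) \<theta>(1) A B that by (auto simp: solution_def piecewise_deriv_def)
  have u: "piecewise_deriv u u'"
    unfolding piecewise_deriv_def u_def[abs_def] u'_def
  proof (intro allI ballI)
    fix n t assume t: "t \<in> piece n"
    note d = derivs[OF t]
    show "((\<lambda>t. \<psi> n t * A n t - \<theta> n t * B n t) has_vector_derivative \<psi>' n t * A n t - \<theta>' n t * B n t) (at t within piece n)"
      by (rule has_vector_derivative_eq_rhs[OF has_vector_derivative_diff[OF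
        has_vector_derivative_mult[OF d(1,5)] has_vector_derivative_mult[OF d(3,6)]]]) (simp add: algebra_simps)
  qed
  have u': "piecewise_deriv u' u''"
    unfolding piecewise_deriv_def u'_def[abs_def]
  proof (intro allI ballI)
    fix n t assume t: "t \<in> piece n"
    note d = derivs[OF t]
    \<comment> \<open>The terms with \<open>h\<close> combine to the Wronskian times
      \<open>h\<close>.\<close>
    have "\<psi>' n t * (\<theta> n t * h n t) + - \<zeta> * \<psi> n t * A n t - (\<theta>' n t * (\<psi> n t * h n t) + - \<zeta> * \<theta> n t * B n t)
        = - \<zeta> * u n t - (\<psi> n t * \<theta>' n t - \<psi>' n t * \<theta> n t) * h n t"
      by (simp add: u_def algebra_simps)
    then have eq: "\<psi>' n t * (\<theta> n t * h n t) + - \<zeta> * \<psi> n t * A n t - (\<theta>' n t * (\<psi> n t * h n t) + - \<zeta> * \<theta> n t * B n t) = u'' n t"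
      unfolding W1[OF t] u''_def by simp
    show "((\<lambda>t. \<psi>' n t * A n t - \<theta>' n t * B n t) has_vector_derivative u'' n t) (at t within piece n)"
      by (rule has_vector_derivative_eq_rhs[OF has_vector_derivative_diff[OF
        has_vector_derivative_mult[OF d(2,5)] has_vector_derivative_mult[OF d(4,6)]] eq])
  qed
  have u'': "piecewise_cont u''"
    using piecewise_deriv_cont[OF u] h(1) unfolding u''_def[abs_def] piecewise_cont_def by (auto intro!: continuous_intros)
  have m: "matched u u'"
  proof -
    have "A (Suc n) (x (Suc n)) = A n (x (Suc n))" "B (Suc n) (x (Suc n)) = B n (x (Suc n))" for n
      by (simp_all add: A_def B_def P_match)
    then show ?thesis using \<psi>(1) \<theta>(1) unfolding solution_def matched_def u_def u'_def by (simp add: algebra_simps)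
  qed
  have van: "u n t = 0" if "n \<ge> N" for n t
    using P_late[OF that] orth by (simp add: u_def A_def B_def c_def)
  have van'': "u'' n t = 0" if "n \<ge> N" for n t using van[OF that] h(2)[OF that] by (simp add: u''_def)
  have L2u: "glue u \<in> L2 L" by (rule glue_L2_finite[OF piecewise_deriv_cont[OF u]]) (rule van)
  have L2u'': "glue u'' \<in> L2 L" by (rule glue_L2_finite[OF u'']) (rule van'')
  note W = glue_W22[OF u u' u'' L2u L2u'']
  have "glue u \<in> W22_comp I X"
  proof (rule W22_compI[OF W(1), of N])
    fix t assume t: "t \<in> I - X" "x N < t"
    then obtain n where n: "x n \<le> t" "t < x (Suc n)" using piece_ex by blast
    have "n \<ge> N" using n t x_mono[of "Suc n" N] by (cases "N \<le> n") auto
    then show "glue u t = 0" using van n by (simp add: glue_eq)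
  qed
  \<comment> \<open>\<open>B\<close> starts at 0 and \<open>\<psi>'\<close> vanishes at 0, so
    subtracting a multiple of \<open>\<psi>\<close> does not spoil the condition at the left
    end.\<close>
  moreover have "D1 (glue u) 0 = 0"
  proof -
    have "0 \<in> I - X" "0 < x 1" using zero_not_X[of 0] x_less[of 0] x0 by auto
    then have "D1 (glue u) 0 = u' 0 0" using W(2)[of 0] x0 by (simp add: glue_eq[of 0])
    also have "\<dots> = 0" using \<psi>(3) x0 by (simp add: u'_def B_def P_def)
    finally show ?thesis .
  qed
  ultimately have "glue u \<in> H_dom b x \<alpha>"
    unfolding H_dom_iff using glue_delta[OF u piecewise_deriv_cont[OF u'] m W(2)] by blast
  moreover have "AE t in L. - D2 (glue u) t - \<zeta> * glue u t = glue h t"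
    using W(3) by eventually_elim (simp add: glue_def u''_def)
  ultimately show thesis by (rule that)
qed

text \<open>By continuity from the right at 0 the function is nonzero on an interval inside the
  first piece.\<close>

lemma glue_not_AE_zero:
  assumes y: "piecewise_cont y" "y 0 0 = 1" and N: "N \<ge> 1"
  shows "\<not> (AE t in M N. glue y t = 0)"
proof
  assume "AE t in M N. glue y t = 0"
  then have "AE t in M 1. glue y t = 0" using AE_M_subset N by blast
  then obtain K where K: "negligible K" "\<And>t. t \<in> {0..x 1} - K \<Longrightarrow> glue y t = 0" by (auto simp: AE_lebesgue_on_iff)
  have x1: "0 < x 1" using x_less[of 0] x0 by simp
  have "continuous_on {0..x 1} (y 0)" using y(1) x0 by (auto simp: piecewise_cont_def dest: spec[of _ 0])
  then have "(y 0 \<longlongrightarrow> y 0 0) (at 0 within {0..x 1})" using x1 by (simp add: continuous_on_def)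
  then have "(y 0 \<longlongrightarrow> 1) (at_right 0)" using y(2) x1 by (simp add: at_within_Icc_at_right)
  then have "\<forall>\<^sub>F t in at_right 0. y 0 t \<noteq> 0" by (rule tendsto_imp_eventually_ne) simp
  then obtain d where d: "d > 0" "\<And>t. 0 < t \<Longrightarrow> t < d \<Longrightarrow> y 0 t \<noteq> 0" by (auto simp: eventually_at_right_field)
  have "box 0 (min d (x 1)) \<subseteq> K"
  proof
    fix t assume t: "t \<in> box 0 (min d (x 1))"
    then have "glue y t = y 0 t" using x0 by (simp add: glue_eq[of 0])
    then show "t \<in> K" using K(2)[of t] d(2)[of t] t by auto
  qed
  then have "negligible (box 0 (min d (x 1)))" using K(1) negligible_subset by blast
  then have "box 0 (min d (x 1)) = {}" by (simp only: negligible_interval)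
  moreover have "min d (x 1) / 2 \<in> box 0 (min d (x 1))" using d(1) x1 by (auto simp: min_def)
  ultimately show False by blast
qed

text \<open>On \<open>{0..x N}\<close> every piecewise continuous \<open>h\<close> orthogonal to
  \<open>\<phi>\<close> is the image of a domain element under H - \<open>cnj z\<close>, and
  \<open>f\<close> is orthogonal to all such images. Hence \<open>f\<close> minus its projection
  onto \<open>\<phi>\<close> is orthogonal to all continuous functions.\<close>

lemma adjoint_eigenfunction_local:
  assumes f: "(f, \<lambda>t. z * f t) \<in> op_adjoint L H0"
    and \<phi>: "solution z \<phi> \<phi>'" "\<phi> 0 0 = 1" "\<phi>' 0 0 = 0" and N: "N \<ge> 1"
  shows "\<exists>c. AE t in M N. f t = c * glue \<phi> t"
proof -
  have fL: "f \<in> L2 L" using f by (auto simp: op_adjoint_def)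
  let ?\<phi> = "glue \<phi>"
  note c\<phi> = solution_cont(1)[OF \<phi>(1)]
  have L2M: "f \<in> L2 (M N)" "?\<phi> \<in> L2 (M N)" using L2_restrict[OF fL] glue_L2_M[OF c\<phi>] by auto
  \<comment> \<open>The adjoint relation for \<open>z\<close> is tested with H -
    \<open>cnj z\<close>, whose solution is the conjugate of \<open>\<phi>\<close>; orthogonality to
    \<open>\<phi>\<close> is then the bilinear condition of \<open>test_function\<close>.\<close>
  define \<psi> where "\<psi> n t = cnj (\<phi> n t)" for n t
  define \<psi>' where "\<psi>' n t = cnj (\<phi>' n t)" for n t
  have \<psi>: "solution (cnj z) \<psi> \<psi>'" "\<psi> 0 0 = 1" "\<psi>' 0 0 = 0"
    using solution_cnj[OF \<phi>(1)] \<phi>(2,3) by (simp_all add: \<psi>_def[abs_def] \<psi>'_def[abs_def])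
  have orth: "L2_inner (M N) (glue h) f = 0"
    if h: "piecewise_cont h" and hN: "\<And>n t. n \<ge> N \<Longrightarrow> h n t = 0" and ho: "L2_inner (M N) (glue h) ?\<phi> = 0" for h
  proof -
    let ?F = "\<lambda>n t. \<psi> n t * h n t"
    have cF: "piecewise_cont ?F" by (rule piecewise_cont_mult[OF solution_cont(1)[OF \<psi>(1)] h])
    have gF: "glue ?F t = glue h t * cnj (?\<phi> t)" for t by (simp add: glue_def \<psi>_def mult.commute)
    have "integrable (M N) (glue ?F)"
      unfolding gF[abs_def] by (rule L2_inner_integrable[OF glue_L2_M[OF h] L2M(2)])
    then have "L2_inner (M N) (glue h) ?\<phi> = integral {0..x N} (glue ?F)"
      unfolding L2_inner_def gF[symmetric] by (intro lebesgue_integral_eq_integral) auto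
    also have "\<dots> = (\<Sum>n<N. integral (piece n) (?F n))" by (rule integral_unique[OF glue_has_integral[OF cF]])
    finally have "(\<Sum>n<N. integral (piece n) (?F n)) = 0" using ho by simp
    from test_function[OF \<psi> h hN this]
    obtain u where u: "u \<in> H_dom b x \<alpha>" "AE t in L. - D2 u t - cnj z * u t = glue h t" by blast
    have uL: "u \<in> L2 L" "(\<lambda>t. - D2 u t) \<in> L2 L" using u(1) H0_L2 by (auto simp: H0_def)
    have "(u, \<lambda>t. - D2 u t) \<in> H0" using u(1) by (auto simp: H0_def)
    then have "L2_inner L (\<lambda>t. - D2 u t) f = L2_inner L u (\<lambda>t. z * f t)" using f unfolding op_adjoint_def by blast
    also have "\<dots> = cnj z * L2_inner L u f" by (rule L2_inner_scale_right)
    also have "\<dots> = L2_inner L (\<lambda>t. cnj z * u t) f" by (rule L2_inner_scale_left[symmetric])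
    finally have "L2_inner L (\<lambda>t. - D2 u t - cnj z * u t) f = 0"
      using uL fL by (simp add: L2_inner_diff_left L2_scale)
    also have "L2_inner L (\<lambda>t. - D2 u t - cnj z * u t) f = L2_inner L (glue h) f"
      using u(2) uL fL glue_L2_finite[OF h hN] by (intro L2_inner_cong_AE) (auto intro!: L2_D(1) L2_diff L2_scale)
    also have "\<dots> = L2_inner (M N) (glue h) f"
      unfolding L2_inner_def
    proof (rule integral_L_eq_M)
      fix t assume t: "t \<in> I" "x N < t"
      then obtain n where n: "x n \<le> t" "t < x (Suc n)" using piece_ex by blast
      have "n \<ge> N" using n t x_mono[of "Suc n" N] by (cases "N \<le> n") auto
      then show "glue h t * cnj (f t) = 0" using hN n by (simp add: glue_eq)
    qed
    finally show ?thesis .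
  qed
  define q where "q = L2_inner (M N) ?\<phi> ?\<phi>"
  have q: "q \<noteq> 0"
    using glue_not_AE_zero[OF c\<phi> \<phi>(2) N] L2_norm_eq_0[OF L2M(2)] by (simp add: q_def L2_inner_self)
  define c where "c = L2_inner (M N) f ?\<phi> / q"
  define g where "g t = f t - c * ?\<phi> t" for t
  have gL: "g \<in> L2 (M N)" unfolding g_def[abs_def] by (intro L2_diff L2_scale L2M)
  have g\<phi>: "L2_inner (M N) g ?\<phi> = 0"
  proof -
    have "L2_inner (M N) g ?\<phi> = L2_inner (M N) f ?\<phi> - c * q"
      unfolding g_def[abs_def] q_def using L2M by (simp add: L2_inner_diff_left L2_scale L2_inner_scale_left)
    then show ?thesis using q by (simp add: c_def)
  qed
  have "AE t in M N. cnj (g t) = 0"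
  proof (rule AE_zero_if_orthogonal_to_continuous)
    have "(\<lambda>t. 1) \<in> L2 (M N)" using continuous_on_L2_interval[of 0 "x N" "\<lambda>t. 1"] by simp
    then show "integrable (M N) (\<lambda>t. cnj (g t))"
      using L2_inner_integrable[of "\<lambda>t. 1" "M N" g] gL by simp
    fix k :: "real \<Rightarrow> real" assume k: "continuous_on UNIV k"
    let ?k = "\<lambda>t. complex_of_real (k t)"
    have kL: "?k \<in> L2 (M N)"
      using k continuous_on_subset by (intro continuous_on_L2_interval continuous_intros) blast
    \<comment> \<open>The coefficient that makes \<open>k\<close> minus a multiple of
      \<open>\<phi>\<close> orthogonal to \<open>\<phi>\<close>.\<close>
    define e where "e = L2_inner (M N) ?k ?\<phi> / q"
    define h where "h = truncate N (\<lambda>n t. ?k t - e * \<phi> n t)"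
    have hc: "piecewise_cont h"
      unfolding h_def using c\<phi> continuous_on_subset[OF k]
      by (intro truncate_cont) (auto simp: piecewise_cont_def intro!: continuous_intros)
    have "glue (\<lambda>n t. ?k t - e * \<phi> n t) = (\<lambda>t. ?k t - e * ?\<phi> t)" by (simp add: glue_def[abs_def])
    then have hAE: "AE t in M N. glue h t = ?k t - e * ?\<phi> t"
      using AE_M_truncate[of N "\<lambda>n t. ?k t - e * \<phi> n t"] unfolding h_def by simp
    have h_inner: "L2_inner (M N) (glue h) F = L2_inner (M N) ?k F - e * L2_inner (M N) ?\<phi> F" if F: "F \<in> L2 (M N)" for F
    proof -
      have "L2_inner (M N) (glue h) F = L2_inner (M N) (\<lambda>t. ?k t - e * ?\<phi> t) F"
        using hAE F kL L2M glue_L2_M[OF hc]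
        by (intro L2_inner_cong_AE) (auto intro!: L2_D(1) L2_diff L2_scale)
      then show ?thesis using F kL L2M by (simp add: L2_inner_diff_left L2_scale L2_inner_scale_left)
    qed
    have h\<phi>: "L2_inner (M N) (glue h) ?\<phi> = 0" using h_inner[OF L2M(2)] q by (simp add: e_def flip: q_def)
    have "L2_inner (M N) (glue h) f = 0" by (rule orth[OF hc _ h\<phi>]) (simp add: h_def truncate_def)
    then have "L2_inner (M N) (glue h) g = 0"
      unfolding g_def[abs_def] using h\<phi> L2M glue_L2_M[OF hc]
      by (simp add: L2_inner_diff_right L2_scale L2_inner_scale_right)
    moreover have "L2_inner (M N) ?\<phi> g = 0" using g\<phi> by (metis L2_inner_commute complex_cnj_zero)
    ultimately have "L2_inner (M N) ?k g = 0" using h_inner[OF gL] by simp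
    then show "(LINT t|M N. of_real (k t) * cnj (g t)) = 0" by (simp add: L2_inner_def)
  qed
  then have "AE t in M N. f t = c * ?\<phi> t"
    by eventually_elim (simp only: complex_cnj_zero_iff g_def right_minus_eq)
  then show ?thesis by blast
qed

text \<open>The local multiples share one constant, because \<open>\<phi>\<close> is not null on the
  first piece; conversely, Green's formula applies to any square integrable multiple of
  \<open>\<phi>\<close>.\<close>

lemma eigenspace_H0:
  assumes \<phi>: "solution z \<phi> \<phi>'" "\<phi> 0 0 = 1" "\<phi>' 0 0 = 0"
  shows "op_eigenspace (op_adjoint L H0) z = {f \<in> L2 L. \<exists>c. AE t in L. f t = c * glue \<phi> t}"
proof (intro equalityI subsetI)
  fix f assume "f \<in> op_eigenspace (op_adjoint L H0) z"
  then have f: "(f, \<lambda>t. z * f t) \<in> op_adjoint L H0" by (simp add: op_eigenspace_def)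
  then have "\<exists>c. AE t in M (Suc N). f t = c * glue \<phi> t" for N
    by (rule adjoint_eigenfunction_local[OF _ \<phi>]) simp
  then obtain c where c: "\<And>N. AE t in M (Suc N). f t = c N * glue \<phi> t" by metis
  \<comment> \<open>Both constants represent \<open>f\<close> on the first piece.\<close>
  have c0: "c N = c 0" for N
  proof (rule ccontr)
    assume ne: "c N \<noteq> c 0"
    have "AE t in M 1. f t = c N * glue \<phi> t" using AE_M_subset[OF c[of N], of 1] by simp
    moreover have "AE t in M 1. f t = c 0 * glue \<phi> t" using c[of 0] unfolding One_nat_def .
    ultimately have "AE t in M 1. glue \<phi> t = 0"
    proof eventually_elim
      case (elim t)
      then have "c N * glue \<phi> t = c 0 * glue \<phi> t" by (simp only:)
      then show ?case using ne by (simp only: mult_cancel_right) simp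
    qed
    then show False using glue_not_AE_zero[OF solution_cont(1)[OF \<phi>(1)] \<phi>(2), of 1] by simp
  qed
  have "\<exists>K. negligible K \<and> (\<forall>t\<in>{0..x (Suc N)} - K. f t = c 0 * glue \<phi> t)" for N
    using c[of N] unfolding c0[of N] by (subst (asm) AE_lebesgue_on_iff) auto
  then obtain K where K: "\<And>N. negligible (K N)" "\<And>N t. t \<in> {0..x (Suc N)} - K N \<Longrightarrow> f t = c 0 * glue \<phi> t"
    by metis
  have "AE t in L. f t = c 0 * glue \<phi> t"
    unfolding AE_lebesgue_on_iff[OF I_sets]
  proof (intro exI conjI ballI)
    show "negligible (\<Union>N. K N)" by (rule negligible_Union_nat[OF K(1)])
    fix t assume t: "t \<in> I - (\<Union>N. K N)"
    then obtain n where "t < x (Suc n)" "0 \<le> t" using piece_ex[of t] by (auto simp: mem_I)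
    then show "f t = c 0 * glue \<phi> t" using K(2)[of t n] t by auto
  qed
  then show "f \<in> {f \<in> L2 L. \<exists>c. AE t in L. f t = c * glue \<phi> t}" using f by (auto simp: op_adjoint_def)
next
  fix f assume "f \<in> {f \<in> L2 L. \<exists>c. AE t in L. f t = c * glue \<phi> t}"
  then obtain c where f: "f \<in> L2 L" and c: "AE t in L. f t = c * glue \<phi> t" by blast
  let ?y = "\<lambda>n t. c * \<phi> n t"
  have s: "solution z ?y (\<lambda>n t. c * \<phi>' n t)" by (rule solution_scale[OF \<phi>(1)])
  have gy: "glue ?y t = c * glue \<phi> t" for t by (simp add: glue_def)
  have fy: "AE t in L. f t = glue ?y t" using c by (simp add: gy)
  have yL: "glue ?y \<in> L2 L"
    using fy by (intro L2_cong_AE[OF f glue_measurable[OF solution_cont(1)[OF s]]]) auto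
  note W = solution_W22[OF s yL]
  have "0 \<in> I - X" "0 < x 1" using zero_not_X[of 0] x_less[of 0] x0 by auto
  then have D0: "D1 (glue ?y) 0 = 0" using W(2)[of 0] x0 \<phi>(3) by (simp add: glue_eq[of 0])
  have "L2_inner L v f = L2_inner L u (\<lambda>t. z * f t)" if "(u, v) \<in> H0" for u v
  proof -
    have u: "u \<in> H_dom b x \<alpha>" and v: "v = (\<lambda>t. - D2 u t)" using that by (auto simp: H0_def)
    have uv: "u \<in> L2 L" "v \<in> L2 L" using that H0_L2 by auto
    have "L2_inner L v f = L2_inner L v (glue ?y)"
      using uv f yL fy by (intro L2_inner_cong_AE) (auto intro: L2_D(1))
    also have "\<dots> = L2_inner L u (\<lambda>t. - D2 (glue ?y) t)"
      unfolding v by (rule green_formula[OF u W(1) D0 W(4)])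
    also have "\<dots> = L2_inner L u (\<lambda>t. z * f t)"
    proof (intro L2_inner_cong_AE)
      show "AE t in L. - D2 (glue ?y) t = z * f t" using W(3) fy by eventually_elim simp
    qed (use uv f W22_D(5)[OF W(1)] in \<open>auto intro!: L2_D(1) L2_scale L2_minus\<close>)
    finally show ?thesis .
  qed
  then show "f \<in> op_eigenspace (op_adjoint L H0) z"
    using f by (auto simp: op_eigenspace_def op_adjoint_def L2_scale)
qed

end


section \<open>Square integrable solutions\<close>

lemma L2_norm_mono:
  assumes "f \<in> L2 M" "g \<in> L2 M" "\<And>t. t \<in> space M \<Longrightarrow> cmod (f t) \<le> cmod (g t)"
  shows "L2_norm M f \<le> L2_norm M g"
  unfolding L2_norm_def using assms
  by (intro real_sqrt_le_mono integral_mono) (auto simp: L2_def)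

text \<open>For the mixed term in the norm of a linear function: it is at most half the sum of the
  squares, so it cannot cancel them.\<close>

lemma middle_bounds:
  fixes a c r :: real
  assumes "\<bar>r\<bar> \<le> (a + c) / 2" "0 \<le> a" "0 \<le> c"
  shows "a + r + c \<le> 3 * (a + c)" "1/2 * (a + c) \<le> a + r + c"
  using assms by (auto simp: abs_le_iff field_simps)

context point_interactions
begin

section \<open>Norms over single pieces\<close>

definition piece_norm :: "(nat \<Rightarrow> real \<Rightarrow> complex) \<Rightarrow> nat \<Rightarrow> real" where
  "piece_norm y n = L2_norm (lebesgue_on (piece n)) (y n)"

lemma piece_norm_nonneg: "0 \<le> piece_norm y n"
  by (simp add: piece_norm_def L2_norm_nonneg)

lemma piece_L2: "piecewise_cont y \<Longrightarrow> y n \<in> L2 (lebesgue_on (piece n))"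
  by (rule continuous_on_L2_interval) (simp add: piecewise_cont_def)

lemma piece_norm_sq:
  assumes "piecewise_cont y"
  shows "complex_of_real ((piece_norm y n)\<^sup>2) = integral (piece n) (\<lambda>t. y n t * cnj (y n t))"
proof -
  have "complex_of_real ((piece_norm y n)\<^sup>2) = L2_inner (lebesgue_on (piece n)) (y n) (y n)"
    by (simp add: piece_norm_def L2_inner_self)
  also have "\<dots> = integral (piece n) (\<lambda>t. y n t * cnj (y n t))"
    unfolding L2_inner_def using piece_L2[OF assms]
    by (intro lebesgue_integral_eq_integral L2_inner_integrable) auto
  finally show ?thesis .
qed

lemma norm_M_sq:
  assumes y: "piecewise_cont y" shows "(L2_norm (M N) (glue y))\<^sup>2 = (\<Sum>n<N. (piece_norm y n)\<^sup>2)"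
proof -
  let ?F = "\<lambda>n t. y n t * cnj (y n t)"
  have c: "piecewise_cont ?F" using y by (auto simp: piecewise_cont_def intro!: continuous_intros)
  have "complex_of_real ((L2_norm (M N) (glue y))\<^sup>2) = L2_inner (M N) (glue y) (glue y)" by (simp add: L2_inner_self)
  also have "\<dots> = integral {0..x N} (glue ?F)"
    unfolding L2_inner_def glue_def[of ?F] unfolding glue_def[of y, symmetric]
    by (intro lebesgue_integral_eq_integral L2_inner_integrable glue_L2_M y) auto
  also have "\<dots> = (\<Sum>n<N. complex_of_real ((piece_norm y n)\<^sup>2))"
    unfolding piece_norm_sq[OF y] by (rule integral_unique[OF glue_has_integral[OF c]])
  also have "\<dots> = complex_of_real (\<Sum>n<N. (piece_norm y n)\<^sup>2)" by simp
  finally show ?thesis unfolding of_real_eq_iff .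
qed

lemma norm_M_le:
  assumes f: "f \<in> L2 L" shows "(L2_norm (M N) f)\<^sup>2 \<le> (L2_norm L f)\<^sup>2"
proof -
  let ?g = "\<lambda>t. (cmod (f t))\<^sup>2"
  have "(LINT t|M N. ?g t) = (LINT t|lebesgue. indicator {0..x N} t *\<^sub>R ?g t)"
    by (intro integral_restrict_space) auto
  also have "\<dots> \<le> (LINT t|lebesgue. indicator I t *\<^sub>R ?g t)"
  proof (rule integral_mono)
    show "integrable lebesgue (\<lambda>t. indicator {0..x N} t *\<^sub>R ?g t)"
      using L2_D(2)[OF L2_restrict[OF f], of N] by (subst (asm) integrable_restrict_space) auto
    show "integrable lebesgue (\<lambda>t. indicator I t *\<^sub>R ?g t)"
      using L2_D(2)[OF f] I_sets by (subst (asm) integrable_restrict_space) auto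
    fix t show "indicator {0..x N} t *\<^sub>R ?g t \<le> indicator I t *\<^sub>R ?g t"
      using interval_in_I[of N] by (cases "t \<in> {0..x N}") (auto simp: subset_iff)
  qed
  also have "\<dots> = (LINT t|L. ?g t)" using I_sets by (intro integral_restrict_space[symmetric]) auto
  finally show ?thesis by (simp add: L2_norm_sq)
qed

text \<open>Turns square integrability into summability, so that the Gronwall lemma for sequences
  also serves the differential equation.\<close>

lemma glue_L2_iff:
  assumes y: "piecewise_cont y"
  shows "glue y \<in> L2 L \<longleftrightarrow> summable (\<lambda>n. (piece_norm y n)\<^sup>2)"
proof
  assume L2: "glue y \<in> L2 L"
  show "summable (\<lambda>n. (piece_norm y n)\<^sup>2)"
  proof (rule summableI_nonneg_bounded)
    show "(\<Sum>n<N. (piece_norm y n)\<^sup>2) \<le> (L2_norm L (glue y))\<^sup>2" for N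
      using norm_M_le[OF L2, of N] by (simp add: norm_M_sq[OF y])
  qed simp
next
  assume sum: "summable (\<lambda>n. (piece_norm y n)\<^sup>2)"
  define s where "s = (\<Sum>n. (piece_norm y n)\<^sup>2)"
  let ?g = "\<lambda>t. ennreal ((cmod (glue y t))\<^sup>2)"
  have [measurable]: "glue y \<in> borel_measurable L" by (rule glue_measurable[OF y])
  have ind [measurable]: "(\<lambda>t. indicator {0..x N} t :: ennreal) \<in> borel_measurable L" for N
    by (intro measurable_restrict_space1 measurable_completion) simp
  have part: "(\<integral>\<^sup>+t. ?g t * indicator {0..x N} t \<partial>L) \<le> ennreal s" for N
  proof -
    have "(\<integral>\<^sup>+t. ?g t * indicator {0..x N} t \<partial>L) = (\<integral>\<^sup>+t. ?g t * indicator {0..x N} t * indicator I t \<partial>lebesgue)"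
      using I_sets by (intro nn_integral_restrict_space) auto
    also have "\<dots> = (\<integral>\<^sup>+t. ?g t * indicator {0..x N} t \<partial>lebesgue)"
      using interval_in_I[of N] by (intro nn_integral_cong) (auto simp: indicator_def subset_iff)
    also have "\<dots> = (\<integral>\<^sup>+t. ?g t \<partial>M N)" by (intro nn_integral_restrict_space[symmetric]) auto
    also have "\<dots> = ennreal ((L2_norm (M N) (glue y))\<^sup>2)" by (rule L2_nn_integral[OF glue_L2_M[OF y]])
    also have "\<dots> \<le> ennreal s"
      unfolding norm_M_sq[OF y] s_def by (intro ennreal_leI sum_le_suminf sum) auto
    finally show ?thesis .
  qed
  have "(\<integral>\<^sup>+t. ?g t \<partial>L) = (\<integral>\<^sup>+t. (SUP N. ?g t * indicator {0..x N} t) \<partial>L)"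
  proof (rule nn_integral_cong)
    fix t assume "t \<in> space L"
    then obtain N where N: "0 \<le> t" "t < x N" by (auto simp: space_restrict_space mem_I)
    have "?g t = ?g t * indicator {0..x N} t" using N by simp
    also have "\<dots> \<le> (SUP N. ?g t * indicator {0..x N} t)" by (rule SUP_upper) simp
    finally show "?g t = (SUP N. ?g t * indicator {0..x N} t)"
      by (intro antisym SUP_least) (auto simp: indicator_def)
  qed
  also have "\<dots> = (SUP N. \<integral>\<^sup>+t. ?g t * indicator {0..x N} t \<partial>L)"
  proof (rule nn_integral_monotone_convergence_SUP)
    show "incseq (\<lambda>N t. ?g t * indicator {0..x N} t)"
      using x_mono by (auto simp: incseq_def le_fun_def indicator_def intro: order_trans)
  qed measurable
  also have "\<dots> \<le> ennreal s" using part by (intro SUP_least)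
  also have "\<dots> = ennreal ((sqrt s)\<^sup>2)" using suminf_nonneg[OF sum] by (simp add: s_def)
  finally show "glue y \<in> L2 L"
    using L2_nn_integral_le[of "glue y" L "sqrt s"] suminf_nonneg[OF sum] by (simp add: s_def)
qed

text \<open>The Cauchy-Schwarz inequality with moduli, after enlarging \<open>{x n..t}\<close> to
  the whole piece; the bound is thus uniform in \<open>t\<close>.\<close>

lemma W_increment:
  assumes y: "solution z y y'" and p: "solution \<zeta> p p'" and z: "cmod (z - \<zeta>) \<le> 1" and t: "t \<in> piece n"
  shows "cmod (W y y' p p' n t - W y y' p p' n (x n)) \<le> piece_norm p n * piece_norm y n"
proof -
  have c: "continuous_on (piece n) (y n)" "continuous_on (piece n) (p n)"
    using solution_cont(1)[OF y] solution_cont(1)[OF p] by (auto simp: piecewise_cont_def)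
  let ?h = "\<lambda>t. cmod (p n t) * cmod (y n t)"
  have hc: "continuous_on (piece n) ?h" using c by (intro continuous_intros)
  have int: "?h integrable_on piece n" using hc by (rule integrable_continuous_real)
  then have int': "?h integrable_on {x n..t}" using t by (intro integrable_on_subinterval[OF int]) auto
  have "cmod (W y y' p p' n t - W y y' p p' n (x n)) = cmod (integral {x n..t} (\<lambda>t. (z - \<zeta>) * (y n t * p n t)))"
    using integral_unique[OF W_diff[OF y p t]] by simp
  also have "\<dots> \<le> integral {x n..t} ?h"
  proof (rule integral_norm_bound_integral[OF _ int'])
    show "(\<lambda>t. (z - \<zeta>) * (y n t * p n t)) integrable_on {x n..t}" using W_diff[OF y p t] by (rule has_integral_integrable)
    fix s
    have "cmod (z - \<zeta>) * ?h s \<le> 1 * ?h s" using z by (intro mult_right_mono) auto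
    then show "cmod ((z - \<zeta>) * (y n s * p n s)) \<le> ?h s" by (simp add: norm_mult mult_ac)
  qed
  also have "\<dots> \<le> integral (piece n) ?h" using t int int' by (intro integral_subset_le) auto
  also have "\<dots> = (LINT t|lebesgue_on (piece n). ?h t)"
    using continuous_imp_integrable_real[OF hc] by (intro lebesgue_integral_eq_integral[symmetric]) auto
  also have "\<dots> \<le> piece_norm p n * piece_norm y n"
    unfolding piece_norm_def by (rule L2_Cauchy_Schwarz_abs[OF piece_L2 piece_L2]) (use solution_cont y p in blast)+
  finally show ?thesis .
qed

text \<open>The sum includes \<open>n\<close> because \<open>t\<close> may lie anywhere in its
  piece; this is why the Gronwall lemma admits the index \<open>n\<close> on its right-hand
  side.\<close>

lemma W_bound:
  assumes y: "solution z y y'" and p: "solution \<zeta> p p'" and z: "cmod (z - \<zeta>) \<le> 1" and t: "t \<in> piece n"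
  shows "cmod (W y y' p p' n t) \<le> cmod (W y y' p p' 0 0) + (\<Sum>k\<le>n. piece_norm p k * piece_norm y k)"
  using t
proof (induction n arbitrary: t)
  case 0
  have "cmod (W y y' p p' 0 t) \<le> cmod (W y y' p p' 0 (x 0)) + cmod (W y y' p p' 0 t - W y y' p p' 0 (x 0))"
    by (rule norm_triangle_sub)
  then show ?case using W_increment[OF y p z 0] x0 by simp
next
  case (Suc n)
  have "cmod (W y y' p p' (Suc n) t) \<le> cmod (W y y' p p' (Suc n) (x (Suc n)))
      + cmod (W y y' p p' (Suc n) t - W y y' p p' (Suc n) (x (Suc n)))"
    by (rule norm_triangle_sub)
  then show ?case
    using W_increment[OF y p z Suc.prems] Suc.IH[of "x (Suc n)"] x_less[of n] W_match[OF y p, of n] by simp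
qed

text \<open>Counterpart of \<open>jacobi_all_l2\<close>: the same identity bounds \<open>y\<close>
  pointwise, and norms over a piece turn this into an inequality for sequences. The Wronskian is
  bounded below only from piece 1 on, since for a solution and its conjugate with the Neumann
  condition it starts at 0.\<close>

lemma solution_L2_transfer:
  assumes y: "solution z y y'" and p: "solution \<zeta> p p'" and z: "cmod (z - \<zeta>) \<le> 1"
    and q: "solution \<eta> q q'" and z': "cmod (z - \<eta>) \<le> 1"
    and W: "\<kappa> > 0" "\<And>n t. n \<ge> 1 \<Longrightarrow> t \<in> piece n \<Longrightarrow> cmod (W p p' q q' n t) \<ge> \<kappa>"
    and L2: "glue p \<in> L2 L" "glue q \<in> L2 L"
  shows "glue y \<in> L2 L"
proof -
  note cy = solution_cont(1)[OF y] and cp = solution_cont(1)[OF p] and cq = solution_cont(1)[OF q]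
  define Y where "Y = piece_norm y"
  define G where "G n = (1 + 1 / \<kappa>) * (piece_norm p n + piece_norm q n)" for n
  define C where "C = cmod (W y y' p p' 0 0) + cmod (W y y' q q' 0 0)"
  have Y0: "0 \<le> Y n" for n by (simp add: Y_def piece_norm_nonneg)
  have pq0: "0 \<le> piece_norm p n + piece_norm q n" for n using piece_norm_nonneg by (intro add_nonneg_nonneg)
  have Gpq: "piece_norm p n + piece_norm q n \<le> G n" for n
  proof -
    have "1 * (piece_norm p n + piece_norm q n) \<le> G n"
      unfolding G_def using W(1) pq0[of n] by (intro mult_right_mono) auto
    then show ?thesis by simp
  qed
  have G0: "0 \<le> G n" for n using pq0[of n] Gpq[of n] by linarith
  have step: "Y n \<le> G n * (C + (\<Sum>k\<le>n. G k * Y k))" if n: "n \<ge> 1" for n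
  proof -
    define R where "R = C + (\<Sum>k\<le>n. G k * Y k)"
    have bW: "cmod (W y y' r r' n t) \<le> R"
      if "cmod (W y y' r r' n t) \<le> cmod (W y y' r r' 0 0) + (\<Sum>k\<le>n. piece_norm r k * piece_norm y k)"
        "cmod (W y y' r r' 0 0) \<le> C" "\<And>n. piece_norm r n \<le> G n" for r r' t
    proof -
      have "(\<Sum>k\<le>n. piece_norm r k * piece_norm y k) \<le> (\<Sum>k\<le>n. G k * Y k)"
        unfolding Y_def using that(3) by (intro sum_mono mult_right_mono piece_norm_nonneg)
      then show ?thesis using that by (simp add: R_def)
    qed
    have cpq: "piece_norm p n \<le> G n" "piece_norm q n \<le> G n" for n
      using Gpq[of n] piece_norm_nonneg[of p n] piece_norm_nonneg[of q n] by linarith+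
    have R0: "0 \<le> R" unfolding R_def C_def by (intro add_nonneg_nonneg sum_nonneg mult_nonneg_nonneg G0 Y0) auto
    have pw: "cmod (y n t) \<le> R / \<kappa> * (cmod (p n t) + cmod (q n t))" if t: "t \<in> piece n" for t
    proof -
      have Rp: "cmod (W y y' p p' n t) \<le> R"
        by (rule bW[OF W_bound[OF y p z t]]) (auto simp: C_def cpq)
      have Rq: "cmod (W y y' q q' n t) \<le> R"
        by (rule bW[OF W_bound[OF y q z' t]]) (auto simp: C_def cpq)
      have "\<kappa> * cmod (y n t) \<le> cmod (W p p' q q' n t) * cmod (y n t)"
        using W(2)[OF n t] by (intro mult_right_mono) auto
      also have "\<dots> = cmod (p n t * W y y' q q' n t - q n t * W y y' p p' n t)"
        unfolding norm_mult[symmetric] by (rule arg_cong[of _ _ cmod]) (simp add: W_def algebra_simps)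
      also have "\<dots> \<le> cmod (p n t) * cmod (W y y' q q' n t) + cmod (q n t) * cmod (W y y' p p' n t)"
        by (metis norm_mult norm_triangle_ineq4)
      also have "\<dots> \<le> cmod (p n t) * R + cmod (q n t) * R"
        by (intro add_mono mult_left_mono Rp Rq) auto
      finally show ?thesis using W(1) by (simp add: field_simps)
    qed
    let ?P = "lebesgue_on (piece n)"
    have abs_L2: "(\<lambda>t. complex_of_real (cmod (r n t))) \<in> L2 ?P" if "piecewise_cont r" for r
      using that by (intro continuous_on_L2_interval continuous_intros) (auto simp: piecewise_cont_def)
    have abs_norm: "L2_norm ?P (\<lambda>t. complex_of_real (cmod (r n t))) = piece_norm r n" for r
      by (simp add: L2_norm_def piece_norm_def)
    let ?s = "\<lambda>t. complex_of_real (cmod (p n t)) + complex_of_real (cmod (q n t))"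
    have sL: "?s \<in> L2 ?P" by (intro L2_add abs_L2 cp cq)
    have "Y n \<le> L2_norm ?P (\<lambda>t. of_real (R / \<kappa>) * ?s t)"
      unfolding Y_def piece_norm_def
    proof (rule L2_norm_mono[OF piece_L2[OF cy] L2_scale[OF sL]])
      fix t assume "t \<in> space ?P"
      then have "t \<in> piece n" by (simp add: space_restrict_space)
      then have "cmod (y n t) \<le> R / \<kappa> * (cmod (p n t) + cmod (q n t))" by (rule pw)
      also have "\<dots> = cmod (of_real (R / \<kappa>) * ?s t)"
        unfolding of_real_add[symmetric] norm_mult norm_of_real using R0 W(1) by simp
      finally show "cmod (y n t) \<le> cmod (of_real (R / \<kappa>) * ?s t)" .
    qed
    also have "\<dots> = R / \<kappa> * L2_norm ?P ?s"
      unfolding L2_norm_scale norm_of_real using R0 W(1) by simp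
    also have "\<dots> \<le> R / \<kappa> * (piece_norm p n + piece_norm q n)"
      using L2_norm_triangle[OF abs_L2[OF cp] abs_L2[OF cq]] R0 W(1) by (intro mult_left_mono) (simp_all add: abs_norm)
    also have "\<dots> = 1 / \<kappa> * (piece_norm p n + piece_norm q n) * R" by simp
    also have "\<dots> \<le> G n * R"
      unfolding G_def using R0 W(1) pq0[of n] by (intro mult_right_mono) auto
    finally show ?thesis by (simp add: R_def)
  qed
  have "summable (\<lambda>n. (Y (Suc n))\<^sup>2)"
  \<comment> \<open>The lower bound on the Wronskian is missing on piece 0, so the recursion starts
    at 1 and the term of piece 0 joins the constant.\<close>
  proof (rule summable_square_Gronwall[where G="\<lambda>n. G (Suc n)" and C="C + G 0 * Y 0"])
    have sum: "summable (\<lambda>n. 2 * ((piece_norm p n)\<^sup>2 + (piece_norm q n)\<^sup>2))"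
      using L2 glue_L2_iff[OF cp] glue_L2_iff[OF cq] by (intro summable_mult summable_add) auto
    have bnd: "norm ((piece_norm p n + piece_norm q n)\<^sup>2) \<le> 2 * ((piece_norm p n)\<^sup>2 + (piece_norm q n)\<^sup>2)" for n
    proof -
      have "(piece_norm p n + piece_norm q n)\<^sup>2 \<le> 2 * ((piece_norm p n)\<^sup>2 + (piece_norm q n)\<^sup>2)"
        using sum_squares_bound[of "piece_norm p n" "piece_norm q n"] by (simp add: power2_sum)
      then show ?thesis by (simp only: real_norm_def abs_power2)
    qed
    have "summable (\<lambda>n. (piece_norm p n + piece_norm q n)\<^sup>2)"
      by (rule summable_comparison_test'[OF sum, of 0]) (rule bnd)
    then have "summable (\<lambda>n. (G n)\<^sup>2)" unfolding G_def power_mult_distrib by (intro summable_mult)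
    then show "summable (\<lambda>n. (G (Suc n))\<^sup>2)" by (subst summable_Suc_iff)
    show "0 \<le> C + G 0 * Y 0" using G0[of 0] Y0[of 0] by (simp add: C_def)
    fix n
    have "(\<Sum>k\<le>Suc n. G k * Y k) = G 0 * Y 0 + (\<Sum>k\<le>n. G (Suc k) * Y (Suc k))" by (rule sum.atMost_Suc_shift)
    then show "Y (Suc n) \<le> G (Suc n) * (C + G 0 * Y 0 + (\<Sum>k\<le>n. G (Suc k) * Y (Suc k)))"
      using step[of "Suc n"] by (simp add: add.assoc)
  qed (auto simp: G0 Y0)
  then have "summable (\<lambda>n. (Y n)\<^sup>2)" by (subst (asm) summable_Suc_iff)
  then show ?thesis using glue_L2_iff[OF cy] by (simp add: Y_def)
qed

text \<open>The solutions at energy \<open>0\<close> are piecewise linear, with values \<open>f n\<close> at \<open>x n\<close> and slopes \<open>g n\<close> to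
  the right of \<open>x n\<close>.\<close>

definition zero_seq :: "(nat \<Rightarrow> complex) \<Rightarrow> (nat \<Rightarrow> complex) \<Rightarrow> bool" where
  "zero_seq f g \<longleftrightarrow> (\<forall>n. f (Suc n) = f n + of_real (x (Suc n) - x n) * g n \<and>
     g (Suc n) = g n + of_real (\<alpha> (Suc n)) * f (Suc n))"

definition linear_family :: "(nat \<Rightarrow> complex) \<Rightarrow> (nat \<Rightarrow> complex) \<Rightarrow> nat \<Rightarrow> real \<Rightarrow> complex" where
  "linear_family f g n t = f n + of_real (t - x n) * g n"

lemma zero_seq_exists: obtains f g where "zero_seq f g" "f 0 = a" "g 0 = p"
proof -
  define step where "step n c = (let a' = fst c + of_real (x (Suc n) - x n) * snd c in
    (a', snd c + of_real (\<alpha> (Suc n)) * a'))" for n and c :: "complex \<times> complex"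
  define c where "c = rec_nat (a, p) step"
  have "c 0 = (a, p)" "\<And>n. c (Suc n) = step n (c n)" by (simp_all add: c_def)
  then have "zero_seq (\<lambda>n. fst (c n)) (\<lambda>n. snd (c n))" "fst (c 0) = a" "snd (c 0) = p"
    by (auto simp: zero_seq_def step_def Let_def)
  then show thesis by (rule that)
qed

lemma linear_family_solution:
  assumes "zero_seq f g" shows "solution 0 (linear_family f g) (\<lambda>n t. g n)"
proof -
  have "((\<lambda>t. f n + of_real (t - x n) * g n) has_vector_derivative g n) (at t within A)" for n t A
    unfolding of_real_diff
    by (auto intro!: derivative_eq_intros simp: has_vector_derivative_def scaleR_conv_of_real)
  then have "piecewise_deriv (linear_family f g) (\<lambda>n t. g n)"
    unfolding piecewise_deriv_def linear_family_def[abs_def] by blast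
  moreover have "piecewise_deriv (\<lambda>n t. g n) (\<lambda>n t. - 0 * linear_family f g n t)"
    by (simp add: piecewise_deriv_def)
  moreover have "matched (linear_family f g) (\<lambda>n t. g n)"
    using assms by (simp add: matched_def linear_family_def zero_seq_def)
  ultimately show ?thesis by (simp add: solution_def)
qed

text \<open>To energy 0 the comparison pair is \<open>\<phi>\<close> and its conjugate, at energies
  \<i> and -\<i>; back to \<i> it is a pair of piecewise linear solutions with Wronskian 1.\<close>

lemma solution_i_L2_iff:
  assumes \<phi>: "solution \<i> \<phi> \<phi>'" "\<phi> 0 0 = 1" "\<phi>' 0 0 = 0"
  shows "glue \<phi> \<in> L2 L \<longleftrightarrow> (\<forall>f g. zero_seq f g \<longrightarrow> glue (linear_family f g) \<in> L2 L)"
proof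
  assume L2: "glue \<phi> \<in> L2 L"
  define q where "q n t = cnj (\<phi> n t)" for n t
  define q' where "q' n t = cnj (\<phi>' n t)" for n t
  have q: "solution (- \<i>) q q'" using solution_cnj[OF \<phi>(1)] by (simp add: q_def[abs_def] q'_def[abs_def])
  have "glue q = (\<lambda>t. cnj (glue \<phi> t))" by (simp add: glue_def[abs_def] q_def)
  then have qL2: "glue q \<in> L2 L" using L2_cnj[OF L2] by simp
  let ?h = "\<lambda>n t. (cmod (\<phi> n t))\<^sup>2"
  have hc: "continuous_on (piece n) (?h n)" for n
    using solution_cont(1)[OF \<phi>(1)] by (auto simp: piecewise_cont_def intro!: continuous_intros)
  have inc: "W \<phi> \<phi>' q q' n t = W \<phi> \<phi>' q q' n (x n) + 2 * \<i> * of_real (integral {x n..t} (?h n))"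
    if t: "t \<in> piece n" for n t
  proof -
    have int: "?h n integrable_on {x n..t}"
      using t by (intro integrable_on_subinterval[OF integrable_continuous_real[OF hc[of n]]]) auto
    have this': "((\<lambda>t. complex_of_real (?h n t)) has_integral of_real (integral {x n..t} (?h n))) {x n..t}"
      by (rule has_integral_of_real[OF integrable_integral[OF int]])
    have qeq: "\<phi> n s * q n s = complex_of_real (?h n s)" for s
      unfolding q_def by (rule complex_norm_square[symmetric])
    have two: "\<i> - - \<i> = 2 * \<i>" by simp
    from has_integral_mult_right[OF this', of "2 * \<i>"]
    have "((\<lambda>t. (\<i> - - \<i>) * (\<phi> n t * q n t)) has_integral 2 * \<i> * of_real (integral {x n..t} (?h n))) {x n..t}"
      unfolding qeq two .
    from has_integral_unique[OF W_diff[OF \<phi>(1) q t] this] show ?thesis by (simp add: algebra_simps)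
  qed
  \<comment> \<open>The Wronskian is 2 \<i> times the integral of |\<phi>|^2 from 0 on, hence of
    modulus at least \<kappa> once the first piece is passed; \<kappa> is positive because
    \<open>\<phi> 0 0 = 1\<close>.\<close>
  define \<kappa> where "\<kappa> = integral (piece 0) (?h 0)"
  have \<kappa>: "\<kappa> > 0"
  proof -
    have "x 0 \<in> piece 0" "?h 0 (x 0) \<noteq> 0" using \<phi>(2) x0 x_nonneg[of 1] by auto
    then have "\<kappa> \<noteq> 0" unfolding \<kappa>_def using integral_eq_0_iff[OF hc[of 0] x_less] by auto
    moreover have "\<kappa> \<ge> 0" unfolding \<kappa>_def
      by (rule Henstock_Kurzweil_Integration.integral_nonneg[OF integrable_continuous_real[OF hc]]) simp
    ultimately show ?thesis by simp
  qed
  have W0: "W \<phi> \<phi>' q q' 0 (x 0) = 0" using \<phi>(2,3) x0 by (simp add: W_def q_def q'_def)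
  have pos: "0 \<le> integral {x n..t} (?h n)" if "t \<in> piece n" for n t
    using that by (intro Henstock_Kurzweil_Integration.integral_nonneg
      integrable_on_subinterval[OF integrable_continuous_real[OF hc[of n]]]) auto
  have node: "\<exists>r\<ge>\<kappa>. W \<phi> \<phi>' q q' (Suc n) (x (Suc n)) = 2 * \<i> * of_real r" for n
  proof (induction n)
    case 0
    have "W \<phi> \<phi>' q q' (Suc 0) (x (Suc 0)) = 2 * \<i> * of_real \<kappa>"
      using W_match[OF \<phi>(1) q, of 0] inc[of "x (Suc 0)" 0] W0 x_less[of 0] by (simp add: \<kappa>_def)
    then show ?case by blast
  next
    case (Suc n)
    then obtain r where r: "r \<ge> \<kappa>" "W \<phi> \<phi>' q q' (Suc n) (x (Suc n)) = 2 * \<i> * of_real r" by blast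
    have m: "x (Suc (Suc n)) \<in> piece (Suc n)" using x_less[of "Suc n"] by simp
    have "W \<phi> \<phi>' q q' (Suc (Suc n)) (x (Suc (Suc n))) = W \<phi> \<phi>' q q' (Suc n) (x (Suc (Suc n)))"
      by (rule W_match[OF \<phi>(1) q])
    also have "\<dots> = 2 * \<i> * of_real r + 2 * \<i> * of_real (integral {x (Suc n)..x (Suc (Suc n))} (?h (Suc n)))"
      unfolding r(2)[symmetric] by (rule inc[OF m])
    also have "\<dots> = 2 * \<i> * of_real (r + integral {x (Suc n)..x (Suc (Suc n))} (?h (Suc n)))"
      by (simp add: algebra_simps)
    finally have "W \<phi> \<phi>' q q' (Suc (Suc n)) (x (Suc (Suc n)))
        = 2 * \<i> * of_real (r + integral {x (Suc n)..x (Suc (Suc n))} (?h (Suc n)))" .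
    moreover have "r + integral {x (Suc n)..x (Suc (Suc n))} (?h (Suc n)) \<ge> \<kappa>" using r(1) pos[OF m] by linarith
    ultimately show ?case by blast
  qed
  have Wlow: "cmod (W \<phi> \<phi>' q q' n t) \<ge> \<kappa>" if n: "n \<ge> 1" and t: "t \<in> piece n" for n t
  proof -
    obtain m where m: "n = Suc m" using n by (cases n) auto
    obtain r where r: "r \<ge> \<kappa>" "W \<phi> \<phi>' q q' n (x n) = 2 * \<i> * of_real r"
      using node[of m] unfolding m[symmetric] by blast
    have "W \<phi> \<phi>' q q' n t = 2 * \<i> * of_real (r + integral {x n..t} (?h n))"
      unfolding inc[OF t] r(2) by (simp add: algebra_simps)
    then have "cmod (W \<phi> \<phi>' q q' n t) = 2 * \<bar>r + integral {x n..t} (?h n)\<bar>"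
      by (simp only: norm_mult norm_of_real) simp
    moreover define J where "J = integral {x n..t} (?h n)"
    ultimately have "cmod (W \<phi> \<phi>' q q' n t) = 2 * \<bar>r + J\<bar>" by simp
    moreover have "0 \<le> J" unfolding J_def by (rule pos[OF t])
    ultimately show ?thesis using r(1) \<kappa> by simp
  qed
  show "\<forall>f g. zero_seq f g \<longrightarrow> glue (linear_family f g) \<in> L2 L"
  proof (intro allI impI)
    fix f g assume "zero_seq f g"
    from linear_family_solution[OF this] show "glue (linear_family f g) \<in> L2 L"
      by (rule solution_L2_transfer[OF _ \<phi>(1) _ q _ \<kappa> Wlow L2 qL2]) auto
  qed
next
  assume all: "\<forall>f g. zero_seq f g \<longrightarrow> glue (linear_family f g) \<in> L2 L"
  obtain f g where fg: "zero_seq f g" "f 0 = 1" "g 0 = 0" by (rule zero_seq_exists)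
  obtain f' g' where fg': "zero_seq f' g'" "f' 0 = 0" "g' 0 = 1" by (rule zero_seq_exists)
  note s = linear_family_solution[OF fg(1)] and s' = linear_family_solution[OF fg'(1)]
  have "cmod (W (linear_family f g) (\<lambda>n t. g n) (linear_family f' g') (\<lambda>n t. g' n) n t) \<ge> 1" if "t \<in> piece n" for n t
    unfolding W_const[OF s s' that] using fg(2,3) fg'(2,3) x0 by (simp add: W_def linear_family_def)
  then show "glue \<phi> \<in> L2 L"
    using all fg(1) fg'(1) by (intro solution_L2_transfer[OF \<phi>(1) s _ s', where \<kappa>=1]) auto
qed

text \<open>Expressed by the values at both ends and without the slope, the form in which
  neighbouring pieces and matrix entries can be compared.\<close>

lemma piece_norm_linear:
  assumes b: "c = f n + of_real d * g n" and d: "d = x (Suc n) - x n"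
  shows "(piece_norm (linear_family f g) n)\<^sup>2 = d / 3 * ((cmod (f n))\<^sup>2 + Re (f n * cnj c) + (cmod c)\<^sup>2)"
proof -
  define F where "F t = (cmod (f n))\<^sup>2 * (t - x n) + Re (f n * cnj (g n)) * (t - x n)^2 + (cmod (g n))\<^sup>2 * (t - x n)^3 / 3" for t
  have eq: "(cmod (linear_family f g n t))\<^sup>2
      = (cmod (f n))\<^sup>2 + 2 * Re (f n * cnj (g n)) * (t - x n) + (cmod (g n))\<^sup>2 * (t - x n)^2" for t
    unfolding linear_family_def cmod_power2 by (simp add: power2_eq_square algebra_simps)
  have "((\<lambda>t. (cmod (linear_family f g n t))\<^sup>2) has_integral (F (x (Suc n)) - F (x n))) (piece n)"
  proof (rule fundamental_theorem_of_calculus)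
    fix t
    have "(F has_real_derivative (cmod (linear_family f g n t))\<^sup>2) (at t within piece n)"
      unfolding F_def[abs_def] eq by (auto intro!: derivative_eq_intros simp: power2_eq_square field_simps)
    then show "(F has_vector_derivative (cmod (linear_family f g n t))\<^sup>2) (at t within piece n)"
      by (simp add: has_real_derivative_iff_has_vector_derivative)
  qed (use x_less[of n] in simp)
  then have int: "integral (piece n) (\<lambda>t. (cmod (linear_family f g n t))\<^sup>2) = F (x (Suc n)) - F (x n)"
    by (rule integral_unique)
  have cont: "continuous_on (piece n) (\<lambda>t. (cmod (linear_family f g n t))\<^sup>2)"
    unfolding linear_family_def by (intro continuous_intros)
  have "(piece_norm (linear_family f g) n)\<^sup>2 = F (x (Suc n)) - F (x n)"
    unfolding piece_norm_def L2_norm_sq int[symmetric]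
    by (intro lebesgue_integral_eq_integral continuous_imp_integrable_real cont) auto
  also have "\<dots> = d / 3 * ((cmod (f n))\<^sup>2 + Re (f n * cnj c) + (cmod c)\<^sup>2)"
    unfolding F_def d[symmetric] b cmod_power2 by (simp add: power2_eq_square power3_eq_cube algebra_simps add_divide_distrib)
  finally show ?thesis .
qed

text \<open>Weyl's limit circle case at energy 0, stated through the values at the points
  \<open>x n\<close> alone. All three operators are compared with this condition, none directly with
  another.\<close>

definition limit_circle :: bool where
  "limit_circle \<longleftrightarrow> (\<forall>f g. zero_seq f g \<longrightarrow>
     summable (\<lambda>n. (x (Suc n) - x n) * ((cmod (f n))\<^sup>2 + (cmod (f (Suc n)))\<^sup>2)))"

text \<open>The exact norm has the factor d/3, and the mixed term changes the sum of squares by a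
  factor between 1/2 and 3; hence the constants 1 and 6.\<close>

lemma linear_family_L2_iff:
  assumes fg: "zero_seq f g"
  shows "glue (linear_family f g) \<in> L2 L
    \<longleftrightarrow> summable (\<lambda>n. (x (Suc n) - x n) * ((cmod (f n))\<^sup>2 + (cmod (f (Suc n)))\<^sup>2))"
proof -
  let ?Y = "\<lambda>n. (piece_norm (linear_family f g) n)\<^sup>2"
  let ?Z = "\<lambda>n. (x (Suc n) - x n) * ((cmod (f n))\<^sup>2 + (cmod (f (Suc n)))\<^sup>2)"
  have bounds: "?Y n \<le> ?Z n" "?Z n \<le> 6 * ?Y n" for n
  proof -
    let ?d = "x (Suc n) - x n"
    have d: "?d > 0" using x_less[of n] by simp
    have Y: "?Y n = ?d / 3 * ((cmod (f n))\<^sup>2 + Re (f n * cnj (f (Suc n))) + (cmod (f (Suc n)))\<^sup>2)"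
      using fg by (intro piece_norm_linear) (auto simp: zero_seq_def)
    have "\<bar>Re (f n * cnj (f (Suc n)))\<bar> \<le> cmod (f n) * cmod (f (Suc n))"
      using abs_Re_le_cmod[of "f n * cnj (f (Suc n))"] by (simp add: norm_mult)
    also have "\<dots> \<le> ((cmod (f n))\<^sup>2 + (cmod (f (Suc n)))\<^sup>2) / 2"
      using sum_squares_bound[of "cmod (f n)" "cmod (f (Suc n))"] by simp
    finally have r: "\<bar>Re (f n * cnj (f (Suc n)))\<bar> \<le> ((cmod (f n))\<^sup>2 + (cmod (f (Suc n)))\<^sup>2) / 2" .
    define \<rho> where "\<rho> = Re (f n * cnj (f (Suc n)))"
    note Y' = Y[folded \<rho>_def] and r' = r[folded \<rho>_def]
    have pos: "0 \<le> (cmod (f n))\<^sup>2" "0 \<le> (cmod (f (Suc n)))\<^sup>2" by auto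
    have "?Y n \<le> ?d / 3 * (3 * ((cmod (f n))\<^sup>2 + (cmod (f (Suc n)))\<^sup>2))"
      unfolding Y'
    proof (rule mult_left_mono)
      show "(cmod (f n))\<^sup>2 + \<rho> + (cmod (f (Suc n)))\<^sup>2 \<le> 3 * ((cmod (f n))\<^sup>2 + (cmod (f (Suc n)))\<^sup>2)"
        by (rule middle_bounds[OF r' pos])
    qed (use d in simp)
    also have "\<dots> = ?Z n" by simp
    finally show "?Y n \<le> ?Z n" .
    have "?d / 3 * (1/2 * ((cmod (f n))\<^sup>2 + (cmod (f (Suc n)))\<^sup>2)) \<le> ?Y n"
      unfolding Y'
    proof (rule mult_left_mono)
      show "1/2 * ((cmod (f n))\<^sup>2 + (cmod (f (Suc n)))\<^sup>2) \<le> (cmod (f n))\<^sup>2 + \<rho> + (cmod (f (Suc n)))\<^sup>2"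
        by (rule middle_bounds[OF r' pos])
    qed (use d in simp)
    then show "?Z n \<le> 6 * ?Y n" by simp
  qed
  have Z0: "0 \<le> ?Z n" for n using x_less[of n] by simp
  have "summable ?Y \<longleftrightarrow> summable ?Z"
  proof
    assume "summable ?Y"
    then have sum: "summable (\<lambda>n. 6 * ?Y n)" by (rule summable_mult)
    show "summable ?Z"
      by (rule summable_comparison_test'[OF sum, of 0]) (simp only: real_norm_def abs_of_nonneg[OF Z0] bounds(2))
  next
    assume sum: "summable ?Z"
    show "summable ?Y"
      by (rule summable_comparison_test'[OF sum, of 0]) (simp only: real_norm_def abs_power2 bounds(1))
  qed
  then show ?thesis using glue_L2_iff[OF solution_cont(1)[OF linear_family_solution[OF fg]]] by simp
qed

theorem H_deficiency:
  "n_plus L (H_op b x \<alpha>) = (if limit_circle then 1 else 0)"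
  "n_minus L (H_op b x \<alpha>) = (if limit_circle then 1 else 0)"
  "op_selfadjoint L (H_op b x \<alpha>) \<longleftrightarrow> \<not> limit_circle"
proof -
  obtain \<phi> \<phi>' where \<phi>: "solution \<i> \<phi> \<phi>'" "\<phi> 0 0 = 1" "\<phi>' 0 0 = 0" by (rule solution_exists)
  note c = solution_cont(1)[OF \<phi>(1)]
  have lc: "glue \<phi> \<in> L2 L \<longleftrightarrow> limit_circle"
    unfolding solution_i_L2_iff[OF \<phi>] limit_circle_def using linear_family_L2_iff by blast
  have nz: "\<not> (AE t in L. glue \<phi> t = 0)"
  proof
    assume "AE t in L. glue \<phi> t = 0"
    moreover have "{0..x 1} \<in> sets lebesgue" by simp
    ultimately have "AE t in M 1. glue \<phi> t = 0"
      using I_sets interval_in_I[of 1] by (simp only: AE_lebesgue_on_iff) blast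
    then show False using glue_not_AE_zero[OF c \<phi>(2)] by blast
  qed
  have eig': "op_eigenspace (op_adjoint L H0) (- \<i>) = {f \<in> L2 L. \<exists>c. AE t in L. f t = c * cnj (glue \<phi> t)}"
    using eigenspace_H0[OF solution_cnj[OF \<phi>(1)]] \<phi>(2,3) by (simp add: glue_def)
  note D = deficiency_dichotomy[OF H0_subspace H0_symmetric glue_measurable[OF c] nz eigenspace_H0[OF \<phi>] eig']
  note D' = D[folded H_op_eq, unfolded lc]
  show "n_plus L (H_op b x \<alpha>) = (if limit_circle then 1 else 0)" by (rule D'(1))
  show "n_minus L (H_op b x \<alpha>) = (if limit_circle then 1 else 0)" by (rule D'(2))
  show "op_selfadjoint L (H_op b x \<alpha>) \<longleftrightarrow> \<not> limit_circle" by (rule D'(3))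
qed

end


section \<open>The Jacobi matrices\<close>

text \<open>For \<open>B2\<close>, whose sequences hold a value and a slope in neighbouring
  entries.\<close>

lemma summable_pairs:
  fixes a :: "nat \<Rightarrow> real"
  assumes a: "\<And>n. 0 \<le> a n"
  shows "summable a \<longleftrightarrow> summable (\<lambda>n. a (2 * n) + a (2 * n + 1))" (is "_ \<longleftrightarrow> summable ?p")
proof
  have eq: "(\<Sum>k<2 * N. a k) = (\<Sum>n<N. ?p n)" for N by (induction N) auto
  {
    assume sum: "summable a"
    show "summable ?p"
    proof (rule summableI_nonneg_bounded)
      fix N
      show "(\<Sum>n<N. ?p n) \<le> suminf a" unfolding eq[symmetric] using a by (intro sum_le_suminf sum) auto
    qed (use a in auto)
  next
    assume sum: "summable ?p"
    show "summable a"
    proof (rule summableI_nonneg_bounded[OF a])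
      fix N
      have "(\<Sum>k<N. a k) \<le> (\<Sum>k<2 * N. a k)" using a by (intro sum_mono2) auto
      also have "\<dots> \<le> suminf ?p" unfolding eq using a by (intro sum_le_suminf sum) auto
      finally show "(\<Sum>k<N. a k) \<le> suminf ?p" .
    qed
  }
qed

lemma summable_bound:
  fixes a c :: "nat \<Rightarrow> real"
  assumes "summable c" "\<And>n. 0 \<le> a n" "\<And>n. a n \<le> c n" shows "summable a"
  by (rule summable_comparison_test'[OF assms(1), of 0]) (simp only: real_norm_def abs_of_nonneg[OF assms(2)] assms(3))

lemma triple_bound: "s \<le> 2 * c + 2 * a \<Longrightarrow> 0 \<le> a \<Longrightarrow> 0 \<le> c \<Longrightarrow> a + s \<le> 3 * (a + c)" for a c s :: real
  by simp

context point_interactions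
begin

section \<open>The matrix \<open>B1\<close>\<close>

abbreviation \<delta> :: "nat \<Rightarrow> real" where "\<delta> n \<equiv> x (Suc n) - x n"

lemma gap_Suc: "gap x (Suc n) = \<delta> n"
  by (simp add: gap_def)

lemma \<delta>_pos: "\<delta> n > 0"
  using x_less[of n] by simp

lemma rr_Suc: "rr x (Suc n) = sqrt (\<delta> n + \<delta> (Suc n))"
  by (simp add: rr_def gap_def)

lemma rr_pos: "rr x (Suc n) > 0"
  unfolding rr_Suc using \<delta>_pos[of n] \<delta>_pos[of "Suc n"] by (simp add: add_pos_pos)

lemma rr_sq: "(rr x (Suc n))\<^sup>2 = \<delta> n + \<delta> (Suc n)"
  unfolding rr_Suc using \<delta>_pos[of n] \<delta>_pos[of "Suc n"] by simp

abbreviation "u1 \<equiv> \<lambda>n. (\<alpha> n + 1 / gap x n + 1 / gap x (n + 1)) / (rr x n)\<^sup>2"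
abbreviation "v1 \<equiv> \<lambda>n. - 1 / (rr x n * rr x (n + 1) * gap x (n + 1))"

text \<open>Up to the weight, a row is the jump of the slope at a point of \<open>X\<close> minus
  the jump prescribed there, for \<open>f\<close> linear between the points.\<close>

lemma B1_row:
  "jacobi_row u1 v1 (\<lambda>n. of_real (rr x n) * f n) (Suc (Suc n))
    = - of_real (1 / rr x (Suc (Suc n))) * ((f (Suc (Suc (Suc n))) - f (Suc (Suc n))) / of_real (\<delta> (Suc (Suc n)))
        - (f (Suc (Suc n)) - f (Suc n)) / of_real (\<delta> (Suc n)) - of_real (\<alpha> (Suc (Suc n))) * f (Suc (Suc n)))"
proof -
  define r1 r2 r3 where r: "r1 = rr x (Suc n)" "r2 = rr x (Suc (Suc n))" "r3 = rr x (Suc (Suc (Suc n)))"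
  define p q where d: "p = \<delta> (Suc n)" "q = \<delta> (Suc (Suc n))"
  have nz: "r1 \<noteq> 0" "r2 \<noteq> 0" "r3 \<noteq> 0" "p \<noteq> 0" "q \<noteq> 0"
    using rr_pos[of n] rr_pos[of "Suc n"] rr_pos[of "Suc (Suc n)"] \<delta>_pos[of "Suc n"] \<delta>_pos[of "Suc (Suc n)"]
    by (auto simp: r d)
  define A where "A = \<alpha> (Suc (Suc n))"
  have "jacobi_row u1 v1 (\<lambda>n. of_real (rr x n) * f n) (Suc (Suc n))
      = of_real (- 1 / (r1 * r2 * p)) * (of_real r1 * f (Suc n))
        + of_real ((A + 1 / p + 1 / q) / r2\<^sup>2) * (of_real r2 * f (Suc (Suc n)))
        + of_real (- 1 / (r2 * r3 * q)) * (of_real r3 * f (Suc (Suc (Suc n))))"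
    by (simp add: jacobi_row_def gap_Suc r d A_def)
  also have "\<dots> = of_real (- 1 / (r1 * r2 * p) * r1) * f (Suc n) + of_real ((A + 1 / p + 1 / q) / r2\<^sup>2 * r2) * f (Suc (Suc n))
        + of_real (- 1 / (r2 * r3 * q) * r3) * f (Suc (Suc (Suc n)))"
    by (simp only: of_real_mult mult.assoc)
  also have "- 1 / (r1 * r2 * p) * r1 = - (1 / r2) * (1 / p)" using nz by (simp add: field_simps)
  also have "(A + 1 / p + 1 / q) / r2\<^sup>2 * r2 = - (1 / r2) * (- A - 1 / p - 1 / q)"
    using nz by (simp add: field_simps power2_eq_square)
  also have "- 1 / (r2 * r3 * q) * r3 = - (1 / r2) * (1 / q)" using nz by (simp add: field_simps)
  also have "of_real (- (1 / r2) * (1 / p)) * f (Suc n) + of_real (- (1 / r2) * (- A - 1 / p - 1 / q)) * f (Suc (Suc n))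
        + of_real (- (1 / r2) * (1 / q)) * f (Suc (Suc (Suc n)))
      = - of_real (1 / r2) * ((f (Suc (Suc (Suc n))) - f (Suc (Suc n))) / of_real q
        - (f (Suc (Suc n)) - f (Suc n)) / of_real p - of_real A * f (Suc (Suc n)))"
    by (simp add: diff_divide_distrib algebra_simps)
  finally show ?thesis by (simp only: r d A_def)
qed

text \<open>The entries are \<open>rr x n * f n\<close>. The square of the weight is the sum of the
  lengths of the two adjacent pieces, so the l2 norm is a regrouping of the sum in
  \<open>limit_circle\<close>, apart from the contribution of \<open>f 0\<close>.\<close>

lemma B1_limit_circle:
  "(\<forall>y. (\<forall>n\<ge>2. jacobi_row u1 v1 y n = 0) \<longrightarrow> y \<in> L2 l2_measure) \<longleftrightarrow> limit_circle"
proof -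
  let ?Z = "\<lambda>f n. \<delta> n * ((cmod (f n))\<^sup>2 + (cmod (f (Suc n)))\<^sup>2)"
  have norm_y: "(cmod (of_real (rr x (Suc n)) * f (Suc n)))\<^sup>2 = (\<delta> n + \<delta> (Suc n)) * (cmod (f (Suc n)))\<^sup>2" for f n
    unfolding norm_mult power_mult_distrib norm_of_real power2_abs rr_sq ..
  have l2: "(\<lambda>n. of_real (rr x n) * f n) \<in> L2 l2_measure \<longleftrightarrow> summable (?Z f)" for f
  proof
    assume "(\<lambda>n. of_real (rr x n) * f n) \<in> L2 l2_measure"
    then have s: "summable (\<lambda>n. (cmod (of_real (rr x (Suc n)) * f (Suc n)))\<^sup>2)"
      unfolding L2_l2_iff by (subst summable_Suc_iff)
    then have s': "summable (\<lambda>n. (cmod (of_real (rr x (Suc (Suc n))) * f (Suc (Suc n))))\<^sup>2)"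
      by (subst summable_Suc_iff)
    \<comment> \<open>The sequence carries no information on \<open>f 0\<close>; the shift drops the
      only term that contains it.\<close>
    have "summable (\<lambda>n. ?Z f (Suc n))"
    proof (rule summable_bound[OF summable_add[OF s s']])
      fix n
      have "\<delta> (Suc n) * (cmod (f (Suc n)))\<^sup>2 \<le> (\<delta> n + \<delta> (Suc n)) * (cmod (f (Suc n)))\<^sup>2"
        "\<delta> (Suc n) * (cmod (f (Suc (Suc n))))\<^sup>2 \<le> (\<delta> (Suc n) + \<delta> (Suc (Suc n))) * (cmod (f (Suc (Suc n))))\<^sup>2"
        using \<delta>_pos[of n] \<delta>_pos[of "Suc (Suc n)"] by (intro mult_right_mono; simp)+
      then show "?Z f (Suc n) \<le> (cmod (of_real (rr x (Suc n)) * f (Suc n)))\<^sup>2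
          + (cmod (of_real (rr x (Suc (Suc n))) * f (Suc (Suc n))))\<^sup>2"
        unfolding norm_y distrib_left by (rule add_mono)
      show "0 \<le> ?Z f (Suc n)" using \<delta>_pos[of "Suc n"] by simp
    qed
    then show "summable (?Z f)" by (subst (asm) summable_Suc_iff)
  next
    assume s: "summable (?Z f)"
    then have s': "summable (\<lambda>n. ?Z f (Suc n))" by (subst summable_Suc_iff)
    have "summable (\<lambda>n. (cmod (of_real (rr x (Suc n)) * f (Suc n)))\<^sup>2)"
    proof (rule summable_bound[OF summable_add[OF s s']])
      fix n
      have "\<delta> n * (cmod (f (Suc n)))\<^sup>2 \<le> ?Z f n" "\<delta> (Suc n) * (cmod (f (Suc n)))\<^sup>2 \<le> ?Z f (Suc n)"
        using \<delta>_pos[of n] \<delta>_pos[of "Suc n"] by (intro mult_left_mono; simp)+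
      then show "(cmod (of_real (rr x (Suc n)) * f (Suc n)))\<^sup>2 \<le> ?Z f n + ?Z f (Suc n)"
        unfolding norm_y distrib_right by (rule add_mono)
    qed simp
    then show "(\<lambda>n. of_real (rr x n) * f n) \<in> L2 l2_measure"
      unfolding L2_l2_iff by (subst (asm) summable_Suc_iff)
  qed
  show ?thesis
  proof
    assume all: "\<forall>y. (\<forall>n\<ge>2. jacobi_row u1 v1 y n = 0) \<longrightarrow> y \<in> L2 l2_measure"
    show limit_circle unfolding limit_circle_def
    proof (intro allI impI)
      fix f g assume fg: "zero_seq f g"
      have slope: "(f (Suc n) - f n) / of_real (\<delta> n) = g n" for n
        using fg \<delta>_pos[of n] by (simp add: zero_seq_def)
      have "jacobi_row u1 v1 (\<lambda>n. of_real (rr x n) * f n) n = 0" if n: "n \<ge> 2" for n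
      proof -
        obtain m where m: "n = Suc (Suc m)" using n by (metis add_2_eq_Suc le_Suc_ex)
        have "g (Suc (Suc m)) - g (Suc m) - of_real (\<alpha> (Suc (Suc m))) * f (Suc (Suc m)) = 0"
          using fg by (simp add: zero_seq_def)
        then show ?thesis unfolding m B1_row slope by simp
      qed
      then have "(\<lambda>n. of_real (rr x n) * f n) \<in> L2 l2_measure" using all by blast
      then show "summable (?Z f)" by (simp only: l2)
    qed
  next
    assume lc: limit_circle
    show "\<forall>y. (\<forall>n\<ge>2. jacobi_row u1 v1 y n = 0) \<longrightarrow> y \<in> L2 l2_measure"
    proof (intro allI impI)
      fix y assume rows: "\<forall>n\<ge>2. jacobi_row u1 v1 y n = 0"
      define F where "F n = y n / of_real (rr x n)" for n
      \<comment> \<open>The rows from 2 on say nothing about the jump at \<open>x 1\<close>. The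
        slope on the first piece is chosen to make that condition true, and \<open>f 0\<close> is
        found by extrapolating to the left.\<close>
      define g0 where "g0 = (F 2 - F 1) / of_real (\<delta> 1) - of_real (\<alpha> 1) * F 1"
      define f where "f n = (if n = 0 then F 1 - of_real (\<delta> 0) * g0 else F n)" for n
      define g where "g n = (f (Suc n) - f n) / of_real (\<delta> n)" for n
      have fy: "of_real (rr x (Suc n)) * f (Suc n) = y (Suc n)" for n
        using rr_pos[of n] by (simp add: f_def F_def)
      have "g (Suc n) = g n + of_real (\<alpha> (Suc n)) * f (Suc n)" for n
      proof (cases n)
        case 0
        have "g 0 = g0" using \<delta>_pos[of 0] by (simp add: g_def f_def)
        then show ?thesis using 0 by (simp add: g_def f_def g0_def numeral_2_eq_2)
      next
        case (Suc m)
        have eq: "jacobi_row u1 v1 (\<lambda>n. of_real (rr x n) * f n) (Suc (Suc m)) = jacobi_row u1 v1 y (Suc (Suc m))"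
          using fy by (simp add: jacobi_row_def)
        have "jacobi_row u1 v1 y (Suc (Suc m)) = 0" using rows by simp
        then have "g (Suc (Suc m)) - g (Suc m) - of_real (\<alpha> (Suc (Suc m))) * f (Suc (Suc m)) = 0"
          unfolding eq[symmetric] B1_row g_def using rr_pos[of "Suc m"] by simp
        then show ?thesis using Suc by (simp add: algebra_simps)
      qed
      moreover have "f (Suc n) = f n + of_real (\<delta> n) * g n" for n
      proof -
        have "of_real (\<delta> n) \<noteq> (0::complex)" using \<delta>_pos[of n] by (simp only: of_real_eq_0_iff)
        then show ?thesis by (simp add: g_def)
      qed
      ultimately have "zero_seq f g" by (simp add: zero_seq_def)
      then have "(\<lambda>n. of_real (rr x n) * f n) \<in> L2 l2_measure" using lc by (simp only: l2 limit_circle_def)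
      then have "summable (\<lambda>n. (cmod (y (Suc n)))\<^sup>2)"
        unfolding L2_l2_iff by (subst (asm) summable_Suc_iff[symmetric]) (simp only: fy)
      then show "y \<in> L2 l2_measure" unfolding L2_l2_iff by (subst (asm) summable_Suc_iff)
    qed
  qed
qed

section \<open>The matrix \<open>B2\<close>\<close>

abbreviation "u2 \<equiv> \<lambda>k. if k = 1 then 0
    else if even k then - 1 / (gap x (k div 2))\<^sup>2 else \<alpha> (k div 2) / gap x (k div 2 + 1)"
abbreviation "v2 \<equiv> \<lambda>k. if odd k then - 1 / (gap x ((k + 1) div 2))\<^sup>2
    else gap x (k div 2) powr (- (3 / 2)) * gap x (k div 2 + 1) powr (- (1 / 2))"

text \<open>Turns the exponents -3/2 and -1/2 of the entries into integer powers.\<close>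

definition sd :: "nat \<Rightarrow> real" where "sd n = sqrt (\<delta> n)"

lemma sd_pos: "sd n > 0"
  using \<delta>_pos[of n] by (simp add: sd_def)

lemma sd_sq: "sd n ^ 2 = \<delta> n"
  using \<delta>_pos[of n] by (simp add: sd_def)

lemma gap_powr: "gap x (Suc n) powr (- (3 / 2)) = 1 / sd n ^ 3" "gap x (Suc n) powr (- (1 / 2)) = 1 / sd n"
proof -
  have g: "gap x (Suc n) = sd n powr 2" using sd_pos[of n] by (simp add: gap_Suc sd_sq)
  have "gap x (Suc n) powr (- (3 / 2)) = sd n powr - 3" unfolding g powr_powr by simp
  also have "\<dots> = 1 / sd n ^ 3" using sd_pos[of n] by (simp add: powr_minus divide_inverse)
  finally show "gap x (Suc n) powr (- (3 / 2)) = 1 / sd n ^ 3" .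
  have "gap x (Suc n) powr (- (1 / 2)) = sd n powr - 1" unfolding g powr_powr by simp
  also have "\<dots> = 1 / sd n" using sd_pos[of n] by (simp add: powr_minus divide_inverse)
  finally show "gap x (Suc n) powr (- (1 / 2)) = 1 / sd n" .
qed

text \<open>Entries of odd index hold the values \<open>f\<close>, those of even index the slopes
  \<open>g\<close>, with weights d^(1/2) and d^(3/2). Even rows then express linear growth along a
  piece.\<close>

lemma B2_row_even:
  assumes y: "y (2 * n + 1) = of_real (sd n) * f n" "y (2 * n + 2) = of_real (sd n ^ 3) * g n"
    "y (2 * n + 3) = of_real (sd (Suc n)) * f (Suc n)"
  shows "jacobi_row u2 v2 y (2 * n + 2) = of_real (1 / sd n ^ 3) * (f (Suc n) - f n - of_real (\<delta> n) * g n)"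
proof -
  define s t where st: "s = sd n" "t = sd (Suc n)"
  have nz: "s \<noteq> 0" "t \<noteq> 0" using sd_pos[of n] sd_pos[of "Suc n"] by (auto simp: st)
  have d: "\<delta> n = s^2" by (simp add: st sd_sq)
  have idx: "(2 * n + 2) div 2 = Suc n" "(2 * n + 2 - 1 + 1) div 2 = Suc n" "2 * n + 2 - 1 = 2 * n + 1" "2 * n + 2 + 1 = 2 * n + 3" by auto
  have "jacobi_row u2 v2 y (2 * n + 2) = of_real (- 1 / (s^2)\<^sup>2) * (of_real s * f n) + of_real (- 1 / (s^2)\<^sup>2) * (of_real (s ^ 3) * g n)
      + of_real (1 / s ^ 3 * (1 / t)) * (of_real t * f (Suc n))"
    unfolding jacobi_row_def idx using y gap_powr(1)[of n] gap_powr(2)[of "Suc n"] d by (simp add: gap_Suc st)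
  also have "\<dots> = of_real (- 1 / (s^2)\<^sup>2 * s) * f n + of_real (- 1 / (s^2)\<^sup>2 * s ^ 3) * g n + of_real (1 / s ^ 3 * (1 / t) * t) * f (Suc n)"
    by (simp only: of_real_mult mult.assoc)
  also have "- 1 / (s^2)\<^sup>2 * s = - (1 / s ^ 3)" using nz by (simp add: field_simps power2_eq_square power3_eq_cube)
  also have "- 1 / (s^2)\<^sup>2 * s ^ 3 = - (1 / s ^ 3 * s^2)" using nz by (simp add: field_simps power2_eq_square power3_eq_cube)
  also have "1 / s ^ 3 * (1 / t) * t = 1 / s ^ 3" using nz by simp
  also have "of_real (- (1 / s ^ 3)) * f n + of_real (- (1 / s ^ 3 * s^2)) * g n + of_real (1 / s ^ 3) * f (Suc n)
      = of_real (1 / s ^ 3) * (f (Suc n) - f n - of_real (s^2) * g n)"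
    by (simp only: of_real_mult of_real_minus) (simp add: algebra_simps)
  finally show ?thesis by (simp only: d st)
qed

text \<open>The odd rows from 3 on express the jump of the slope at
  \<open>x (Suc n)\<close>.\<close>

lemma B2_row_odd:
  assumes y: "y (2 * n + 2) = of_real (sd n ^ 3) * g n" "y (2 * n + 3) = of_real (sd (Suc n)) * f (Suc n)"
    "y (2 * n + 4) = of_real (sd (Suc n) ^ 3) * g (Suc n)"
  shows "jacobi_row u2 v2 y (2 * n + 3) = - of_real (1 / sd (Suc n)) * (g (Suc n) - g n - of_real (\<alpha> (Suc n)) * f (Suc n))"
proof -
  define s t where st: "s = sd n" "t = sd (Suc n)"
  have nz: "s \<noteq> 0" "t \<noteq> 0" using sd_pos[of n] sd_pos[of "Suc n"] by (auto simp: st)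
  have d: "\<delta> (Suc n) = t^2" by (simp add: st sd_sq)
  have idx: "(2 * n + 3) div 2 = Suc n" "(2 * n + 2) div 2 = Suc n" "2 * n + 3 - 1 = 2 * n + 2" "2 * n + 3 + 1 = 2 * n + 4"
    "(2 * n + 4) div 2 = Suc (Suc n)" by auto
  define A where "A = \<alpha> (Suc n)"
  have "jacobi_row u2 v2 y (2 * n + 3) = of_real (1 / s ^ 3 * (1 / t)) * (of_real (s ^ 3) * g n) + of_real (A / t^2) * (of_real t * f (Suc n))
      + of_real (- 1 / (t^2)\<^sup>2) * (of_real (t ^ 3) * g (Suc n))"
    unfolding jacobi_row_def idx using y gap_powr(1)[of n] gap_powr(2)[of "Suc n"] d by (simp add: gap_Suc st A_def)
  also have "\<dots> = of_real (1 / s ^ 3 * (1 / t) * s ^ 3) * g n + of_real (A / t^2 * t) * f (Suc n) + of_real (- 1 / (t^2)\<^sup>2 * t ^ 3) * g (Suc n)"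
    by (simp only: of_real_mult mult.assoc)
  also have "1 / s ^ 3 * (1 / t) * s ^ 3 = 1 / t" using nz by simp
  also have "A / t^2 * t = 1 / t * A" using nz by (simp add: field_simps power2_eq_square)
  also have "- 1 / (t^2)\<^sup>2 * t ^ 3 = - (1 / t)" using nz by (simp add: field_simps power2_eq_square power3_eq_cube)
  also have "of_real (1 / t) * g n + of_real (1 / t * A) * f (Suc n) + of_real (- (1 / t)) * g (Suc n)
      = - of_real (1 / t) * (g (Suc n) - g n - of_real A * f (Suc n))"
    by (simp only: of_real_mult of_real_minus) (simp add: algebra_simps)
  finally show ?thesis by (simp only: st A_def)
qed

text \<open>Here the rows from 2 on are equivalent to the full system \<open>zero_seq\<close>, and
  the sequence contains both \<open>f 0\<close> and \<open>g 0\<close>; in contrast to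
  \<open>B1\<close> nothing has to be extrapolated.\<close>

lemma B2_limit_circle:
  "(\<forall>y. (\<forall>n\<ge>2. jacobi_row u2 v2 y n = 0) \<longrightarrow> y \<in> L2 l2_measure) \<longleftrightarrow> limit_circle"
proof -
  have key: "(\<forall>n\<ge>2. jacobi_row u2 v2 y n = 0) \<longleftrightarrow> zero_seq f g"
    "zero_seq f g \<Longrightarrow> y \<in> L2 l2_measure \<longleftrightarrow> summable (\<lambda>n. \<delta> n * ((cmod (f n))\<^sup>2 + (cmod (f (Suc n)))\<^sup>2))"
    if y: "\<And>n. y (2 * n + 1) = of_real (sd n) * f n" "\<And>n. y (2 * n + 2) = of_real (sd n ^ 3) * g n"
    for y f g
  proof -
    have y3: "y (2 * n + 3) = of_real (sd (Suc n)) * f (Suc n)" "y (2 * n + 4) = of_real (sd (Suc n) ^ 3) * g (Suc n)" for n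
      using y(1)[of "Suc n"] y(2)[of "Suc n"] by (simp_all add: eval_nat_numeral)
    have nz: "of_real (1 / sd n ^ 3) \<noteq> (0::complex)" "- of_real (1 / sd n) \<noteq> (0::complex)" for n
      using sd_pos[of n] by auto
    have even: "jacobi_row u2 v2 y (2 * n + 2) = 0 \<longleftrightarrow> f (Suc n) = f n + of_real (\<delta> n) * g n" for n
    proof -
      have "jacobi_row u2 v2 y (2 * n + 2) = of_real (1 / sd n ^ 3) * (f (Suc n) - f n - of_real (\<delta> n) * g n)"
        by (rule B2_row_even[where y=y and g=g and f=f, OF y y3(1)])
      then show ?thesis using nz(1)[of n] by (simp only: mult_eq_0_iff diff_diff_eq right_minus_eq) simp
    qed
    have odd: "jacobi_row u2 v2 y (2 * n + 3) = 0 \<longleftrightarrow> g (Suc n) = g n + of_real (\<alpha> (Suc n)) * f (Suc n)" for n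
    proof -
      have "jacobi_row u2 v2 y (2 * n + 3) = - of_real (1 / sd (Suc n)) * (g (Suc n) - g n - of_real (\<alpha> (Suc n)) * f (Suc n))"
        by (rule B2_row_odd[where y=y and g=g and f=f, OF y(2) y3])
      then show ?thesis using nz(2)[of "Suc n"] by (simp only: mult_eq_0_iff diff_diff_eq right_minus_eq) simp
    qed
    have "(\<forall>n\<ge>2. jacobi_row u2 v2 y n = 0)
      \<longleftrightarrow> (\<forall>n. jacobi_row u2 v2 y (2 * n + 2) = 0 \<and> jacobi_row u2 v2 y (2 * n + 3) = 0)"
    proof (intro iffI allI impI)
      fix n :: nat assume all: "\<forall>n. jacobi_row u2 v2 y (2 * n + 2) = 0 \<and> jacobi_row u2 v2 y (2 * n + 3) = 0" and n: "n \<ge> 2"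
      have "n = 2 * ((n - 2) div 2) + 2 \<or> n = 2 * ((n - 2) div 2) + 3" using n by arith
      then obtain m where "n = 2 * m + 2 \<or> n = 2 * m + 3" by blast
      then show "jacobi_row u2 v2 y n = 0" using all[rule_format, of m] by (elim disjE) (simp_all only:)
    qed auto
    then show "(\<forall>n\<ge>2. jacobi_row u2 v2 y n = 0) \<longleftrightarrow> zero_seq f g"
      unfolding even odd zero_seq_def .
    assume fg: "zero_seq f g"
    let ?Z = "\<lambda>n. \<delta> n * ((cmod (f n))\<^sup>2 + (cmod (f (Suc n)))\<^sup>2)"
    \<comment> \<open>The length times the slope is the increment of \<open>f\<close>, so a slope
      entry contributes the square of that increment times the length.\<close>
    let ?P = "\<lambda>n. \<delta> n * ((cmod (f n))\<^sup>2 + (cmod (f (Suc n) - f n))\<^sup>2)"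
    have pair: "(cmod (y (2 * n + 1)))\<^sup>2 + (cmod (y (2 * n + 2)))\<^sup>2 = ?P n" for n
    proof -
      have "f (Suc n) - f n = of_real (\<delta> n) * g n" using fg by (simp add: zero_seq_def)
      then have "\<delta> n * (cmod (f (Suc n) - f n))\<^sup>2 = \<delta> n * (\<delta> n * \<delta> n) * (cmod (g n))\<^sup>2"
        using \<delta>_pos[of n] by (simp only: norm_mult norm_of_real power_mult_distrib) (simp add: power2_eq_square)
      also have "\<delta> n * (\<delta> n * \<delta> n) = (sd n ^ 3)\<^sup>2" unfolding sd_sq[symmetric] by algebra
      finally have "\<delta> n * (cmod (f (Suc n) - f n))\<^sup>2 = (cmod (y (2 * n + 2)))\<^sup>2"
        unfolding y(2) norm_mult norm_of_real power_mult_distrib by simp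
      moreover have "(cmod (y (2 * n + 1)))\<^sup>2 = \<delta> n * (cmod (f n))\<^sup>2"
        unfolding y(1) norm_mult norm_of_real power_mult_distrib power2_abs sd_sq ..
      ultimately show ?thesis by (simp only: distrib_left)
    qed
    have "y \<in> L2 l2_measure \<longleftrightarrow> summable (\<lambda>n. (cmod (y (Suc n)))\<^sup>2)"
      unfolding L2_l2_iff by (rule summable_Suc_iff[symmetric])
    also have "\<dots> \<longleftrightarrow> summable (\<lambda>n. (cmod (y (Suc (2 * n))))\<^sup>2 + (cmod (y (Suc (2 * n + 1))))\<^sup>2)"
      by (rule summable_pairs) simp
    also have "\<dots> \<longleftrightarrow> summable ?P" using pair by simp
    also have "\<dots> \<longleftrightarrow> summable ?Z"
    proof -
      have sq: "(cmod (a + c))\<^sup>2 \<le> 2 * (cmod a)\<^sup>2 + 2 * (cmod c)\<^sup>2" for a c :: complex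
      proof -
        have "(cmod (a + c))\<^sup>2 \<le> (cmod a + cmod c)\<^sup>2" by (simp add: norm_triangle_ineq power_mono)
        also have "\<dots> \<le> 2 * (cmod a)\<^sup>2 + 2 * (cmod c)\<^sup>2"
          using sum_squares_bound[of "cmod a" "cmod c"] by (simp add: power2_sum)
        finally show ?thesis .
      qed
      have PZ: "?P n \<le> 3 * ?Z n" for n
      proof -
        have "(cmod (f n))\<^sup>2 + (cmod (f (Suc n) - f n))\<^sup>2 \<le> 3 * ((cmod (f n))\<^sup>2 + (cmod (f (Suc n)))\<^sup>2)"
          using sq[of "f (Suc n)" "- f n"] by (intro triple_bound) simp_all
        from mult_left_mono[OF this, of "\<delta> n"] show ?thesis using \<delta>_pos[of n] by (simp add: mult.left_commute)
      qed
      have ZP: "?Z n \<le> 3 * ?P n" for n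
      proof -
        have "(cmod (f n))\<^sup>2 + (cmod (f (Suc n)))\<^sup>2 \<le> 3 * ((cmod (f n))\<^sup>2 + (cmod (f (Suc n) - f n))\<^sup>2)"
          using sq[of "f (Suc n) - f n" "f n"] by (intro triple_bound) simp_all
        from mult_left_mono[OF this, of "\<delta> n"] show ?thesis using \<delta>_pos[of n] by (simp add: mult.left_commute)
      qed
      have P0: "0 \<le> ?P n" and Z0: "0 \<le> ?Z n" for n using \<delta>_pos[of n] by auto
      show ?thesis
        using summable_bound[OF summable_mult Z0 ZP] summable_bound[OF summable_mult P0 PZ] by (rule iffI)
    qed
    finally show "y \<in> L2 l2_measure \<longleftrightarrow> summable ?Z" .
  qed
  show ?thesis
  proof
    assume all: "\<forall>y. (\<forall>n\<ge>2. jacobi_row u2 v2 y n = 0) \<longrightarrow> y \<in> L2 l2_measure"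
    show limit_circle unfolding limit_circle_def
    proof (intro allI impI)
      fix f g assume fg: "zero_seq f g"
      \<comment> \<open>For even \<open>k\<close> at least 2 the piece index is
        \<open>k div 2 - 1\<close>. Entry 0 gets an arbitrary value by truncated subtraction, which
        \<open>l2_measure\<close> ignores.\<close>
      define y where "y k = (if odd k then of_real (sd (k div 2)) * f (k div 2) else of_real (sd (k div 2 - 1) ^ 3) * g (k div 2 - 1))" for k
      have y: "y (2 * n + 1) = of_real (sd n) * f n" "y (2 * n + 2) = of_real (sd n ^ 3) * g n" for n
        by (simp_all add: y_def)
      show "summable (\<lambda>n. \<delta> n * ((cmod (f n))\<^sup>2 + (cmod (f (Suc n)))\<^sup>2))"
        using key(1)[OF y] key(2)[OF y fg] all fg by blast
    qed
  next
    assume lc: limit_circle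
    show "\<forall>y. (\<forall>n\<ge>2. jacobi_row u2 v2 y n = 0) \<longrightarrow> y \<in> L2 l2_measure"
    proof (intro allI impI)
      fix y assume rows: "\<forall>n\<ge>2. jacobi_row u2 v2 y n = 0"
      define f where "f n = y (2 * n + 1) / of_real (sd n)" for n
      define g where "g n = y (2 * n + 2) / of_real (sd n ^ 3)" for n
      have nz: "of_real (sd n) \<noteq> (0::complex)" for n using sd_pos[of n] by simp
      have y: "y (2 * n + 1) = of_real (sd n) * f n" "y (2 * n + 2) = of_real (sd n ^ 3) * g n" for n
        using nz[of n] by (simp_all add: f_def g_def)
      have "zero_seq f g" using key(1)[OF y] rows by blast
      then show "y \<in> L2 l2_measure" using key(2)[OF y] lc unfolding limit_circle_def by blast
    qed
  qed
qed

theorem B1_deficiency: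
  "n_plus l2_measure (min_op (B1 x \<alpha>)) = (if limit_circle then 1 else 0)"
  "n_minus l2_measure (min_op (B1 x \<alpha>)) = (if limit_circle then 1 else 0)"
  "op_selfadjoint l2_measure (min_op (B1 x \<alpha>)) \<longleftrightarrow> \<not> limit_circle"
proof -
  have v: "v1 n \<noteq> 0" if n: "n \<ge> 1" for n
  proof -
    obtain m where "n = Suc m" using n by (cases n) auto
    then show ?thesis using rr_pos[of m] rr_pos[of "Suc m"] \<delta>_pos[of "Suc m"] by (simp add: gap_Suc)
  qed
  note D = jacobi_deficiency[of v1 u1, OF v B1_limit_circle]
  show "n_plus l2_measure (min_op (B1 x \<alpha>)) = (if limit_circle then 1 else 0)" unfolding B1_def by (rule D(1))
  show "n_minus l2_measure (min_op (B1 x \<alpha>)) = (if limit_circle then 1 else 0)" unfolding B1_def by (rule D(2))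
  show "op_selfadjoint l2_measure (min_op (B1 x \<alpha>)) \<longleftrightarrow> \<not> limit_circle" unfolding B1_def by (rule D(3))
qed

theorem B2_deficiency:
  "n_plus l2_measure (min_op (B2 x \<alpha>)) = (if limit_circle then 1 else 0)"
  "n_minus l2_measure (min_op (B2 x \<alpha>)) = (if limit_circle then 1 else 0)"
  "op_selfadjoint l2_measure (min_op (B2 x \<alpha>)) \<longleftrightarrow> \<not> limit_circle"
proof -
  have v: "v2 n \<noteq> 0" if n: "n \<ge> 1" for n
  proof -
    have g: "gap x k > 0" if k: "k \<ge> 1" for k
    proof -
      obtain m where "k = Suc m" using k by (cases k) auto
      then show ?thesis using \<delta>_pos[of m] by (simp add: gap_Suc)
    qed
    show ?thesis
    proof (cases "odd n")
      case True
      then show ?thesis using g[of "(n + 1) div 2"] n by auto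
    next
      case False
      then have "n div 2 \<ge> 1" using n by auto
      then show ?thesis using g[of "n div 2"] g[of "n div 2 + 1"] False by simp
    qed
  qed
  note D = jacobi_deficiency[of v2 u2, OF v B2_limit_circle]
  show "n_plus l2_measure (min_op (B2 x \<alpha>)) = (if limit_circle then 1 else 0)" unfolding B2_def by (rule D(1))
  show "n_minus l2_measure (min_op (B2 x \<alpha>)) = (if limit_circle then 1 else 0)" unfolding B2_def by (rule D(2))
  show "op_selfadjoint l2_measure (min_op (B2 x \<alpha>)) \<longleftrightarrow> \<not> limit_circle" unfolding B2_def by (rule D(3))
qed

end

theorem theorem5p4:
  fixes b :: ereal and x \<alpha> :: "nat \<Rightarrow> real"
  assumes "0 < b"
    and "x 0 = 0" and "strict_mono x"
    and "\<And>n. ereal (x n) < b"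
    and "(\<lambda>n. ereal (x n)) \<longlonglongrightarrow> b"
    and "bdd_above (gap x ` {1..})"
  defines "L \<equiv> lebesgue_on (half_open b)"
    and "H \<equiv> H_op b x \<alpha>"
  shows "n_plus L H = n_minus L H \<and> n_plus L H \<le> 1 \<and>
    (\<forall>A \<in> {B1 x \<alpha>, B2 x \<alpha>}.
       n_plus L H = n_plus l2_measure (min_op A) \<and>
       n_minus L H = n_minus l2_measure (min_op A) \<and>
       (op_selfadjoint L H \<longleftrightarrow> op_selfadjoint l2_measure (min_op A)))"
proof -
  interpret point_interactions b x \<alpha>
    by unfold_locales (use assms in auto)
  \<comment> \<open>Every index equals \<open>if limit_circle then 1 else 0\<close>, and each
    operator is self-adjoint exactly when \<open>limit_circle\<close> fails.\<close>
  show ?thesis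
    using H_deficiency B1_deficiency B2_deficiency unfolding L_def H_def I_def by simp
qed

end
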